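(* Let $k\geq 2$ be an integer, and let $G$ be a connected weak $k$-bicritical graph. Then $\operatorname{diam}(G)\leq 2k-2$, with equality if and only if $G\in \mathcal{F}^{*}_{k}$ (up to isomorphism).
   Context: All graphs are finite, simple and undirected. For a graph $G$, a set $S\subseteq V(G)$ is dominating if every vertex of $G$ is in $S$ or adjacent to a vertex of $S$; $\gamma(G)$ is the minimum size of a dominating set. Define $V^{0}(G)=\{x:\gamma(G-x)=\gamma(G)\}$, $V^{+}(G)=\{x:\gamma(G-x)>\gamma(G)\}$, $V^{-}(G)=\{x:\gamma(G-x)<\gamma(G)\}$. A vertex in $V^{-}(G)$ is called critical; $G$ is critical if $V(G)=V^{-}(G)$, and $k$-critical if moreover $\gamma(G)=k$. $G$ is weak bicritical if $V^{+}(G)=\emptyset$ and $G-x$ is critical for every $x\in V^{0}(G)$; weak $k$-bicritical if moreover $\gamma(G)=k$. $d_G(x,y)$ is the distance, $\operatorname{diam}(G)=\max_{x,y}d_G(x,y)$, and a vertex $x$ is diametrical if $\max_y d_G(x,y)=\operatorname{diam}(G)$. $\overline{H}$ denotes the complement of $H$, $sH$ the disjoint union of $s$ copies of $H$, $K_n$, $P_n$ the complete graph and path on $n$ vertices. The family $\mathcal{F}_k$ ($k\geq 2$): for integers $m_1,\dots,m_{k-1}\geq 2$, let $G_i\cong\overline{m_iK_2}$ (the complete graph on $2m_i$ vertices minus a perfect matching) and choose $u_i,v_i\in V(G_i)$ with $u_iv_i\notin E(G_i)$; $G(m_1,\dots,m_{k-1})$ is obtained from $G_1,\dots,G_{k-1}$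 by identifying $v_i$ with $u_{i+1}$ for each $1\leq i\leq k-2$. Then $\mathcal{F}_k=\{G(m_1,\dots,m_{k-1}): m_i\geq 2\}$. The family $\mathcal{F}^{*}_k$ and its identifiable vertices are defined recursively. $\mathcal{F}^{*}_2=\{\overline{(m+1)K_2},\ \overline{mK_2\cup K_3},\ \overline{mK_2\cup P_3}: m\geq 1\}$; for $G\in\mathcal{F}^{*}_2$ a vertex $x$ is identifiable if $x\in V^{-}(G)$. For $k\geq 3$: $\mathcal{F}'_k$ is the family of graphs obtained from $H_1\in\mathcal{F}_{k_1}$ and $H_2\in\mathcal{F}^{*}_{k_2}$, with $k_1,k_2\geq 2$ and $k_1+k_2-1=k$, by identifying a diametrical vertex of $H_1$ with an identifiable vertex of $H_2$. For $m_1,m_2\geq 2$ let $u$ be the unique cut vertex of $G(m_1,m_2)\in\mathcal{F}_3$; $G^{1}(m_1,m_2)$ is obtained from $G(m_1,m_2)$ by adding a new vertex $u'$ joined to all vertices of $N_{G(m_1,m_2)}(u)$, and $G^{2}(m_1,m_2)=G^{1}(m_1,m_2)+uu'$. Set $\mathcal{F}''_3=\{G^{1}(m_1,m_2),G^{2}(m_1,m_2): m_1,m_2\geq 2\}$ and $\mathcal{F}''_k=\emptyset$ for $k\geq 4$. Then $\mathcal{F}^{*}_k=\mathcal{F}'_k\cup\mathcal{F}''_k$ for $k\geq 3$, and for $G\in\mathcal{F}^{*}_k$ ($k\geq 3$) a vertex $x$ is identifiable if $x\in V^{-}(G)$ and $x$ is a diametrical vertex of $G$. *)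

theory Defs
  imports "Graph_Theory.Graph_Theory" "HOL-Library.Extended_Nat"
begin

text \<open>
  Finite simple undirected graphs are the graphs satisfying the locale predicate
  \<^const>\<open>pair_graph\<close>; an edge is a pair of opposite arcs.
\<close>

type_synonym 'a sgraph = "'a pair_pre_digraph"

abbreviation isomorphic :: "'a sgraph \<Rightarrow> 'b sgraph \<Rightarrow> bool"  (infix \<open>\<cong>\<^sub>G\<close> 50) where
  "G \<cong>\<^sub>G H \<equiv> digraph_iso (with_proj G) (with_proj H)"


subsection \<open>Domination and criticality\<close>

definition dominating :: "'a sgraph \<Rightarrow> 'a set \<Rightarrow> bool" where
  "dominating G S \<longleftrightarrow>
     S \<subseteq> pverts G \<and> (\<forall>x\<in>pverts G. x \<in> S \<or> (\<exists>s\<in>S. (x, s) \<in> parcs G))"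

definition domination_number :: "'a sgraph \<Rightarrow> nat"  (\<open>\<gamma>\<close>) where
  "\<gamma> G = Min (card ` {S. dominating G S})"

definition delete_vertex :: "'a sgraph \<Rightarrow> 'a \<Rightarrow> 'a sgraph" where
  "delete_vertex G x =
     \<lparr>pverts = pverts G - {x}, parcs = {(a, b) \<in> parcs G. a \<noteq> x \<and> b \<noteq> x}\<rparr>"

lemma with_proj_delete_vertex:
  "with_proj (delete_vertex G x) = pre_digraph.del_vert (with_proj G) x"
  by (auto simp: delete_vertex_def with_proj_def pre_digraph.del_vert_def)

definition V_zero :: "'a sgraph \<Rightarrow> 'a set" where
  "V_zero G = {x \<in> pverts G. \<gamma> (delete_vertex G x) = \<gamma> G}"

definition V_plus :: "'a sgraph \<Rightarrow> 'a set" where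
  "V_plus G = {x \<in> pverts G. \<gamma> (delete_vertex G x) > \<gamma> G}"

definition V_minus :: "'a sgraph \<Rightarrow> 'a set" where
  "V_minus G = {x \<in> pverts G. \<gamma> (delete_vertex G x) < \<gamma> G}"

definition critical :: "'a sgraph \<Rightarrow> bool" where
  "critical G \<longleftrightarrow> pverts G = V_minus G"

definition weak_bicritical :: "'a sgraph \<Rightarrow> bool" where
  "weak_bicritical G \<longleftrightarrow> V_plus G = {} \<and> (\<forall>x\<in>V_zero G. critical (delete_vertex G x))"

definition weak_k_bicritical :: "nat \<Rightarrow> 'a sgraph \<Rightarrow> bool" where
  "weak_k_bicritical k G \<longleftrightarrow> weak_bicritical G \<and> \<gamma> G = k"


subsection \<open>Distance\<close>

text \<open>The distance between vertices in different components is \<open>\<infinity>\<close>.\<close>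

definition gdist :: "'a sgraph \<Rightarrow> 'a \<Rightarrow> 'a \<Rightarrow> enat" where
  "gdist G x y = (INF p\<in>{p. pre_digraph.awalk (with_proj G) x p y}. enat (length p))"

definition diam :: "'a sgraph \<Rightarrow> enat" where
  "diam G = (SUP x\<in>pverts G. SUP y\<in>pverts G. gdist G x y)"

definition diametrical :: "'a sgraph \<Rightarrow> 'a \<Rightarrow> bool" where
  "diametrical G x \<longleftrightarrow> x \<in> pverts G \<and> (SUP y\<in>pverts G. gdist G x y) = diam G"

definition cut_vertex :: "'a sgraph \<Rightarrow> 'a \<Rightarrow> bool" where
  "cut_vertex G u \<longleftrightarrow> u \<in> pverts G \<and>
     (\<exists>a\<in>pverts G - {u}. \<exists>b\<in>pverts G - {u}.
        a \<rightarrow>\<^sup>*\<^bsub>with_proj G\<^esub> b \<and> \<not> a \<rightarrow>\<^sup>*\<^bsub>with_proj (delete_vertex G u)\<^esub> b)"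


subsection \<open>Graph operations\<close>

definition complete_graph :: "nat \<Rightarrow> nat sgraph" where
  "complete_graph n = \<lparr>pverts = {..<n}, parcs = {(i, j). i < n \<and> j < n \<and> i \<noteq> j}\<rparr>"

lemma complete_digraph_complete_graph: "complete_digraph n (with_proj (complete_graph n))"
proof -
  have "finite (parcs (complete_graph n))"
    by (rule finite_subset[of _ "{..<n} \<times> {..<n}"]) (auto simp: complete_graph_def)
  then have "pair_graph (complete_graph n)"
    by unfold_locales (auto simp: complete_graph_def symmetric_def sym_def)
  then have "graph (with_proj (complete_graph n))"
    by (rule pair_graph.pair_graphD_graph)
  then show ?thesis
    by (auto simp: complete_digraph_def complete_graph_def)
qed

definition path_graph :: "nat \<Rightarrow> nat sgraph" where
  "path_graph n = \<lparr>pverts = {..<n}, parcs = {(i, j). i < n \<and> j < n \<and> (j = Suc i \<or> i = Suc j)}\<rparr>"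

definition graph_complement :: "'a sgraph \<Rightarrow> 'a sgraph" where
  "graph_complement G = \<lparr>pverts = pverts G,
     parcs = {(a, b). a \<in> pverts G \<and> b \<in> pverts G \<and> a \<noteq> b \<and> (a, b) \<notin> parcs G}\<rparr>"

definition disjoint_union :: "'a sgraph \<Rightarrow> 'b sgraph \<Rightarrow> ('a + 'b) sgraph" where
  "disjoint_union G H = \<lparr>pverts = Inl ` pverts G \<union> Inr ` pverts H,
     parcs = map_prod Inl Inl ` parcs G \<union> map_prod Inr Inr ` parcs H\<rparr>"

definition disjoint_sum :: "nat \<Rightarrow> (nat \<Rightarrow> 'a sgraph) \<Rightarrow> (nat \<times> 'a) sgraph" where
  "disjoint_sum n H = \<lparr>pverts = (SIGMA i:{..<n}. pverts (H i)),
     parcs = {((i, a), (i, b)) | i a b. i < n \<and> (a, b) \<in> parcs (H i)}\<rparr>"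

definition copies :: "nat \<Rightarrow> 'a sgraph \<Rightarrow> (nat \<times> 'a) sgraph" where
  "copies s H = disjoint_sum s (\<lambda>_. H)"

text \<open>The quotient of a graph by the kernel of a map \<open>f\<close>: vertices are identified
  exactly when they have the same value under \<open>f\<close>.\<close>

definition identify_along :: "('a \<Rightarrow> 'b) \<Rightarrow> 'a sgraph \<Rightarrow> 'b sgraph" where
  "identify_along f G = \<lparr>pverts = f ` pverts G, parcs = map_prod f f ` parcs G\<rparr>"

definition coalesce :: "'a sgraph \<Rightarrow> 'a \<Rightarrow> 'b sgraph \<Rightarrow> 'b \<Rightarrow> ('a + 'b) sgraph" where
  "coalesce H1 x H2 y = identify_along (id(Inl x := Inr y)) (disjoint_union H1 H2)"

text \<open>A new vertex \<open>None\<close> is joined to all neighbours of \<open>u\<close>.\<close>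

definition add_twin :: "'a sgraph \<Rightarrow> 'a \<Rightarrow> 'a option sgraph" where
  "add_twin G u = \<lparr>pverts = insert None (Some ` pverts G),
     parcs = map_prod Some Some ` parcs G
       \<union> {(None, Some w) | w. (u, w) \<in> parcs G} \<union> {(Some w, None) | w. (u, w) \<in> parcs G}\<rparr>"

definition add_edge :: "'a sgraph \<Rightarrow> 'a \<Rightarrow> 'a \<Rightarrow> 'a sgraph" where
  "add_edge G a b = \<lparr>pverts = pverts G, parcs = parcs G \<union> {(a, b), (b, a)}\<rparr>"


subsection \<open>The families\<close>

text \<open>
  All families below are closed under isomorphism.  Every building block of a member
  embeds in that member, so taking the blocks on the same vertex type is no restriction.
\<close>

abbreviation co_mK2 :: "nat \<Rightarrow> (nat \<times> nat) sgraph" where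
  "co_mK2 m \<equiv> graph_complement (copies m (complete_graph 2))"

text \<open>The graph \<open>G(m\<^sub>1,\<dots>,m\<^sub>n)\<close> for \<open>ms = [m\<^sub>1,\<dots>,m\<^sub>n]\<close>, with indices shifted to start at \<open>0\<close>;
  \<open>v i\<close> in block \<open>i\<close> is identified with \<open>u (Suc i)\<close> in block \<open>Suc i\<close>.\<close>

definition chain :: "nat list \<Rightarrow> (nat \<Rightarrow> nat \<times> nat) \<Rightarrow> (nat \<Rightarrow> nat \<times> nat)
    \<Rightarrow> (nat \<times> nat \<times> nat) sgraph" where
  "chain ms u v = identify_along
     (\<lambda>(i, p). if Suc i < length ms \<and> p = v i then (Suc i, u (Suc i)) else (i, p))
     (disjoint_sum (length ms) (\<lambda>i. co_mK2 (ms ! i)))"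

definition family_F :: "nat \<Rightarrow> 'a sgraph \<Rightarrow> bool" where
  "family_F k G \<longleftrightarrow> k \<ge> 2 \<and> (\<exists>ms u v. length ms = k - 1 \<and> (\<forall>m\<in>set ms. m \<ge> 2) \<and>
     (\<forall>i<length ms. u i \<in> pverts (co_mK2 (ms ! i)) \<and> v i \<in> pverts (co_mK2 (ms ! i)) \<and>
        u i \<noteq> v i \<and> (u i, v i) \<notin> parcs (co_mK2 (ms ! i))) \<and>
     G \<cong>\<^sub>G chain ms u v)"

definition identifiable :: "nat \<Rightarrow> 'a sgraph \<Rightarrow> 'a \<Rightarrow> bool" where
  "identifiable k G x \<longleftrightarrow> x \<in> V_minus G \<and> (k \<ge> 3 \<longrightarrow> diametrical G x)"

inductive family_F_star :: "nat \<Rightarrow> 'a sgraph \<Rightarrow> bool" where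
  co_K2: "family_F_star 2 G" if "m \<ge> 1" and "G \<cong>\<^sub>G co_mK2 (m + 1)"
| co_K2_K3: "family_F_star 2 G" if "m \<ge> 1" and
    "G \<cong>\<^sub>G graph_complement (disjoint_union (copies m (complete_graph 2)) (complete_graph 3))"
| co_K2_P3: "family_F_star 2 G" if "m \<ge> 1" and
    "G \<cong>\<^sub>G graph_complement (disjoint_union (copies m (complete_graph 2)) (path_graph 3))"
| coalesced: "family_F_star k G" if "k1 \<ge> 2" and "k2 \<ge> 2" and "k1 + k2 - 1 = k"
    and "family_F k1 (H1 :: 'a sgraph)" and "diametrical H1 x"
    and "family_F_star k2 H2" and "identifiable k2 H2 y"
    and "G \<cong>\<^sub>G coalesce H1 x H2 y"
| twin: "family_F_star 3 G" if "family_F 3 (H :: 'a sgraph)" and "cut_vertex H u" and "G \<cong>\<^sub>G add_twin H u"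
| adjacent_twin: "family_F_star 3 G" if "family_F 3 (H :: 'a sgraph)" and "cut_vertex H u"
    and "G \<cong>\<^sub>G add_edge (add_twin H u) (Some u) None"

end

theory Submission
  imports Defs
begin

text \<open>
  Let \<open>k = \<gamma> G\<close>.  For a critical vertex \<open>z\<close> some set \<open>D\<close> with \<open>|D| < k\<close> dominates \<open>G - z\<close>, and \<open>D\<close>
  avoids the closed neighbourhood of \<open>z\<close>; for a noncritical \<open>z\<close> and any \<open>v \<noteq> z\<close> some set \<open>D\<close> with
  \<open>|D| < k\<close> dominates \<open>G - z - v\<close>.  Let \<open>L\<^sub>0, \<dots>, L\<^sub>d\<close> be the distance layers from a vertex \<open>x\<close>.
  Exchanging parts of dominating sets shows that a set dominating \<open>L\<^sub>0, \<dots>, L\<^sub>2\<^sub>j\<close> has at least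
  \<open>j + 1\<close> elements in \<open>L\<^sub>0, \<dots>, L\<^sub>2\<^sub>j\<^sub>+\<^sub>1\<close>, and symmetrically from the other side.  This
  bounds the diameter.  If \<open>d = 2k - 2\<close>, the two counts together determine how a set \<open>D\<close> as above is
  distributed over the layers near its exceptional vertices.

  Hence, for \<open>k \<ge> 3\<close>, if all vertices of \<open>L\<^sub>0 \<union> L\<^sub>1 \<union> L\<^sub>2\<close> are critical, then \<open>L\<^sub>2\<close> is a single cut
  vertex \<open>w\<close> and \<open>L\<^sub>0 \<union> L\<^sub>1 \<union> L\<^sub>2\<close> spans a complete graph minus a perfect matching; splitting it off
  at \<open>w\<close> leaves a weak \<open>(k - 1)\<close>-bicritical graph, and induction applies.  A noncritical vertex of
  \<open>L\<^sub>2\<close> forces \<open>L\<^sub>2\<close> to be a pair of twins.  Noncritical vertices cannot occur near both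
  ends of a diametrical path unless \<open>k = 3\<close> and the middle layer is such a pair, so one of the two
  ends can always be split off otherwise.  For \<open>k = 2\<close> one analyses the complement.
\<close>

section \<open>Walk distance in a relation\<close>

text \<open>Applied to all layers \<open>0\<close> to \<open>2 * k - 2\<close>, the count asks for
  \<open>k\<close> vertices, one more than \<open>D\<close> has; only the exceptional vertices allow
  \<open>D\<close> to be short. So the place of the exceptions dictates where the elements of
  \<open>D\<close> lie: a block free of exceptions must be served in full, and little is left for
  the rest. The obstacle is noncriticality, for then no small set with a single exception exists,
  and the second exception costs control. Two noncritical vertices are good again: \<open>D\<close>
  avoids both closed neighbourhoods, and exchanging one or two elements tends to give a set with a
  single exception, which makes one of the two critical. Splitting at \<open>w\<close> has to yield
  more than a smaller extremal graph: \<open>w\<close> must be critical and diametrical in the rest,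
  as only such vertices may be glued. Its criticality there comes from the set that belongs to
  \<open>w\<close> in \<open>G\<close>, with its only element below layer three, the end vertex,
  removed. The argument is carried out for a vertex set and a relation with a fixed number
  \<open>k\<close>; \<gamma> occurs only in the translation from and to graphs.\<close>

definition rdist :: "('a \<times> 'a) set \<Rightarrow> 'a \<Rightarrow> 'a \<Rightarrow> nat" where
  "rdist E x v = (LEAST n. (x, v) \<in> E ^^ n)"

lemma rdist_le: "(x, v) \<in> E ^^ n \<Longrightarrow> rdist E x v \<le> n"
  unfolding rdist_def by (rule Least_le)

lemma relpow_rdist: "(x, v) \<in> E\<^sup>* \<Longrightarrow> (x, v) \<in> E ^^ rdist E x v"
  unfolding rdist_def by (metis LeastI rtrancl_power)

lemma rdist_refl [simp]: "rdist E x x = 0"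
  using rdist_le[of x x 0 E] by simp

lemma rdist_eq_0D: "(x, v) \<in> E\<^sup>* \<Longrightarrow> rdist E x v = 0 \<Longrightarrow> v = x"
  using relpow_rdist[of x v E] by simp

lemma rdist_step: "(x, a) \<in> E\<^sup>* \<Longrightarrow> (a, b) \<in> E \<Longrightarrow> rdist E x b \<le> rdist E x a + 1"
  using rdist_le[of x b "Suc (rdist E x a)" E] relpow_rdist[of x a E] by auto

lemma rdist_pred:
  assumes "(x, v) \<in> E\<^sup>*" "rdist E x v = Suc n"
  obtains u where "(x, u) \<in> E\<^sup>*" "(u, v) \<in> E" "rdist E x u = n"
proof -
  from relpow_rdist[OF assms(1)] assms(2) obtain u where u: "(x, u) \<in> E ^^ n" "(u, v) \<in> E"
    by auto
  then have xu: "(x, u) \<in> E\<^sup>*" by (metis rtrancl_power)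
  have "rdist E x u \<le> n" using u by (simp add: rdist_le)
  moreover have "Suc n \<le> rdist E x u + 1" using rdist_step[OF xu u(2)] assms(2) by simp
  ultimately show ?thesis using that xu u by auto
qed

text \<open>Walking back from \<open>y\<close> through predecessors lowers the distance by exactly
  one at a time. This is what makes all layers nonempty.\<close>

lemma rdist_attained:
  assumes "(x, y) \<in> E\<^sup>*" "i \<le> rdist E x y"
  obtains v where "(x, v) \<in> E\<^sup>*" "rdist E x v = i"
proof -
  have "\<exists>v. (x, v) \<in> E\<^sup>* \<and> rdist E x v = i" if "(x, y) \<in> E\<^sup>*" "rdist E x y = i + n" for n y
    using that
  proof (induction n arbitrary: y)
    case (Suc n)
    then show ?case using rdist_pred[of x y E "i + n"] by (metis add_Suc_right)
  qed auto
  then show ?thesis using that assms le_Suc_ex by metis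
qed

lemma relpow_sym: "sym E \<Longrightarrow> (x, y) \<in> E ^^ n \<Longrightarrow> (y, x) \<in> E ^^ n"
proof (induction n arbitrary: y)
  case (Suc n)
  then obtain z where "(x, z) \<in> E ^^ n" "(z, y) \<in> E" by auto
  with Suc have "(z, x) \<in> E ^^ n" "(y, z) \<in> E" by (auto dest: symD)
  then show ?case by (meson relpow_Suc_I2)
qed auto

lemma rdist_sym: "sym E \<Longrightarrow> rdist E x y = rdist E y x"
  unfolding rdist_def by (metis relpow_sym)


section \<open>Domination in a weak bicritical graph\<close>

text \<open>\<open>S\<close> need not lie inside \<open>X\<close>, so the same predicate covers
  domination of a graph, of a graph minus exceptional vertices, and of a block of layers from
  outside the block.\<close>

definition dominates_set :: "('a \<times> 'a) set \<Rightarrow> 'a set \<Rightarrow> 'a set \<Rightarrow> bool" where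
  "dominates_set E S X \<longleftrightarrow> (\<forall>v\<in>X. \<exists>s\<in>S. s = v \<or> (v, s) \<in> E)"

lemma dominates_setE:
  assumes "dominates_set E S X" "v \<in> X"
  obtains s where "s \<in> S" "s = v \<or> (v, s) \<in> E"
  using assms unfolding dominates_set_def by blast

text \<open>The complement of a perfect matching on \<open>X\<close>. The pairing is described from
  one side only: apart from \<open>p\<close> itself, nothing but \<open>v\<close> may miss
  \<open>p\<close>.\<close>

definition comatching :: "('a \<times> 'a) set \<Rightarrow> 'a set \<Rightarrow> bool" where
  "comatching E X \<longleftrightarrow> (\<forall>v\<in>X. \<exists>p\<in>X. p \<noteq> v \<and> (v, p) \<notin> E \<and>
     (\<forall>u\<in>X. u \<noteq> v \<longrightarrow> u \<noteq> p \<longrightarrow> (u, p) \<in> E))"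

text \<open>The pairing is an involution: the partner \<open>q\<close> of \<open>p\<close> misses
  \<open>p\<close>, and the only vertex that may do so is \<open>v\<close>. Hence \<open>v\<close>
  also sees everything except \<open>p\<close>.\<close>

lemma comatchingE:
  assumes "comatching E X" "sym E" "v \<in> X"
  obtains p where "p \<in> X" "p \<noteq> v" "(v, p) \<notin> E" "(p, v) \<notin> E"
    "\<And>u. u \<in> X \<Longrightarrow> u \<noteq> v \<Longrightarrow> u \<noteq> p \<Longrightarrow> (u, p) \<in> E \<and> (u, v) \<in> E"
proof -
  obtain p where p: "p \<in> X" "p \<noteq> v" "(v, p) \<notin> E" "\<And>u. u \<in> X \<Longrightarrow> u \<noteq> v \<Longrightarrow> u \<noteq> p \<Longrightarrow> (u, p) \<in> E"
    using assms(1,3) unfolding comatching_def by blast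
  obtain q where q: "q \<in> X" "q \<noteq> p" "(p, q) \<notin> E" "\<And>u. u \<in> X \<Longrightarrow> u \<noteq> p \<Longrightarrow> u \<noteq> q \<Longrightarrow> (u, q) \<in> E"
    using assms(1) p(1) unfolding comatching_def by blast
  have "(q, p) \<notin> E" using q(3) assms(2) by (auto dest: symD)
  then have "q = v" using p(4) q(1,2) by blast
  then show ?thesis using that[of p] p q by blast
qed

locale simple_rel =
  fixes V :: "'a set" and E :: "('a \<times> 'a) set"
  assumes finV: "finite V"
    and EV: "(a, b) \<in> E \<Longrightarrow> a \<in> V \<and> b \<in> V"
    and symE: "(a, b) \<in> E \<Longrightarrow> (b, a) \<in> E"
    and irrE: "(a, a) \<notin> E"
begin

lemma sym: "sym E" by (rule symI) (rule symE)

end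

text \<open>Weak bicriticality as inequalities against a fixed \<open>k\<close>. The second
  alternative says that deleting \<open>z\<close> does not lower the number, while deleting any
  further vertex does. In this form the property can be checked on a part of the graph without
  computing a minimum.\<close>

locale weak_bicritical_rel = simple_rel +
  fixes k :: nat
  assumes dominating_ge: "S \<subseteq> V \<Longrightarrow> dominates_set E S V \<Longrightarrow> k \<le> card S"
    and crit_or: "z \<in> V \<Longrightarrow>
      (\<exists>D\<subseteq>V - {z}. card D < k \<and> dominates_set E D (V - {z})) \<or>
      (\<forall>S\<subseteq>V - {z}. dominates_set E S (V - {z}) \<longrightarrow> k \<le> card S) \<and>
      (\<forall>v\<in>V - {z}. \<exists>D\<subseteq>V - {z, v}. card D < k \<and> dominates_set E D (V - {z, v}))"
begin

definition crit :: "'a \<Rightarrow> bool" where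
  "crit z \<longleftrightarrow> (\<exists>D\<subseteq>V - {z}. card D < k \<and> dominates_set E D (V - {z}))"

lemma critI: "D \<subseteq> V \<Longrightarrow> z \<notin> D \<Longrightarrow> card D < k \<Longrightarrow> dominates_set E D (V - {z}) \<Longrightarrow> crit z"
  unfolding crit_def by blast

text \<open>An element of \<open>D\<close> adjacent to \<open>z\<close> would make \<open>D\<close>
  dominate all of \<open>V\<close> with fewer than \<open>k\<close> vertices.\<close>

lemma critE:
  assumes "crit z" "z \<in> V"
  obtains D where "D \<subseteq> V" "z \<notin> D" "card D < k" "dominates_set E D (V - {z})" "\<And>s. s \<in> D \<Longrightarrow> (z, s) \<notin> E"
proof -
  obtain D where D: "D \<subseteq> V - {z}" "card D < k" "dominates_set E D (V - {z})"
    using assms(1) unfolding crit_def by blast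
  have "(z, s) \<notin> E" if "s \<in> D" for s
  proof
    assume "(z, s) \<in> E"
    then have "dominates_set E D V" using D(3) that unfolding dominates_set_def by blast
    then show False using dominating_ge[of D] D by force
  qed
  then show ?thesis using that[of D] D by blast
qed

text \<open>An element of \<open>D\<close> adjacent to \<open>v\<close> would make \<open>D\<close>
  a small set for \<open>z\<close> alone, so that \<open>z\<close> were critical. If
  \<open>v\<close> is noncritical too, the same argument applies with the roles exchanged.\<close>

lemma noncritE:
  assumes "\<not> crit z" "z \<in> V" "v \<in> V" "v \<noteq> z"
  obtains D where "D \<subseteq> V" "z \<notin> D" "v \<notin> D" "card D < k" "dominates_set E D (V - {z, v})"
    "\<And>s. s \<in> D \<Longrightarrow> (v, s) \<notin> E" "\<And>s. \<not> crit v \<Longrightarrow> s \<in> D \<Longrightarrow> (z, s) \<notin> E"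
proof -
  from crit_or[OF assms(2)] assms(1)
  have low: "\<And>S. S \<subseteq> V - {z} \<Longrightarrow> dominates_set E S (V - {z}) \<Longrightarrow> k \<le> card S"
    and ex: "\<forall>v\<in>V - {z}. \<exists>D\<subseteq>V - {z, v}. card D < k \<and> dominates_set E D (V - {z, v})"
    unfolding crit_def by auto
  obtain D where D: "D \<subseteq> V - {z, v}" "card D < k" "dominates_set E D (V - {z, v})"
    using ex assms by blast
  have 1: "(v, s) \<notin> E" if "s \<in> D" for s
  proof
    assume "(v, s) \<in> E"
    then have "dominates_set E D (V - {z})" using D(3) that unfolding dominates_set_def by blast
    then show False using low[of D] D by force
  qed
  have 2: "(z, s) \<notin> E" if "\<not> crit v" "s \<in> D" for s
  proof
    assume "(z, s) \<in> E"
    then have "dominates_set E D (V - {v})" using D(3) that unfolding dominates_set_def by blast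
    then show False using that critI[of D v] D by blast
  qed
  show ?thesis using that[of D] D 1 2 by blast
qed

lemma noncrit2E:
  assumes "\<not> crit z" "\<not> crit v" "z \<in> V" "v \<in> V" "v \<noteq> z"
  obtains D where "D \<subseteq> V" "z \<notin> D" "v \<notin> D" "card D < k" "dominates_set E D (V - {z, v})"
    "\<And>s. s \<in> D \<Longrightarrow> (v, s) \<notin> E" "\<And>s. s \<in> D \<Longrightarrow> (z, s) \<notin> E"
  by (rule noncritE[OF assms(1,3-5)]) (use assms(2) that in blast)

text \<open>A critical vertex needs only one exception, and a second one does no harm. Thus the
  layer count can be proved without asking which vertices are critical.\<close>

lemma two_exceptions:
  assumes "v \<in> V" "v' \<in> V" "v \<noteq> v'"
  obtains D where "D \<subseteq> V" "card D < k" "dominates_set E D (V - {v, v'})"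
proof (cases "crit v")
  case True
  then obtain D where D: "D \<subseteq> V" "card D < k" "dominates_set E D (V - {v})"
    by (rule critE[OF _ assms(1)]) (rule that)
  then have "dominates_set E D (V - {v, v'})" by (auto simp: dominates_set_def)
  then show ?thesis using that D by blast
next
  case False
  then show ?thesis by (rule noncritE[OF _ assms(1,2) assms(3)[symmetric]]) (rule that)
qed

end

lemma card_split: "finite D \<Longrightarrow> card D = card {s \<in> D. P s} + card {s \<in> D. \<not> P s}"
  by (subst card_Un_disjoint[symmetric]) (auto intro: arg_cong[where f = card])

lemma card_filter_ge_all:
  assumes "finite D" "card D \<le> card {s \<in> D. P s}" "s \<in> D"
  shows "P s"
proof -
  have "{s \<in> D. P s} = D" using assms by (intro card_seteq) auto
  then show ?thesis using assms by blast
qed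

lemma card_filter_le_1_unique:
  assumes "finite D" "card {s \<in> D. P s} \<le> 1" "s \<in> D" "t \<in> D" "P s" "P t"
  shows "s = t"
  using assms card_le_Suc0_iff_eq[of "{s \<in> D. P s}"] by auto

text \<open>The layering is any map onto \<open>0\<close> to \<open>d\<close> that changes by at
  most one along edges. It need not be a distance, because reversed layers and distances cut off at
  \<open>d\<close> have to qualify as well.\<close>

locale layered = weak_bicritical_rel +
  fixes l :: "'a \<Rightarrow> nat" and d :: nat
  assumes lip: "(a, b) \<in> E \<Longrightarrow> l b \<le> l a + 1"
    and layer_le: "v \<in> V \<Longrightarrow> l v \<le> d"
    and layer_nonempty: "i \<le> d \<Longrightarrow> \<exists>v\<in>V. l v = i"
begin

lemma lip': "(a, b) \<in> E \<Longrightarrow> l a \<le> l b + 1"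
  using lip symE by blast

text \<open>If the bound grew by less than one over two layers, a set doing the work on the lower layers
  could replace the corresponding part of a set of size less than \<open>k\<close> that misses
  only vertices of those two layers.\<close>

lemma card_dominating_lower_layers:
  assumes "S \<subseteq> V" "dominates_set E S {v \<in> V. l v \<le> 2 * j}" "2 * j \<le> d"
  shows "j + 1 \<le> card {s \<in> S. l s \<le> 2 * j + 1}"
  using assms
proof (induction j arbitrary: S)
  case 0
  obtain x where x: "x \<in> V" "l x = 0" using layer_nonempty[of 0] by auto
  then obtain s where s: "s \<in> S" "s = x \<or> (x, s) \<in> E" using 0(2) by (auto elim: dominates_setE)
  then have "l s \<le> 1" using lip[of x s] x by auto
  then have "s \<in> {s \<in> S. l s \<le> 2 * 0 + 1}" using s by auto
  moreover have "finite {s \<in> S. l s \<le> 2 * 0 + 1}" using 0 finV by (auto intro: finite_subset)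
  ultimately show ?case by (metis Suc_leI add_0 card_gt_0_iff empty_iff plus_1_eq_Suc add.commute)
next
  case (Suc j)
  let ?S0 = "{s \<in> S. l s \<le> 2 * Suc j + 1}"
  have finS: "finite S" using Suc finV by (auto intro: finite_subset)
  show ?case
  proof (rule ccontr)
    assume "\<not> ?thesis"
    then have S0: "card ?S0 \<le> j + 1" by simp
    have "j + 1 \<le> card {s \<in> S. l s \<le> 2 * j + 1}"
      using Suc.prems by (intro Suc.IH) (auto simp: dominates_set_def)
    then have eq: "{s \<in> S. l s \<le> 2 * j + 1} = ?S0"
      using S0 finS by (intro card_seteq) auto
    obtain v where v: "v \<in> V" "l v = 2 * j + 1" using layer_nonempty[of "2 * j + 1"] Suc.prems by auto
    obtain v' where v': "v' \<in> V" "l v' = 2 * j + 2" using layer_nonempty[of "2 * j + 2"] Suc.prems by auto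
    obtain D where D: "D \<subseteq> V" "card D < k" "dominates_set E D (V - {v, v'})"
      using two_exceptions[of v v'] v v' by (metis Suc_eq_plus1 add_2_eq_Suc' n_not_Suc_n)
    have finD: "finite D" using D finV by (auto intro: finite_subset)
    have "dominates_set E D {v \<in> V. l v \<le> 2 * j}"
      using D(3) v v' by (auto simp: dominates_set_def)
    then have 1: "j + 1 \<le> card {s \<in> D. l s \<le> 2 * j + 1}"
      using Suc.prems by (intro Suc.IH[OF D(1)]) auto
    let ?D2 = "{s \<in> D. \<not> l s \<le> 2 * j + 1}"
    have "card D = card {s \<in> D. l s \<le> 2 * j + 1} + card ?D2" by (rule card_split[OF finD])
    then have c: "card (?S0 \<union> ?D2) < k"
      using card_Un_le[of ?S0 ?D2] S0 1 D(2) by linarith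
    \<comment> \<open>\<open>?S0\<close> serves the layers up to \<open>2 * j + 2\<close>, which
      include both exceptions of \<open>D\<close>. A vertex in a higher layer is dominated from
      layer \<open>2 * j + 2\<close> or above, hence by \<open>?D2\<close>.\<close>
    have "dominates_set E (?S0 \<union> ?D2) V"
      unfolding dominates_set_def
    proof
      fix u assume u: "u \<in> V"
      show "\<exists>s\<in>?S0 \<union> ?D2. s = u \<or> (u, s) \<in> E"
      proof (cases "l u \<le> 2 * Suc j")
        case True
        then obtain s where s: "s \<in> S" "s = u \<or> (u, s) \<in> E"
          using Suc.prems(2) u by (auto elim: dominates_setE)
        then have "l s \<le> 2 * Suc j + 1" using True lip[of u s] by auto
        then show ?thesis using s by blast
      next
        case False
        then have "u \<in> V - {v, v'}" using u v v' by auto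
        then obtain s where s: "s \<in> D" "s = u \<or> (u, s) \<in> E" using D(3) by (auto elim: dominates_setE)
        then have "\<not> l s \<le> 2 * j + 1" using False lip'[of u s] by auto
        then show ?thesis using s by blast
      qed
    qed
    then have "k \<le> card (?S0 \<union> ?D2)" using Suc.prems D by (intro dominating_ge) auto
    then show False using c by simp
  qed
qed

lemma reversed: "layered V E k (\<lambda>v. d - l v) d"
proof unfold_locales
  fix a b assume "(a, b) \<in> E"
  then show "d - l b \<le> d - l a + 1" using lip'[of a b] by auto
next
  fix i assume "i \<le> d"
  then obtain v where "v \<in> V" "l v = d - i" using layer_nonempty[of "d - i"] by auto
  then show "\<exists>v\<in>V. d - l v = i" using \<open>i \<le> d\<close> by (metis diff_diff_cancel)
qed auto

lemma card_below:
  assumes "D \<subseteq> V" "dominates_set E D (V - Z)" "\<And>z. z \<in> Z \<Longrightarrow> 2 * j < l z" "2 * j \<le> d"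
  shows "j + 1 \<le> card {s \<in> D. l s \<le> 2 * j + 1}"
  using assms by (intro card_dominating_lower_layers) (force simp: dominates_set_def)+

text \<open>The reversed count for the \<open>2 * j + 1\<close> layers from \<open>i\<close> to
  \<open>d\<close>. The condition \<open>i \<le> l s + 1\<close> means layer \<open>i - 1\<close> or
  higher without subtraction of naturals.\<close>

lemma card_above:
  assumes "D \<subseteq> V" "dominates_set E D (V - Z)" "\<And>z. z \<in> Z \<Longrightarrow> l z < i" "i + 2 * j = d"
  shows "j + 1 \<le> card {s \<in> D. i \<le> l s + 1}"
proof -
  interpret R: layered V E k "\<lambda>v. d - l v" d by (rule reversed)
  have "dominates_set E D {v \<in> V. d - l v \<le> 2 * j}"
    using assms(2,3,4) by (force simp: dominates_set_def)
  then have "j + 1 \<le> card {s \<in> D. d - l s \<le> 2 * j + 1}"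
    using assms(4) by (intro R.card_dominating_lower_layers[OF assms(1)]) auto
  also have "{s \<in> D. d - l s \<le> 2 * j + 1} = {s \<in> D. i \<le> l s + 1}"
    using assms(4) by auto
  finally show ?thesis .
qed

end

section \<open>The bound on the diameter\<close>

locale connected_weak_bicritical = weak_bicritical_rel +
  assumes conn: "a \<in> V \<Longrightarrow> b \<in> V \<Longrightarrow> (a, b) \<in> E\<^sup>*"
    and k_ge_2: "2 \<le> k"
begin

lemma rdist_eq_0_iff: "a \<in> V \<Longrightarrow> b \<in> V \<Longrightarrow> rdist E a b = 0 \<longleftrightarrow> b = a"
  using conn[of a b] rdist_eq_0D[of a b E] by auto

lemma rdist_eq_1_iff:
  assumes "a \<in> V" "b \<in> V"
  shows "rdist E a b = 1 \<longleftrightarrow> (a, b) \<in> E"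
proof
  assume "rdist E a b = 1"
  then show "(a, b) \<in> E" using relpow_rdist[OF conn[OF assms]] by simp
next
  assume *: "(a, b) \<in> E"
  then have "rdist E a b \<le> 1" using rdist_le[of a b 1 E] by simp
  moreover have "rdist E a b \<noteq> 0" using * rdist_eq_0_iff[OF assms] irrE by auto
  ultimately show "rdist E a b = 1" by simp
qed

lemma rdist_lip: "x \<in> V \<Longrightarrow> (a, b) \<in> E \<Longrightarrow> rdist E x b \<le> rdist E x a + 1"
  using rdist_step[OF conn, of x a b] EV[of a b] by blast

lemma rtrancl_in: "(a, b) \<in> E\<^sup>* \<Longrightarrow> a \<in> V \<Longrightarrow> b \<in> V"
  by (induction rule: rtrancl_induct) (auto dest: EV)

text \<open>Everything beyond distance \<open>d\<close> is collapsed into the top layer. The number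
  of layers can then be chosen, with the parity the count needs, whatever the eccentricity of
  \<open>x\<close> is.\<close>

lemma truncated_layers:
  assumes "x \<in> V" "y \<in> V" "d \<le> rdist E x y"
  shows "layered V E k (\<lambda>v. min (rdist E x v) d) d"
proof unfold_locales
  fix a b assume "(a, b) \<in> E"
  then show "min (rdist E x b) d \<le> min (rdist E x a) d + 1" using rdist_lip[OF assms(1), of a b] by auto
next
  fix i assume "i \<le> d"
  then obtain v where "(x, v) \<in> E\<^sup>*" "rdist E x v = i"
    using rdist_attained[OF conn[OF assms(1,2)], of i] assms(3) by auto
  then show "\<exists>v\<in>V. min (rdist E x v) d = i" using \<open>i \<le> d\<close> rtrancl_in assms(1) by (intro bexI[of _ v]) auto
qed auto

text \<open>If \<open>y\<close> were at distance \<open>2 * k - 1\<close> or more, the layers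
  \<open>1\<close> to \<open>2 * k - 1\<close> would form an odd block free of the exception
  \<open>x\<close>, and it alone would take \<open>k\<close> elements of \<open>D\<close>.\<close>

lemma eccentricity_critical:
  assumes "x \<in> V" "y \<in> V" "crit x"
  shows "rdist E x y \<le> 2 * k - 2"
proof (rule ccontr)
  assume "\<not> ?thesis"
  then have "2 * k - 1 \<le> rdist E x y" by simp
  then interpret layered V E k "\<lambda>v. min (rdist E x v) (2 * k - 1)" "2 * k - 1"
    using assms by (intro truncated_layers)
  obtain D where D: "D \<subseteq> V" "x \<notin> D" "card D < k" "dominates_set E D (V - {x})"
    by (rule critE[OF assms(3,1)]) (rule that)
  have "k - 1 + 1 \<le> card {s \<in> D. 1 \<le> min (rdist E x s) (2 * k - 1) + 1}"
    using D(1,4) k_ge_2 by (intro card_above) auto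
  then show False using D(3) by auto
qed

text \<open>Since \<open>x\<close> cannot be the only exception, a second one is placed in layer 1
  or 2. The resulting sets force layer 1 to be a single vertex \<open>a\<close>, so \<open>x\<close>
  is a leaf. A set avoiding the closed neighbourhood of \<open>a\<close> then cannot dominate
  \<open>x\<close>.\<close>

lemma eccentricity_noncritical:
  assumes xV: "x \<in> V" and yV: "y \<in> V" and x: "\<not> crit x" and y: "\<not> crit y"
  shows "rdist E x y \<le> 2 * k - 2"
proof (rule ccontr)
  assume "\<not> ?thesis"
  then have dxy: "2 * k - 1 \<le> rdist E x y" by simp
  define l where "l = (\<lambda>v. min (rdist E x v) (2 * k - 1))"
  interpret layered V E k l "2 * k - 1"
    unfolding l_def using assms dxy by (intro truncated_layers) auto
  have d3: "3 \<le> 2 * k - 1" using k_ge_2 by simp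
  have l0: "l v = 0 \<longleftrightarrow> v = x" if "v \<in> V" for v
    using rdist_eq_0_iff[OF xV that] d3 by (auto simp: l_def)
  have l1: "l v = 1 \<longleftrightarrow> (x, v) \<in> E" if "v \<in> V" for v
    using rdist_eq_1_iff[OF xV that] d3 by (auto simp: l_def)
  have above: "k - j \<le> card {s \<in> D. 2 * j \<le> l s}"
    if "D \<subseteq> V" "dominates_set E D (V - Z)" "\<And>z. z \<in> Z \<Longrightarrow> l z < 2 * j + 1" for D Z j
  proof (cases "j < k")
    case True
    have "k - 1 - j + 1 \<le> card {s \<in> D. 2 * j + 1 \<le> l s + 1}"
      using that True by (intro card_above) auto
    then show ?thesis using True by simp
  qed auto
  \<comment> \<open>Counting the layers from 3 on uses up all of \<open>F\<close> in layers 2 and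
    above. Counting those from 5 on leaves at most one element in layers 2 and 3.\<close>
  have F: "\<exists>F\<subseteq>V. dominates_set E F (V - {x, z}) \<and> (\<forall>s\<in>F. (z, s) \<notin> E) \<and> z \<notin> F \<and>
      (\<forall>s\<in>F. 2 \<le> l s) \<and> (\<forall>s\<in>F. \<forall>t\<in>F. l s < 4 \<longrightarrow> l t < 4 \<longrightarrow> s = t)"
    if z: "z \<in> V" "l z = 1 \<or> l z = 2" for z
  proof -
    have "z \<noteq> x" using l0[OF xV] z by auto
    then obtain F where F: "F \<subseteq> V" "x \<notin> F" "z \<notin> F" "card F < k" "dominates_set E F (V - {x, z})"
      "\<And>s. s \<in> F \<Longrightarrow> (z, s) \<notin> E"
      by (rule noncritE[OF x xV z(1)]) (rule that)
    have fin: "finite F" using F finV by (auto intro: finite_subset)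
    have lz: "l v < 2 * j + 1" if "1 \<le> j" "v \<in> {x, z}" for v j using z l0[OF xV] that by auto
    have "k - 1 \<le> card {s \<in> F. 2 * 1 \<le> l s}" by (rule above[OF F(1,5)]) (rule lz, simp)
    then have "card F \<le> card {s \<in> F. 2 \<le> l s}" using F(4) by simp
    then have ge2: "\<forall>s\<in>F. 2 \<le> l s" using card_filter_ge_all[OF fin, where P = "\<lambda>s. 2 \<le> l s"] by blast
    have "k - 2 \<le> card {s \<in> F. 2 * 2 \<le> l s}" by (rule above[OF F(1,5)]) (rule lz, simp)
    then have "card {s \<in> F. \<not> 4 \<le> l s} \<le> 1"
      using card_split[OF fin, of "\<lambda>s. 4 \<le> l s"] F(4) by simp
    then have "s = t" if "s \<in> F" "t \<in> F" "l s < 4" "l t < 4" for s t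
      by (rule card_filter_le_1_unique[OF fin, where P = "\<lambda>s. \<not> 4 \<le> l s"]) (use that in simp_all)
    then show ?thesis using F ge2 by blast
  qed
  obtain a where a: "a \<in> V" "l a = 1" using layer_nonempty[of 1] d3 by auto
  \<comment> \<open>The only element of \<open>F\<close> in layers 2 and 3 must dominate all of
    layer 1 and all of layer 2 except \<open>z\<close>. This is the companion
    \<open>f\<close>.\<close>
  have z2: "\<exists>f\<in>V. l f = 2 \<and> f \<noteq> z \<and> (z, f) \<notin> E \<and> (\<forall>v\<in>V. l v = 1 \<longrightarrow> (v, f) \<in> E) \<and>
      (\<forall>v\<in>V. l v = 2 \<longrightarrow> v \<noteq> z \<longrightarrow> v = f \<or> (v, f) \<in> E)" if z: "z \<in> V" "l z = 2" for z
  proof -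
    obtain F where F: "F \<subseteq> V" "dominates_set E F (V - {x, z})" "\<And>s. s \<in> F \<Longrightarrow> (z, s) \<notin> E" "z \<notin> F"
      "\<And>s. s \<in> F \<Longrightarrow> 2 \<le> l s" "\<And>s t. s \<in> F \<Longrightarrow> t \<in> F \<Longrightarrow> l s < 4 \<Longrightarrow> l t < 4 \<Longrightarrow> s = t"
      using F[of z] z by metis
    have 1: "\<exists>s\<in>F. l s = 2 \<and> (v, s) \<in> E" if v: "v \<in> V" "l v = 1" for v
    proof -
      have "v \<in> V - {x, z}" using v z l0[OF xV] by auto
      then obtain s where s: "s \<in> F" "s = v \<or> (v, s) \<in> E" using F(2) by (auto elim: dominates_setE)
      have "2 \<le> l s" using F(5) s by blast
      then have "(v, s) \<in> E" "l s = 2" using s v lip[of v s] by auto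
      then show ?thesis using s by auto
    qed
    obtain f where f: "f \<in> F" "l f = 2" using 1[OF a] by blast
    have "(v, f) \<in> E" if "v \<in> V" "l v = 1" for v using 1[OF that] f F(6) by fastforce
    moreover have "v = f \<or> (v, f) \<in> E" if v: "v \<in> V" "l v = 2" "v \<noteq> z" for v
    proof -
      have "v \<in> V - {x, z}" using v z l0[OF xV] by auto
      then obtain s where s: "s \<in> F" "s = v \<or> (v, s) \<in> E" using F(2) by (auto elim: dominates_setE)
      then have "l s < 4" using v lip[of v s] by auto
      then have "s = f" using F(6)[of s f] f s by auto
      then show ?thesis using s by auto
    qed
    ultimately show ?thesis using f F(1,3,4) by blast
  qed
  \<comment> \<open>Only \<open>f\<close> in layer 2 can miss \<open>g\<close>, so the companion of
    \<open>g\<close> is \<open>f\<close> again. Hence every vertex of layer 2 is a companion and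
    sees all of layer 1.\<close>
  have all2: "(v, f) \<in> E" if f: "f \<in> V" "l f = 2" and v: "v \<in> V" "l v = 1" for f v
  proof -
    obtain g where g: "g \<in> V" "l g = 2" "g \<noteq> f" "(f, g) \<notin> E"
      "\<And>v. v \<in> V \<Longrightarrow> l v = 2 \<Longrightarrow> v \<noteq> f \<Longrightarrow> v = g \<or> (v, g) \<in> E" using z2[OF f] by blast
    obtain h where h: "h \<in> V" "l h = 2" "h \<noteq> g" "(g, h) \<notin> E" "\<And>v. v \<in> V \<Longrightarrow> l v = 1 \<Longrightarrow> (v, h) \<in> E"
      using z2[OF g(1,2)] by blast
    have "h = f" using g(5)[of h] h symE by blast
    then show ?thesis using h(5) v by blast
  qed
  have single: "v = a" if v: "v \<in> V" "l v = 1" for v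
  proof (rule ccontr)
    assume va: "v \<noteq> a"
    obtain F where F: "F \<subseteq> V" "dominates_set E F (V - {x, a})" "\<And>s. s \<in> F \<Longrightarrow> (a, s) \<notin> E"
      "\<And>s. s \<in> F \<Longrightarrow> 2 \<le> l s"
      using F[of a] a by metis
    have "v \<in> V - {x, a}" using v va l0[OF xV] by auto
    then obtain s where s: "s \<in> F" "s = v \<or> (v, s) \<in> E" using F(2) by (auto elim: dominates_setE)
    have "2 \<le> l s" using F(4) s by blast
    then have "(v, s) \<in> E" "l s = 2" using s v lip[of v s] by auto
    then have "(a, s) \<in> E" using all2[of s a] a s F by auto
    then show False using F(3) s by blast
  qed
  have leaf: "s = a" if "(x, s) \<in> E" for s
    using single[of s] l1[of s] EV[OF that] that by auto
  have ax: "(a, x) \<in> E" using l1[OF a(1)] a symE by auto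
  have xa: "x \<noteq> a" using ax irrE by auto
  have ly: "l y = 2 * k - 1" using dxy by (simp add: l_def)
  show False
  proof (cases "crit a")
    case True
    then obtain D where D: "a \<notin> D" "dominates_set E D (V - {a})" "\<And>s. s \<in> D \<Longrightarrow> (a, s) \<notin> E"
      by (rule critE[OF _ a(1)]) (rule that)
    obtain s where s: "s \<in> D" "s = x \<or> (x, s) \<in> E" using D(2) xV xa by (auto elim: dominates_setE)
    then show False using leaf ax D by metis
  next
    case False
    \<comment> \<open>The second exception is \<open>y\<close> because it is noncritical: only then
      does \<open>D\<close> avoid the neighbours of \<open>a\<close> as well.\<close>
    have "y \<noteq> a" using ly a d3 by auto
    then obtain D where D: "a \<notin> D" "dominates_set E D (V - {a, y})" "\<And>s. s \<in> D \<Longrightarrow> (a, s) \<notin> E"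
      by (rule noncritE[OF False a(1) yV]) (use that y in blast)
    have "x \<noteq> y" using ly l0[OF xV] d3 by auto
    then obtain s where s: "s \<in> D" "s = x \<or> (x, s) \<in> E" using D(2) xV xa by (auto elim: dominates_setE)
    then show False using leaf ax D by metis
  qed
qed

theorem rdist_bound:
  assumes "x \<in> V" "y \<in> V"
  shows "rdist E x y \<le> 2 * k - 2"
  using assms eccentricity_critical[of x y] eccentricity_critical[of y x] eccentricity_noncritical[of x y]
    rdist_sym[OF sym, of x y] by (cases "crit x"; cases "crit y") auto

end

section \<open>Layers seen from one end of a diametrical path\<close>

locale extremal = connected_weak_bicritical +
  fixes x :: 'a
  assumes xV: "x \<in> V"
    and k_ge_3: "3 \<le> k"
    and far: "\<exists>y\<in>V. rdist E x y = 2 * k - 2"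
begin

abbreviation l :: "'a \<Rightarrow> nat" where "l \<equiv> rdist E x"

definition layer :: "nat \<Rightarrow> 'a set" where "layer i = {v \<in> V. l v = i}"

sublocale layered V E k l "2 * k - 2"
proof unfold_locales
  fix a b assume "(a, b) \<in> E"
  then show "l b \<le> l a + 1" by (rule rdist_lip[OF xV])
next
  fix v assume "v \<in> V"
  then show "l v \<le> 2 * k - 2" by (rule rdist_bound[OF xV])
next
  fix i assume i: "i \<le> 2 * k - 2"
  obtain y where "y \<in> V" "l y = 2 * k - 2" using far by blast
  then obtain v where "(x, v) \<in> E\<^sup>*" "l v = i"
    using rdist_attained[OF conn[OF xV], of y i] i by auto
  then show "\<exists>v\<in>V. l v = i" using rtrancl_in xV by blast
qed

lemma l_eq_0_iff: "v \<in> V \<Longrightarrow> l v = 0 \<longleftrightarrow> v = x"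
  by (rule rdist_eq_0_iff[OF xV])

lemma layer_1_iff: "v \<in> layer 1 \<longleftrightarrow> (x, v) \<in> E"
  using rdist_eq_1_iff[OF xV, of v] EV[of x v] unfolding layer_def by blast

lemma layerD: "v \<in> layer i \<Longrightarrow> v \<in> V \<and> l v = i"
  by (simp add: layer_def)

lemma layer_in_V: "v \<in> layer i \<Longrightarrow> v \<in> V"
  by (simp add: layer_def)

lemma l_neq: "l a \<noteq> l b \<Longrightarrow> a \<noteq> b"
  by blast

lemma layer_1I: "v \<in> V \<Longrightarrow> l v \<le> 1 \<Longrightarrow> v \<noteq> x \<Longrightarrow> v \<in> layer 1"
  using l_eq_0_iff[of v] by (simp add: layer_def le_Suc_eq)

lemma layerI: "v \<in> V \<Longrightarrow> l v = i \<Longrightarrow> v \<in> layer i"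
  by (simp add: layer_def)

lemma layer_cases:
  assumes "u \<in> V"
  obtains "u = x" | "u \<in> layer 1" | "u \<in> layer 2" | "3 \<le> l u"
proof -
  have "l u = 0 \<or> l u = 1 \<or> l u = 2 \<or> 3 \<le> l u" by linarith
  then show ?thesis using that assms l_eq_0_iff[of u] by (auto simp: layer_def)
qed

lemma layer_ex: "i \<le> 4 \<Longrightarrow> \<exists>v. v \<in> layer i"
  using layer_nonempty[of i] k_ge_3 unfolding layer_def by force

lemma layer_pred:
  assumes "v \<in> layer (Suc n)"
  obtains u where "u \<in> layer n" "(u, v) \<in> E"
proof -
  have "(x, v) \<in> E\<^sup>*" using conn[OF xV] assms layerD by blast
  then obtain u where u: "(x, u) \<in> E\<^sup>*" "(u, v) \<in> E" "l u = n"
    using rdist_pred[of x v E n] layerD[OF assms] by blast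
  then show ?thesis using that[of u] EV[of u v] by (simp add: layer_def)
qed

text \<open>The layers from 4 to \<open>2 * k - 2\<close> are free of exceptions and take
  \<open>k - 2\<close> of the at most \<open>k - 1\<close> elements, all from layer 3 on.\<close>

lemma low_unique:
  assumes D: "D \<subseteq> V" "card D < k" "dominates_set E D (V - Z)" "\<And>z. z \<in> Z \<Longrightarrow> l z \<le> 3"
    and st: "s \<in> D" "t \<in> D" "l s < 3" "l t < 3"
  shows "s = t"
proof -
  have fin: "finite D" using D finV by (auto intro: finite_subset)
  have "k - 3 + 1 \<le> card {s \<in> D. 4 \<le> l s + 1}"
    using D(4) k_ge_3 by (intro card_above[OF D(1,3)]) (auto dest!: D(4))
  also have "{s \<in> D. 4 \<le> l s + 1} = {s \<in> D. \<not> l s < 3}" by auto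
  finally have "card {s \<in> D. l s < 3} \<le> 1"
    using card_split[OF fin, of "\<lambda>s. l s < 3"] D(2) k_ge_3 by simp
  then show ?thesis by (rule card_filter_le_1_unique[OF fin]) (use st in simp_all)
qed

text \<open>Layer 0 needs an element in layers 0 and 1, and the layers from 4 on leave no other
  element below layer 3. The layers from 6 on take \<open>k - 3\<close> elements from layer 5 on, so
  at most one is left for layers 3 and 4.\<close>

lemma exceptions_middle:
  assumes D: "D \<subseteq> V" "card D < k" "dominates_set E D (V - Z)" "\<And>z. z \<in> Z \<Longrightarrow> 1 \<le> l z \<and> l z \<le> 3"
  obtains p where "p \<in> D" "l p \<le> 1" "\<And>s. s \<in> D \<Longrightarrow> s = p \<or> 3 \<le> l s"
    "\<And>s t. s \<in> D \<Longrightarrow> t \<in> D \<Longrightarrow> 3 \<le> l s \<Longrightarrow> l s \<le> 4 \<Longrightarrow> 3 \<le> l t \<Longrightarrow> l t \<le> 4 \<Longrightarrow> s = t"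
proof -
  have fin: "finite D" using D finV by (auto intro: finite_subset)
  have Z: "0 < l z" "l z < 4" "l z < 6" if "z \<in> Z" for z using D(4)[OF that] by auto
  have "0 + 1 \<le> card {s \<in> D. l s \<le> 2 * 0 + 1}"
    using Z by (intro card_below[OF D(1,3)]) auto
  then have a: "1 \<le> card {s \<in> D. l s \<le> 1}" by simp
  then obtain p where p: "p \<in> D" "l p \<le> 1" by (metis (mono_tags, lifting) card.empty empty_Collect_eq not_one_le_zero)
  have low: "s = p \<or> 3 \<le> l s" if "s \<in> D" for s
    using low_unique[OF D(1-3) _ that p(1)] Z D(4) p(2) by (cases "l s < 3") auto
  \<comment> \<open>For \<open>k = 3\<close> there is no layer 6 to count, and the bound is
    trivial.\<close>
  have "k - 3 \<le> card {s \<in> D. \<not> l s < 5}"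
  proof (cases "k = 3")
    case False
    have "k - 4 + 1 \<le> card {s \<in> D. 6 \<le> l s + 1}"
      using Z k_ge_3 False by (intro card_above[OF D(1,3)]) auto
    also have "{s \<in> D. 6 \<le> l s + 1} = {s \<in> D. \<not> l s < 5}" by auto
    finally show ?thesis by simp
  qed simp
  then have b: "card {s \<in> D. l s < 5} \<le> 2"
    using card_split[OF fin, of "\<lambda>s. l s < 5"] D(2) k_ge_3 by simp
  have fin5: "finite {s \<in> D. l s < 5}" using fin by simp
  have "s = t" if "s \<in> D" "t \<in> D" "3 \<le> l s" "l s \<le> 4" "3 \<le> l t" "l t \<le> 4" for s t
  proof (rule ccontr)
    assume "s \<noteq> t"
    then have "card {p, s, t} = 3" using that p by (auto simp: card_insert_if)
    moreover have "card {p, s, t} \<le> card {s \<in> D. l s < 5}"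
      using that p by (intro card_mono[OF fin5]) auto
    ultimately show False using b by simp
  qed
  then show ?thesis using that[of p] p low by blast
qed

text \<open>With all exceptions in layer 1, the layers from 2 on take \<open>k - 1\<close> elements
  from layer 1 on. That is all of \<open>D\<close>, so its low element cannot be
  \<open>x\<close>.\<close>

lemma exceptions_first:
  assumes D: "D \<subseteq> V" "card D < k" "dominates_set E D (V - Z)" "\<And>z. z \<in> Z \<Longrightarrow> l z = 1"
  obtains p where "p \<in> D" "l p = 1" "\<And>s. s \<in> D \<Longrightarrow> s = p \<or> 3 \<le> l s"
proof -
  have fin: "finite D" using D finV by (auto intro: finite_subset)
  have "k - 2 + 1 \<le> card {s \<in> D. 2 \<le> l s + 1}"
    using D(4) k_ge_3 by (intro card_above[OF D(1,3)]) auto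
  then have "card D \<le> card {s \<in> D. 2 \<le> l s + 1}" using D(2) by linarith
  then have ge1: "2 \<le> l s + 1" if "s \<in> D" for s
    using card_filter_ge_all[OF fin, where P = "\<lambda>s. 2 \<le> l s + 1"] that by blast
  obtain p where "p \<in> D" "l p \<le> 1" "\<And>s. s \<in> D \<Longrightarrow> s = p \<or> 3 \<le> l s"
    by (rule exceptions_middle[OF D(1-3), rotated], rule that, assumption+) (use D(4) in force)
  then show ?thesis using that[of p] ge1[of p] by auto
qed

text \<open>The layers 0 to 2 need two elements in layers up to 3, and the layers from 4 on need
  \<open>k - 2\<close> in layers from 3 on. As \<open>D\<close> has fewer than \<open>k\<close>
  elements, some element is counted twice.\<close>

lemma exceptions_third:
  assumes D: "D \<subseteq> V" "card D < k" "dominates_set E D (V - Z)" "\<And>z. z \<in> Z \<Longrightarrow> l z = 3"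
  obtains s where "s \<in> D" "s \<in> layer 3"
proof -
  have fin: "finite D" using D finV by (auto intro: finite_subset)
  have a: "1 + 1 \<le> card {s \<in> D. l s \<le> 2 * 1 + 1}"
    using D(4) k_ge_3 by (intro card_below[OF D(1,3)]) auto
  have b: "k - 3 + 1 \<le> card {s \<in> D. 4 \<le> l s + 1}"
    using D(4) k_ge_3 by (intro card_above[OF D(1,3)]) auto
  have "{s \<in> D. l s \<le> 3} \<inter> {s \<in> D. 3 \<le> l s} \<noteq> {}"
  proof
    assume "{s \<in> D. l s \<le> 3} \<inter> {s \<in> D. 3 \<le> l s} = {}"
    then have "card ({s \<in> D. l s \<le> 3} \<union> {s \<in> D. 3 \<le> l s}) = card {s \<in> D. l s \<le> 3} + card {s \<in> D. 3 \<le> l s}"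
      using fin by (intro card_Un_disjoint) auto
    moreover have "card ({s \<in> D. l s \<le> 3} \<union> {s \<in> D. 3 \<le> l s}) \<le> card D"
      using fin by (intro card_mono) auto
    moreover have "{s \<in> D. 4 \<le> l s + 1} = {s \<in> D. 3 \<le> l s}" by auto
    ultimately show False using a b D(2) k_ge_3 by simp
  qed
  then obtain s where "s \<in> D" "l s = 3" by force
  then show ?thesis using that[of s] D(1) by (auto simp: layer_def)
qed

text \<open>A low element in layer 1 would leave its nonneighbour in that layer undominated, because
  \<open>D\<close> has nothing else below layer 3.\<close>

lemma exceptions_middle_x:
  assumes D: "D \<subseteq> V" "card D < k" "dominates_set E D (V - Z)" "\<And>z. z \<in> Z \<Longrightarrow> 2 \<le> l z \<and> l z \<le> 3"
    and co: "comatching E (layer 1)"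
  shows "x \<in> D \<and> (\<forall>s\<in>D. s = x \<or> 3 \<le> l s) \<and>
    (\<forall>s\<in>D. \<forall>t\<in>D. 3 \<le> l s \<longrightarrow> l s \<le> 4 \<longrightarrow> 3 \<le> l t \<longrightarrow> l t \<le> 4 \<longrightarrow> s = t)"
proof -
  obtain p where p: "p \<in> D" "l p \<le> 1" "\<And>s. s \<in> D \<Longrightarrow> s = p \<or> 3 \<le> l s"
    "\<And>s t. s \<in> D \<Longrightarrow> t \<in> D \<Longrightarrow> 3 \<le> l s \<Longrightarrow> l s \<le> 4 \<Longrightarrow> 3 \<le> l t \<Longrightarrow> l t \<le> 4 \<Longrightarrow> s = t"
    by (rule exceptions_middle[OF D(1-3), rotated], rule that, assumption+) (use D(4) in force)
  have "p = x"
  proof (rule ccontr)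
    assume "p \<noteq> x"
    then have "p \<in> layer 1" using p(1,2) D(1) by (intro layer_1I) auto
    then obtain q where q: "q \<in> layer 1" "q \<noteq> p" "(q, p) \<notin> E"
      using comatchingE[OF co sym] by metis
    have "q \<in> V - Z" using layerD[OF q(1)] D(4)[of q] by auto
    then obtain s where s: "s \<in> D" "s = q \<or> (q, s) \<in> E" using D(3) by (auto elim: dominates_setE)
    then have "l s \<le> 2" using layerD[OF q(1)] lip[of q s] by auto
    then show False using p(3)[OF s(1)] s q by auto
  qed
  then show ?thesis using p by blast
qed

text \<open>The count leaves room for only one vertex of \<open>D\<close> in layers three and four.\<close>

lemma exceptions_second:
  assumes D: "D \<subseteq> V" "card D < k" "dominates_set E D (V - Z)" "Z \<subseteq> layer 2" "x \<in> D"
    and u: "u \<in> layer 2 - Z"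
  obtains r where "r \<in> D" "r \<in> layer 3" "(u, r) \<in> E" "\<And>v. v \<in> layer 3 \<Longrightarrow> v = r \<or> (v, r) \<in> E"
proof -
  have Z: "1 \<le> l z \<and> l z \<le> 3" if "z \<in> Z" for z using that D(4) by (auto simp: layer_def)
  obtain p where p: "p \<in> D" "l p \<le> 1" "\<And>s. s \<in> D \<Longrightarrow> s = p \<or> 3 \<le> l s"
    "\<And>s t. s \<in> D \<Longrightarrow> t \<in> D \<Longrightarrow> 3 \<le> l s \<Longrightarrow> l s \<le> 4 \<Longrightarrow> 3 \<le> l t \<Longrightarrow> l t \<le> 4 \<Longrightarrow> s = t"
    by (rule exceptions_middle[OF D(1-3) Z]) (assumption, rule that)
  have px: "p = x" using p(3)[OF D(5)] by simp
  have "u \<in> V - Z" using u by (auto simp: layer_def)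
  then obtain r where r: "r \<in> D" "r = u \<or> (u, r) \<in> E" using D(3) by (auto elim: dominates_setE)
  have lu: "l u = 2" using u by (auto simp: layer_def)
  have "r \<noteq> x" using r(2) lu lip'[of u x] by auto
  then have l3: "3 \<le> l r" using p(3)[OF r(1)] px by simp
  then have ur: "(u, r) \<in> E" using r lu by auto
  then have r3: "r \<in> layer 3" using l3 lu lip[of u r] r(1) D(1) by (auto simp: layer_def)
  have "v = r \<or> (v, r) \<in> E" if v: "v \<in> layer 3" for v
  proof -
    have "v \<in> V - Z" using v D(4) by (auto simp: layer_def)
    then obtain t where t: "t \<in> D" "t = v \<or> (v, t) \<in> E" using D(3) by (auto elim: dominates_setE)
    have lv: "l v = 3" using v by (simp add: layer_def)
    have "l t \<le> 4" "2 \<le> l t" using t(2) lv lip[of v t] lip'[of v t] by auto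
    then have "t = r" using p(3)[OF t(1)] p(4)[OF t(1) r(1)] px layerD[OF r3] by auto
    then show ?thesis using t by auto
  qed
  then show ?thesis using that r(1) r3 ur by blast
qed

text \<open>The set of a critical \<open>r\<close> would have to meet layer 3 by the overlap of the
  two counts, but all of layer 3 lies in the closed neighbourhood of \<open>r\<close>.\<close>

lemma third_layer_dominated_noncrit:
  assumes r: "r \<in> layer 3" "\<And>v. v \<in> layer 3 \<Longrightarrow> v = r \<or> (v, r) \<in> E"
  shows "\<not> crit r"
proof
  assume "crit r"
  then obtain D where D: "D \<subseteq> V" "r \<notin> D" "card D < k" "dominates_set E D (V - {r})"
    "\<And>s. s \<in> D \<Longrightarrow> (r, s) \<notin> E"
    by (rule critE[OF _ layer_in_V[OF r(1)]]) (rule that)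
  obtain s where "s \<in> D" "s \<in> layer 3"
    by (rule exceptions_third[OF D(1,3,4), rotated], rule that, assumption+) (use layerD[OF r(1)] in auto)
  then show False using r(2)[of s] D symE by blast
qed

text \<open>If \<open>v\<close> were noncritical like \<open>r\<close>, a set for both would avoid
  the closed neighbourhood of \<open>r\<close>, hence layer 3. Its only element below layer 3 is
  \<open>x\<close>, so nothing is left to dominate \<open>u\<close>.\<close>

lemma third_layer_dominated:
  assumes r: "r \<in> layer 3" "\<And>v. v \<in> layer 3 \<Longrightarrow> v = r \<or> (v, r) \<in> E"
    and co: "comatching E (layer 1)" and v: "v \<in> layer 2" and u: "u \<in> layer 2" "u \<noteq> v"
  shows "crit v"
proof (rule ccontr)
  assume nv: "\<not> crit v"
  have nr: "\<not> crit r" by (rule third_layer_dominated_noncrit[OF r])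
  have "v \<noteq> r" using v r by (auto simp: layer_def)
  then obtain D where D: "D \<subseteq> V" "r \<notin> D" "v \<notin> D" "card D < k" "dominates_set E D (V - {r, v})"
    "\<And>s. s \<in> D \<Longrightarrow> (r, s) \<notin> E"
    by (rule noncrit2E[OF nr nv layer_in_V[OF r(1)] layer_in_V[OF v]]) (rule that)
  have *: "x \<in> D \<and> (\<forall>s\<in>D. s = x \<or> 3 \<le> l s) \<and>
    (\<forall>s\<in>D. \<forall>t\<in>D. 3 \<le> l s \<longrightarrow> l s \<le> 4 \<longrightarrow> 3 \<le> l t \<longrightarrow> l t \<le> 4 \<longrightarrow> s = t)"
    by (rule exceptions_middle_x[OF D(1,4,5) _ co]) (use r(1) v in \<open>auto simp: layer_def\<close>)
  have "u \<in> V - {r, v}" using u layerD[OF r(1)] layerD[OF u(1)] by auto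
  then obtain s where s: "s \<in> D" "s = u \<or> (u, s) \<in> E" using D(5) by (auto elim: dominates_setE)
  have lu: "l u = 2" using layerD[OF u(1)] by simp
  have "s \<noteq> x" using s(2) lu lip'[of u x] by auto
  then have l3: "3 \<le> l s" using * s(1) by blast
  then have "l s = 3" using s(2) lu lip[of u s] by auto
  then have "s \<in> layer 3" using s(1) D(1) by (auto simp: layer_def)
  then have "(r, s) \<in> E" using r(2)[of s] D(2) s(1) symE by blast
  then show False using D(6)[OF s(1)] by simp
qed

section \<open>A noncritical vertex in layer two\<close>

lemma comatching_first_layer:
  assumes z: "z \<in> layer 2" "\<not> crit z"
  shows "comatching E (layer 1)"
  unfolding comatching_def
proof
  fix v assume v: "v \<in> layer 1"
  have "v \<noteq> z" using v z by (auto simp: layer_def)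
  then obtain D where D: "D \<subseteq> V" "z \<notin> D" "v \<notin> D" "card D < k" "dominates_set E D (V - {z, v})"
    "\<And>s. s \<in> D \<Longrightarrow> (v, s) \<notin> E"
    by (rule noncritE[OF z(2) layer_in_V[OF z(1)] layer_in_V[OF v]]) (rule that)
  obtain p where p: "p \<in> D" "l p \<le> 1" "\<And>s. s \<in> D \<Longrightarrow> s = p \<or> 3 \<le> l s"
    by (rule exceptions_middle[OF D(1,4,5), rotated], rule that, assumption+) (use z(1) v in \<open>auto simp: layer_def\<close>)
  \<comment> \<open>\<open>x\<close> is a neighbour of \<open>v\<close>, which \<open>D\<close>
    avoids. So the low element lies in layer 1: it misses \<open>v\<close> and has to dominate the
    rest of that layer alone.\<close>
  have "x \<notin> D" using v layer_1_iff D(6) symE by blast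
  then have p1: "p \<in> layer 1" using p(1,2) D(1) by (intro layer_1I) auto
  moreover have "p \<noteq> v" "(v, p) \<notin> E" using p(1) D by auto
  moreover have "(u, p) \<in> E" if u: "u \<in> layer 1" "u \<noteq> v" "u \<noteq> p" for u
  proof -
    have "u \<in> V - {z, v}" using u layerD[OF z(1)] layerD[OF u(1)] by auto
    then obtain s where s: "s \<in> D" "s = u \<or> (u, s) \<in> E" using D(5) by (auto elim: dominates_setE)
    then have "l s \<le> 2" using layerD[OF u(1)] lip[of u s] by auto
    then show ?thesis using s p(3)[of s] u by auto
  qed
  ultimately show "\<exists>p\<in>layer 1. p \<noteq> v \<and> (v, p) \<notin> E \<and> (\<forall>u\<in>layer 1. u \<noteq> v \<longrightarrow> u \<noteq> p \<longrightarrow> (u, p) \<in> E)"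
    by blast
qed

text \<open>Taking \<open>x\<close> as the second exception keeps \<open>D\<close> out of layers 0
  and 1. Layer 1 must then be dominated from layer 2, where \<open>D\<close> has a single
  element.\<close>

lemma second_layer_companion:
  assumes z: "z \<in> layer 2" "\<not> crit z"
  obtains w where "w \<in> layer 2" "w \<noteq> z" "\<And>v. v \<in> layer 1 \<Longrightarrow> (v, w) \<in> E"
proof -
  have "x \<noteq> z" using z(1) by (auto simp: layer_def)
  then obtain D where D: "D \<subseteq> V" "z \<notin> D" "x \<notin> D" "card D < k" "dominates_set E D (V - {z, x})"
    "\<And>s. s \<in> D \<Longrightarrow> (x, s) \<notin> E"
    by (rule noncritE[OF z(2) layer_in_V[OF z(1)] xV]) (rule that)
  have ge2: "2 \<le> l s" if "s \<in> D" for s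
  proof -
    have "l s \<noteq> 0" "l s \<noteq> 1" using that D(1,3) D(6)[OF that] l_eq_0_iff[of s] layer_1_iff[of s]
      by (auto simp: layer_def)
    then show ?thesis by linarith
  qed
  have *: "\<exists>s\<in>D. l s = 2 \<and> (v, s) \<in> E" if v: "v \<in> layer 1" for v
  proof -
    have "v \<in> V - {z, x}" using layerD[OF z(1)] layerD[OF v] by auto
    then obtain s where s: "s \<in> D" "s = v \<or> (v, s) \<in> E" using D(5) by (auto elim: dominates_setE)
    have "s \<noteq> v" using ge2[OF s(1)] layerD[OF v] by auto
    then show ?thesis using s ge2[OF s(1)] lip[of v s] layerD[OF v] by (intro bexI[of _ s]) auto
  qed
  obtain a where "a \<in> layer 1" using layer_ex[of 1] by auto
  then obtain w where w: "w \<in> D" "l w = 2" using * by blast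
  have "(v, w) \<in> E" if v: "v \<in> layer 1" for v
  proof -
    obtain s where s: "s \<in> D" "l s = 2" "(v, s) \<in> E" using *[OF v] by blast
    have "s = w" by (rule low_unique[OF D(1,4,5) _ s(1) w(1)]) (use s w z in \<open>auto simp: layer_def\<close>)
    then show ?thesis using s by simp
  qed
  then show ?thesis using that[of w] w D by (auto simp: layer_def)
qed

text \<open>A vertex of layer 2 outside the exceptions would be dominated by a vertex that dominates
  all of layer 3, and this would make \<open>z\<close> critical. With exceptions \<open>z\<close>
  and \<open>w\<close> this excludes a third vertex; with \<open>w\<close> alone, applied to
  \<open>z\<close>, it excludes that \<open>w\<close> is critical.\<close>

lemma second_layer_pair:
  assumes z: "z \<in> layer 2" "\<not> crit z" and w: "w \<in> layer 2" "w \<noteq> z"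
  shows "layer 2 = {z, w}" "\<not> crit w"
proof -
  have co: "comatching E (layer 1)" by (rule comatching_first_layer[OF z])
  have no: False if D: "D \<subseteq> V" "card D < k" "dominates_set E D (V - Z)" "Z \<subseteq> {z, w}" and u: "u \<in> layer 2 - Z" for D Z u
  proof -
    have Z: "2 \<le> l v \<and> l v \<le> 3" if "v \<in> Z" for v using that D(4) z(1) w(1) by (auto simp: layer_def)
    have "x \<in> D" using exceptions_middle_x[OF D(1-3) Z co] by blast
    moreover have "Z \<subseteq> layer 2" using D(4) z(1) w(1) by blast
    ultimately obtain r where r: "r \<in> layer 3" "\<And>v. v \<in> layer 3 \<Longrightarrow> v = r \<or> (v, r) \<in> E"
      using exceptions_second[OF D(1-3) _ _ u] by blast
    show False using third_layer_dominated[OF r co z(1) w] z(2) by blast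
  qed
  obtain D where D: "D \<subseteq> V" "card D < k" "dominates_set E D (V - {z, w})"
    using two_exceptions[of z w] layerD[OF z(1)] layerD[OF w(1)] w(2) by blast
  show "layer 2 = {z, w}" using no[OF D] z w by blast
  show "\<not> crit w"
  proof
    assume "crit w"
    then obtain D where "D \<subseteq> V" "card D < k" "dominates_set E D (V - {w})"
      by (rule critE[OF _ layer_in_V[OF w(1)]]) (rule that)
    then show False using no[of D "{w}" z] z w by blast
  qed
qed

text \<open>With exceptions \<open>z\<close> and \<open>q\<close>, the vertex \<open>w\<close> is
  dominated from layer 3. The element \<open>s\<close> doing this is the only one in layers 3 and 4,
  so it also has to dominate layer 3 apart from \<open>q\<close>. For \<open>k = 3\<close> the set
  is just \<open>{x, s}\<close>, and \<open>s\<close> covers layer 4 too.\<close>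

lemma third_layer_partner:
  assumes z: "z \<in> layer 2" "\<not> crit z" and w: "w \<in> layer 2" "w \<noteq> z" and q: "q \<in> layer 3"
  shows "\<exists>s\<in>layer 3. s \<noteq> q \<and> (q, s) \<notin> E \<and> (\<forall>u\<in>layer 3. u \<noteq> q \<longrightarrow> u \<noteq> s \<longrightarrow> (u, s) \<in> E) \<and> (s, w) \<in> E \<and>
    (k = 3 \<longrightarrow> (\<forall>u\<in>layer 4. (s, u) \<in> E))"
proof -
  have co: "comatching E (layer 1)" by (rule comatching_first_layer[OF z])
  have "q \<noteq> z" using q z by (auto simp: layer_def)
  then obtain D where D: "D \<subseteq> V" "z \<notin> D" "q \<notin> D" "card D < k" "dominates_set E D (V - {z, q})"
    "\<And>s. s \<in> D \<Longrightarrow> (q, s) \<notin> E"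
    by (rule noncritE[OF z(2) layer_in_V[OF z(1)] layer_in_V[OF q]]) (rule that)
  have *: "x \<in> D \<and> (\<forall>s\<in>D. s = x \<or> 3 \<le> l s) \<and>
    (\<forall>s\<in>D. \<forall>t\<in>D. 3 \<le> l s \<longrightarrow> l s \<le> 4 \<longrightarrow> 3 \<le> l t \<longrightarrow> l t \<le> 4 \<longrightarrow> s = t)"
    by (rule exceptions_middle_x[OF D(1,4,5) _ co]) (use q z in \<open>auto simp: layer_def\<close>)
  have "w \<in> V - {z, q}" using w layerD[OF q] layerD[OF w(1)] by auto
  then obtain s where s: "s \<in> D" "s = w \<or> (w, s) \<in> E" using D(5) by (auto elim: dominates_setE)
  have lw: "l w = 2" using layerD[OF w(1)] by simp
  have "s \<noteq> x" using s(2) lw lip'[of w x] by auto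
  then have l3: "3 \<le> l s" using * s(1) by blast
  then have ws: "(w, s) \<in> E" "l s = 3" using s(2) lw lip[of w s] by auto
  then have s3: "s \<in> layer 3" using s(1) D(1) by (auto simp: layer_def)
  have 1: "(u, s) \<in> E" if u: "u \<in> layer 3" "u \<noteq> q" "u \<noteq> s" for u
  proof -
    have "u \<in> V - {z, q}" using u layerD[OF z(1)] layerD[OF u(1)] by auto
    then obtain t where t: "t \<in> D" "t = u \<or> (u, t) \<in> E" using D(5) by (auto elim: dominates_setE)
    have lv: "l u = 3" using layerD[OF u(1)] by simp
    have "l t \<le> 4" "2 \<le> l t" using t(2) lv lip[of u t] lip'[of u t] by auto
    moreover have "t \<noteq> x" using \<open>2 \<le> l t\<close> by auto
    then have "3 \<le> l t" using * t(1) by blast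
    ultimately have "t = s" using * t(1) s(1) ws(2) l3 by simp
    then show ?thesis using t u by auto
  qed
  have 2: "(s, u) \<in> E" if u: "u \<in> layer 4" and k: "k = 3" for u
  proof -
    have "u \<in> V - {z, q}" using u layerD[OF z(1)] layerD[OF u(1)] layerD[OF q] by auto
    then obtain t where t: "t \<in> D" "t = u \<or> (u, t) \<in> E" using D(5) by (auto elim: dominates_setE)
    have lu: "l u = 4" using layerD[OF u] by simp
    have tx: "t \<noteq> x" using t(2) lu lip'[of u x] by auto
    have "t = s"
    proof (rule ccontr)
      assume "t \<noteq> s"
      then have "card {x, s, t} = 3" using tx \<open>s \<noteq> x\<close> by auto
      moreover have "card {x, s, t} \<le> card D"
        using * s t D(1) finV by (intro card_mono) (auto intro: finite_subset)
      ultimately show False using D(4) k by simp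
    qed
    then show ?thesis using t(2) lu ws(2) symE by auto
  qed
  show ?thesis using s3 D s(1) 1 2 symE[OF ws(1)] by (intro bexI[of _ s]) blast+
qed

lemma twin_structure:
  assumes z: "z \<in> layer 2" "\<not> crit z"
  obtains w where "w \<noteq> z" "layer 2 = {z, w}" "\<not> crit w" "comatching E (layer 1)" "comatching E (layer 3)"
    "\<And>v. v \<in> layer 1 \<union> layer 3 \<Longrightarrow> (v, z) \<in> E \<and> (v, w) \<in> E"
    "\<And>u v. k = 3 \<Longrightarrow> v \<in> layer 3 \<Longrightarrow> u \<in> layer 4 \<Longrightarrow> (v, u) \<in> E"
proof -
  obtain w where w: "w \<in> layer 2" "w \<noteq> z" "\<And>v. v \<in> layer 1 \<Longrightarrow> (v, w) \<in> E"
    by (rule second_layer_companion[OF z]) (rule that)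
  note pair = second_layer_pair[OF z w(1,2)]
  obtain z' where z': "z' \<in> layer 2" "z' \<noteq> w" "\<And>v. v \<in> layer 1 \<Longrightarrow> (v, z') \<in> E"
    by (rule second_layer_companion[OF w(1) pair(2)]) (rule that)
  have "z' = z" using z' pair(1) by auto
  then have z1: "(v, z) \<in> E" if "v \<in> layer 1" for v using z' that by simp
  note partner_w = third_layer_partner[OF z w(1,2)]
  note partner_z = third_layer_partner[OF w(1) pair(2) z(1) w(2)[symmetric]]
  have co3: "comatching E (layer 3)" unfolding comatching_def using partner_w by blast
  have *: "(s, w) \<in> E \<and> (s, z) \<in> E \<and> (k = 3 \<longrightarrow> (\<forall>u\<in>layer 4. (s, u) \<in> E))" if s: "s \<in> layer 3" for s
  proof -
    obtain q where q: "q \<in> layer 3" "q \<noteq> s" "(s, q) \<notin> E"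
      "\<And>u. u \<in> layer 3 \<Longrightarrow> u \<noteq> s \<Longrightarrow> u \<noteq> q \<Longrightarrow> (u, q) \<in> E \<and> (u, s) \<in> E"
      using comatchingE[OF co3 sym s] by metis
    \<comment> \<open>The nonneighbour of \<open>q\<close> in layer 3 is unique, so \<open>s\<close>
      itself is the partner obtained for \<open>q\<close>, once with \<open>z\<close> and once with
      \<open>w\<close> as the exception.\<close>
    have "s' = s" if "s' \<in> layer 3" "s' \<noteq> q" "(q, s') \<notin> E" for s'
      using q(4)[of s'] that symE by blast
    then show ?thesis using partner_w[OF q(1)] partner_z[OF q(1)] by metis
  qed
  show ?thesis
    by (rule that[of w]) (use w pair z1 co3 * comatching_first_layer[OF z] in auto)
qed

text \<open>Suppose layer 4 has a second vertex \<open>v\<close>. A set with exceptions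
  \<open>z\<close> and \<open>y\<close> avoids layer 3, all of which is adjacent to
  \<open>y\<close>, so its two elements are \<open>p\<close> for \<open>x\<close> and
  \<open>t\<close> for \<open>v\<close>. Only \<open>p\<close> can dominate \<open>w\<close>; hence
  \<open>p\<close> is in layer 1 and misses its own partner there.\<close>

lemma twin_last_layer:
  assumes z: "z \<in> layer 2" "\<not> crit z" and k: "k = 3"
  obtains y where "layer 4 = {y}"
proof -
  obtain w where w: "w \<noteq> z" "layer 2 = {z, w}" "comatching E (layer 1)"
    "\<And>u v. k = 3 \<Longrightarrow> v \<in> layer 3 \<Longrightarrow> u \<in> layer 4 \<Longrightarrow> (v, u) \<in> E"
    by (rule twin_structure[OF z]) (rule that)
  have w2: "w \<in> layer 2" using w(2) by simp
  have "v = y" if y: "y \<in> layer 4" and v: "v \<in> layer 4" for v y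
  proof (rule ccontr)
    assume vy: "v \<noteq> y"
    have "y \<noteq> z" using y z by (auto simp: layer_def)
    then obtain D where D: "D \<subseteq> V" "z \<notin> D" "y \<notin> D" "card D < k" "dominates_set E D (V - {z, y})"
      "\<And>s. s \<in> D \<Longrightarrow> (y, s) \<notin> E"
      by (rule noncritE[OF z(2) layer_in_V[OF z(1)] layer_in_V[OF y]]) (rule that)
    have fin: "finite D" using D finV by (auto intro: finite_subset)
    have no3: "l s \<noteq> 3" if "s \<in> D" for s
      using D(6)[OF that] w(4)[OF k, of s y] y that D(1) symE by (auto simp: layer_def)
    have dom: "\<exists>s\<in>D. s = u \<or> (u, s) \<in> E" if "u \<in> V" "u \<noteq> z" "u \<noteq> y" for u
      using D(5) that unfolding dominates_set_def by blast
    have lz: "l z = 2" "l y = 4" "l w = 2" "l v = 4"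
      using layerD[OF z(1)] layerD[OF y] layerD[OF w2] layerD[OF v] by auto
    have "x \<noteq> z" "x \<noteq> y" using lz by (auto intro!: l_neq)
    then obtain p where p: "p \<in> D" "p = x \<or> (x, p) \<in> E" using dom[of x] xV by blast
    have lp: "l p \<le> 1" using p(2) lip[of x p] by auto
    have "v \<noteq> z" using lz by (intro l_neq) simp
    then obtain t where t: "t \<in> D" "t = v \<or> (v, t) \<in> E" using dom[of v] layerD[OF v] vy by blast
    have lt: "4 \<le> l t" using t lz lip'[of v t] no3[OF t(1)] by auto
    have D2: "s = p \<or> s = t" if "s \<in> D" for s
    proof (rule ccontr)
      assume "\<not> ?thesis"
      moreover have "p \<noteq> t" using lp lt by auto
      ultimately have "card {p, s, t} = 3" by auto
      moreover have "card {p, s, t} \<le> card D" using p t that fin by (intro card_mono) auto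
      ultimately show False using D(4) k by simp
    qed
    have "w \<noteq> y" using lz by (intro l_neq) simp
    then obtain s where s: "s \<in> D" "s = w \<or> (w, s) \<in> E" using dom[of w] layerD[OF w2] w(1) by blast
    have "s \<noteq> t" using s(2) lt lz lip[of w s] by auto
    then have "s = p" using D2 s by blast
    then have wp: "(w, p) \<in> E" using s lz lp by auto
    then have "p \<in> layer 1" using lp lz lip'[of w p] p(1) D(1) by (auto simp: layer_def)
    then obtain q where q: "q \<in> layer 1" "q \<noteq> p" "(q, p) \<notin> E"
      using comatchingE[OF w(3) sym] by metis
    have "q \<noteq> z" "q \<noteq> y" using layerD[OF q(1)] lz by (auto intro!: l_neq)
    then obtain s' where s': "s' \<in> D" "s' = q \<or> (q, s') \<in> E" using dom[of q] layerD[OF q(1)] by auto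
    then have "s' \<noteq> t" using layerD[OF q(1)] lip[of q s'] lt by auto
    then show False using D2 s' q by blast
  qed
  then show ?thesis using that layer_ex[of 4] by blast
qed

text \<open>A set for two noncritical vertices \<open>z\<close> and \<open>y\<close> avoids layers 1
  and 3, so it contains \<open>x\<close> and \<open>w\<close>. Exchanging \<open>x\<close> for a
  vertex of layer 1 keeps layers 0 to 2 covered, now including \<open>z\<close>, and leaves
  \<open>y\<close> as the only exception.\<close>

lemma twin_far_critical:
  assumes z: "z \<in> layer 2" "\<not> crit z" and y: "y \<in> V" "4 \<le> l y"
  shows "crit y"
proof (rule ccontr)
  assume ny: "\<not> crit y"
  obtain w where w: "w \<noteq> z" "layer 2 = {z, w}"
    "\<And>v. v \<in> layer 1 \<union> layer 3 \<Longrightarrow> (v, z) \<in> E \<and> (v, w) \<in> E"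
    by (rule twin_structure[OF z]) (rule that)
  have lz: "l z = 2" "l w = 2" "z \<in> V" "w \<in> V" using w(2) layerD by blast+
  have "y \<noteq> z" using y lz by auto
  then obtain D where D: "D \<subseteq> V" "z \<notin> D" "y \<notin> D" "card D < k" "dominates_set E D (V - {z, y})"
    "\<And>s. s \<in> D \<Longrightarrow> (z, s) \<notin> E"
    by (rule noncrit2E[OF z(2) ny lz(3) y(1)]) (rule that)
  have fin: "finite D" using D finV by (auto intro: finite_subset)
  have dom: "\<exists>s\<in>D. s = u \<or> (u, s) \<in> E" if "u \<in> V" "u \<noteq> z" "u \<noteq> y" for u
    using D(5) that unfolding dominates_set_def by blast
  have no13: "l s \<noteq> 1 \<and> l s \<noteq> 3" if "s \<in> D" for s
    using D(6)[OF that] w(3)[of s] that D(1) symE by (auto simp: layer_def)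
  have wD: "w \<in> D"
  proof -
    have "w \<noteq> y" using lz y by (intro l_neq) simp
    then obtain s where s: "s \<in> D" "s = w \<or> (w, s) \<in> E" using dom[of w] lz(4) w(1) by blast
    have "1 \<le> l s" "l s \<le> 3" using s(2) lz lip[of w s] lip'[of w s] by auto
    then have "l s = 2" using no13[OF s(1)] by auto
    then show ?thesis using s(1) w(2) D(1,2) by (auto simp: layer_def)
  qed
  have xD: "x \<in> D"
  proof -
    have "x \<noteq> z" "x \<noteq> y" using lz y by (auto intro!: l_neq)
    then obtain s where s: "s \<in> D" "s = x \<or> (x, s) \<in> E" using dom[of x] xV by blast
    then show ?thesis using no13[OF s(1)] layer_1_iff[of s] layerD by blast
  qed
  obtain p where p: "p \<in> layer 1" using layer_ex[of 1] by auto
  define D' where "D' = insert p (D - {x})"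
  have pD: "p \<in> V" "p \<noteq> y" using layerD[OF p] y by auto
  have "card D' \<le> card D" unfolding D'_def using card_insert_le_m1[of "card D" "D - {x}" p] card_Suc_Diff1[OF fin xD] by linarith
  moreover have "D' \<subseteq> V" "y \<notin> D'" using D pD by (auto simp: D'_def)
  moreover have "dominates_set E D' (V - {y})"
    unfolding dominates_set_def
  proof
    fix u assume u: "u \<in> V - {y}"
    have "w \<noteq> x" using lz by auto
    then have wD': "w \<in> D'" using wD by (simp add: D'_def)
    have pD': "p \<in> D'" by (simp add: D'_def)
    from u have "u \<in> V" by simp
    then show "\<exists>s\<in>D'. s = u \<or> (u, s) \<in> E"
    proof (cases rule: layer_cases)
      case 1
      then show ?thesis using pD' p layer_1_iff by blast
    next
      case 2
      then show ?thesis using wD' w(3)[of u] by blast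
    next
      case 3
      then have "u = z \<or> u = w" using w(2) by simp
      moreover have "(z, p) \<in> E" using w(3)[of p] p symE by simp
      ultimately show ?thesis using pD' wD' by blast
    next
      case 4
      then have "u \<noteq> z" using lz by (intro l_neq) simp
      then obtain s where s: "s \<in> D" "s = u \<or> (u, s) \<in> E" using dom[of u] u by blast
      then have "s \<noteq> x" using 4 lip'[of u s] by auto
      then show ?thesis using s by (auto simp: D'_def)
    qed
  qed
  ultimately show False using critI[of D' y] ny D(4) by auto
qed


section \<open>Layer two without noncritical vertices\<close>

lemma first_layer_dominated_noncrit:
  assumes p: "p \<in> layer 1" "\<And>v. v \<in> layer 1 \<Longrightarrow> v = p \<or> (v, p) \<in> E"
  shows "\<not> crit p"
proof
  assume "crit p"
  then obtain D where D: "D \<subseteq> V" "p \<notin> D" "card D < k" "dominates_set E D (V - {p})"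
    "\<And>s. s \<in> D \<Longrightarrow> (p, s) \<notin> E"
    by (rule critE[OF _ layer_in_V[OF p(1)]]) (rule that)
  obtain s where "s \<in> D" "l s = 1"
    by (rule exceptions_first[OF D(1,3,4), rotated], rule that, assumption+) (use layerD[OF p(1)] in auto)
  then show False using p(2)[of s] D symE layerI[of s 1] by blast
qed

text \<open>A set with exceptions \<open>p\<close> and \<open>q\<close> must meet layer 1, but it
  has to avoid the closed neighbourhood of \<open>q\<close>, which contains that layer.\<close>

lemma first_layer_dominator_unique:
  assumes p: "p \<in> layer 1" "\<And>v. v \<in> layer 1 \<Longrightarrow> v = p \<or> (v, p) \<in> E"
    and q: "q \<in> layer 1" "\<And>v. v \<in> layer 1 \<Longrightarrow> v = q \<or> (v, q) \<in> E"
  shows "q = p"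
proof (rule ccontr)
  have np: "\<not> crit p" by (rule first_layer_dominated_noncrit[OF p])
  assume "q \<noteq> p"
  then obtain D where D: "D \<subseteq> V" "q \<notin> D" "card D < k" "dominates_set E D (V - {p, q})"
    "\<And>s. s \<in> D \<Longrightarrow> (q, s) \<notin> E"
    by (rule noncritE[OF np layer_in_V[OF p(1)] layer_in_V[OF q(1)]]) (rule that)
  obtain s where "s \<in> D" "l s = 1"
    by (rule exceptions_first[OF D(1,3,4), rotated], rule that, assumption+) (use layerD[OF p(1)] layerD[OF q(1)] in auto)
  then show False using q(2)[of s] D symE layerI[of s 1] by blast
qed

text \<open>The set of \<open>w\<close> might have its low element \<open>p\<close> in layer 1. Then
  \<open>p\<close> dominates layer 1 and is noncritical. A set with exceptions \<open>p\<close> and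
  \<open>w\<close> has \<open>x\<close> as its low element, since \<open>p\<close> is the only
  dominator of layer 1, and \<open>x\<close> covers \<open>p\<close>.\<close>

lemma second_layer_crit:
  assumes w: "w \<in> layer 2" "crit w"
  obtains D where "D \<subseteq> V" "x \<in> D" "card D < k" "dominates_set E D (V - {w})"
    "\<And>s. s \<in> D \<Longrightarrow> (w, s) \<notin> E" "\<And>s. s \<in> D \<Longrightarrow> s = x \<or> 3 \<le> l s"
proof -
  obtain D where D: "D \<subseteq> V" "w \<notin> D" "card D < k" "dominates_set E D (V - {w})"
    "\<And>s. s \<in> D \<Longrightarrow> (w, s) \<notin> E"
    by (rule critE[OF w(2) layer_in_V[OF w(1)]]) (rule that)
  have lw: "l w = 2" "w \<in> V" using layerD[OF w(1)] by auto
  obtain p where p: "p \<in> D" "l p \<le> 1" "\<And>s. s \<in> D \<Longrightarrow> s = p \<or> 3 \<le> l s"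
    by (rule exceptions_middle[OF D(1,3,4), rotated], rule that, assumption+) (use lw in auto)
  show ?thesis
  proof (cases "p = x")
    case True
    then show ?thesis using that[of D] D p by blast
  next
    case False
    then have p1: "p \<in> layer 1" using p(1,2) D(1) by (intro layer_1I) auto
    have pdom: "v = p \<or> (v, p) \<in> E" if v: "v \<in> layer 1" for v
    proof -
      have "v \<in> V - {w}" using layerD[OF v] lw by auto
      then obtain s where s: "s \<in> D" "s = v \<or> (v, s) \<in> E" using D(4) by (auto elim: dominates_setE)
      then have "l s \<le> 2" using layerD[OF v] lip[of v s] by auto
      then show ?thesis using s p(3)[of s] by auto
    qed
    have np: "\<not> crit p" by (rule first_layer_dominated_noncrit[OF p1 pdom])
    have "w \<noteq> p" using lw layerD[OF p1] by auto
    then obtain D2 where D2: "D2 \<subseteq> V" "p \<notin> D2" "w \<notin> D2" "card D2 < k" "dominates_set E D2 (V - {p, w})"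
      "\<And>s. s \<in> D2 \<Longrightarrow> (w, s) \<notin> E"
      by (rule noncritE[OF np layer_in_V[OF p1] lw(2)]) (rule that)
    obtain q where q: "q \<in> D2" "l q \<le> 1" "\<And>s. s \<in> D2 \<Longrightarrow> s = q \<or> 3 \<le> l s"
      by (rule exceptions_middle[OF D2(1,4,5), rotated], rule that, assumption+) (use lw layerD[OF p1] in auto)
    have "q = x"
    proof (rule ccontr)
      assume "q \<noteq> x"
      then have q1: "q \<in> layer 1" using q(1,2) D2(1) by (intro layer_1I) auto
      have qdom: "v = q \<or> (v, q) \<in> E" if v: "v \<in> layer 1" for v
      proof (cases "v = p")
        case True
        then show ?thesis using pdom[OF q1] q(1) D2(2) symE by blast
      next
        case False
        then have "v \<in> V - {p, w}" using layerD[OF v] lw by auto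
        then obtain s where s: "s \<in> D2" "s = v \<or> (v, s) \<in> E" using D2(5) by (auto elim: dominates_setE)
        then have "l s \<le> 2" using layerD[OF v] lip[of v s] by auto
        then show ?thesis using s q(3)[of s] by auto
      qed
      have "q = p" by (rule first_layer_dominator_unique[OF p1 _ q1]) (fact pdom qdom)+
      then show False using q(1) D2(2) by simp
    qed
    moreover have "(p, x) \<in> E" using p1 layer_1_iff symE by blast
    ultimately have "dominates_set E D2 (V - {w})" using D2(5) q(1) unfolding dominates_set_def by blast
    then show ?thesis using that[of D2] D2 q \<open>q = x\<close> by blast
  qed
qed

text \<open>Two critical vertices of layer 2 give two vertices \<open>r\<close> and
  \<open>r'\<close> that each dominate layer 3; they differ because \<open>w\<close> sees
  \<open>r'\<close> but not \<open>r\<close>. A set with exceptions \<open>r\<close> and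
  \<open>r'\<close> would still have to meet layer 3, where everything is in the closed
  neighbourhood of \<open>r'\<close>.\<close>

lemma second_layer_singleton:
  assumes "\<And>v. v \<in> layer 2 \<Longrightarrow> crit v"
  obtains w where "layer 2 = {w}"
proof -
  obtain w where w: "w \<in> layer 2" using layer_ex[of 2] by auto
  have "w' = w" if w': "w' \<in> layer 2" for w'
  proof (rule ccontr)
    assume ww': "w' \<noteq> w"
    have *: "\<exists>r. r \<in> layer 3 \<and> (u, r) \<in> E \<and> (v, r) \<notin> E \<and> (\<forall>v\<in>layer 3. v = r \<or> (v, r) \<in> E)"
      if v: "v \<in> layer 2" and u: "u \<in> layer 2" "u \<noteq> v" for u v
    proof -
      obtain D where D: "D \<subseteq> V" "x \<in> D" "card D < k" "dominates_set E D (V - {v})"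
        "\<And>s. s \<in> D \<Longrightarrow> (v, s) \<notin> E"
        by (rule second_layer_crit[OF v assms[OF v]]) (rule that)
      obtain r where r: "r \<in> D" "r \<in> layer 3" "(u, r) \<in> E" "\<And>v. v \<in> layer 3 \<Longrightarrow> v = r \<or> (v, r) \<in> E"
        by (rule exceptions_second[OF D(1,3,4) _ D(2), where u = u, rotated 2], rule that, assumption+) (use u v in auto)
      then show ?thesis using D(5) by blast
    qed
    obtain r where r: "r \<in> layer 3" "(w', r) \<in> E" "(w, r) \<notin> E" "\<And>v. v \<in> layer 3 \<Longrightarrow> v = r \<or> (v, r) \<in> E"
      using *[OF w w' ww'] by blast
    obtain r' where r': "r' \<in> layer 3" "(w, r') \<in> E" "\<And>v. v \<in> layer 3 \<Longrightarrow> v = r' \<or> (v, r') \<in> E"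
      using *[OF w' w ww'[symmetric]] by blast
    have nr: "\<not> crit r" by (rule third_layer_dominated_noncrit[OF r(1,4)])
    have "r' \<noteq> r" using r r' by blast
    then obtain D where D: "D \<subseteq> V" "r' \<notin> D" "card D < k" "dominates_set E D (V - {r, r'})"
      "\<And>s. s \<in> D \<Longrightarrow> (r', s) \<notin> E"
      by (rule noncritE[OF nr layer_in_V[OF r(1)] layer_in_V[OF r'(1)]]) (rule that)
    obtain s where "s \<in> D" "s \<in> layer 3"
      by (rule exceptions_third[OF D(1,3,4), rotated], rule that, assumption+) (use layerD[OF r(1)] layerD[OF r'(1)] in auto)
    then show False using r'(3)[of s] D symE by blast
  qed
  then show ?thesis using that w by blast
qed

text \<open>A set that avoids \<open>x\<close> and its neighbours can dominate a vertex of layer 1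
  only from layer 2, hence only by \<open>w\<close>.\<close>

lemma first_layer_joined:
  assumes w: "layer 2 = {w}" and D: "D \<subseteq> V" "x \<notin> D" "dominates_set E D (V - Z)" "\<And>s. s \<in> D \<Longrightarrow> (x, s) \<notin> E"
    and v: "v \<in> layer 1" "v \<notin> Z"
  shows "(v, w) \<in> E"
proof -
  obtain s where s: "s \<in> D" "s = v \<or> (v, s) \<in> E"
    using D(3) v layerD[OF v(1)] by (auto elim: dominates_setE)
  have "l s \<le> 2" using s layerD[OF v(1)] lip[of v s] by auto
  moreover have "s \<in> V" "l s \<noteq> 0" "l s \<noteq> 1"
    using s(1) D(1,2) D(4)[of s] l_eq_0_iff[of s] layer_1_iff[of s] by (auto simp: layer_def)
  ultimately have "s \<in> layer 2" by (auto simp: layer_def)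
  moreover have "s \<noteq> v" using \<open>l s \<noteq> 1\<close> layerD[OF v(1)] by auto
  ultimately show ?thesis using s w by auto
qed

text \<open>If \<open>y\<close> were noncritical, a set for \<open>x\<close> and \<open>y\<close>
  would avoid layer 1, which is therefore joined to \<open>w\<close>. A set with exceptions
  \<open>x\<close> and \<open>w\<close> then avoids layers 0 to 2 altogether and cannot dominate
  layer 1.\<close>

lemma noncrit_root_far_crit:
  assumes w: "layer 2 = {w}" and x: "\<not> crit x" and y: "y \<in> V" "3 \<le> l y"
  shows "crit y"
proof (rule ccontr)
  assume ny: "\<not> crit y"
  have "y \<noteq> x" using y by auto
  then obtain D where D: "D \<subseteq> V" "x \<notin> D" "dominates_set E D (V - {x, y})" "\<And>s. s \<in> D \<Longrightarrow> (x, s) \<notin> E"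
    by (rule noncrit2E[OF x ny xV y(1)]) (rule that)
  have joined: "(v, w) \<in> E" if v: "v \<in> layer 1" for v
    by (rule first_layer_joined[OF w D v]) (use layerD[OF v] y in auto)
  have lw: "w \<in> V" "l w = 2" using w layerD by blast+
  then have "w \<noteq> x" by auto
  then obtain D' where D': "D' \<subseteq> V" "x \<notin> D'" "w \<notin> D'" "dominates_set E D' (V - {x, w})"
    "\<And>s. s \<in> D' \<Longrightarrow> (w, s) \<notin> E"
    by (rule noncritE[OF x xV lw(1)]) (rule that)
  obtain a where a: "a \<in> layer 1" using layer_ex[of 1] by auto
  then have "a \<in> V - {x, w}" using lw layerD[OF a] by auto
  then obtain p where p: "p \<in> D'" "p = a \<or> (a, p) \<in> E" using D'(4) by (auto elim: dominates_setE)
  have "l p \<le> 2" using p layerD[OF a] lip[of a p] by auto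
  moreover have "p \<in> V" "l p \<noteq> 0" using p(1) D'(1,2) l_eq_0_iff[of p] by auto
  moreover have "p \<notin> layer 2" using p(1) D'(3) w by auto
  ultimately have "p \<in> layer 1" by (auto simp: layer_def)
  then show False using joined D'(5) p(1) symE by blast
qed

text \<open>If \<open>y\<close> were noncritical, a set for \<open>q\<close> and \<open>y\<close>
  would contain a vertex \<open>p\<close> of layer 1 dominating that layer except \<open>q\<close>.
  Put in place of \<open>x\<close> into the set of the critical vertex \<open>w\<close>, it covers
  \<open>w\<close> and leaves \<open>q\<close> as the only exception.\<close>

lemma noncrit_first_layer_far_crit:
  assumes w: "layer 2 = {w}" "crit w" and x: "crit x" and q: "q \<in> layer 1" "\<not> crit q"
    and y: "y \<in> V" "3 \<le> l y"
  shows "crit y"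
proof (rule ccontr)
  assume ny: "\<not> crit y"
  have lw: "w \<in> V" "l w = 2" "w \<in> layer 2" using w layerD by blast+
  have lq: "q \<in> V" "l q = 1" "(q, x) \<in> E" using q layerD layer_1_iff symE by blast+
  obtain Dx where Dx: "Dx \<subseteq> V" "x \<notin> Dx" "dominates_set E Dx (V - {x})" "\<And>s. s \<in> Dx \<Longrightarrow> (x, s) \<notin> E"
    by (rule critE[OF x xV]) (rule that)
  have joined: "(v, w) \<in> E" if v: "v \<in> layer 1" for v
    by (rule first_layer_joined[OF w(1) Dx v]) (use layerD[OF v] in auto)
  have "y \<noteq> q" using y lq by auto
  then obtain D where D: "D \<subseteq> V" "q \<notin> D" "y \<notin> D" "card D < k" "dominates_set E D (V - {q, y})"
    "\<And>s. s \<in> D \<Longrightarrow> (q, s) \<notin> E"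
    by (rule noncrit2E[OF q(2) ny lq(1) y(1)]) (rule that)
  have fin: "finite D" using D finV by (auto intro: finite_subset)
  have dom: "\<exists>s\<in>D. s = u \<or> (u, s) \<in> E" if "u \<in> V" "u \<noteq> q" "u \<noteq> y" for u
    using D(5) that unfolding dominates_set_def by blast
  have xw: "x \<notin> D" "w \<notin> D" using D(6) lq(3) joined[OF q(1)] by blast+
  obtain p where p: "p \<in> D" "p \<in> layer 1"
    using dom[of x] xV y lq xw layer_1_iff by fastforce
  \<comment> \<open>Two elements of layer 1 could be traded for \<open>x\<close> and
    \<open>w\<close>, which dominate layers 0 to 2. The result would have \<open>y\<close> as its
    only exception.\<close>
  have only: "s = p" if s: "s \<in> D" "s \<in> layer 1" for s
  proof (rule ccontr)
    assume sp: "s \<noteq> p"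
    define D' where "D' = {x, w} \<union> (D - {p, s})"
    have "card {p, s} = 2" using sp by auto
    moreover have "card (D - {p, s}) = card D - card {p, s}" using p s fin by (intro card_Diff_subset) auto
    moreover have "card {p, s} \<le> card D" using p s fin by (intro card_mono) auto
    moreover have "card D' \<le> card {x, w} + card (D - {p, s})" unfolding D'_def by (rule card_Un_le)
    moreover have "card {x, w} \<le> 2" by (simp add: card_insert_if)
    ultimately have "card D' < k" using D(4) by linarith
    moreover have "D' \<subseteq> V" "y \<notin> D'" using D lw xV y by (auto simp: D'_def)
    moreover have "dominates_set E D' (V - {y})"
      unfolding dominates_set_def
    proof
      fix u assume u: "u \<in> V - {y}"
      from u have "u \<in> V" by simp
      then show "\<exists>s\<in>D'. s = u \<or> (u, s) \<in> E"
      proof (cases rule: layer_cases)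
        case 2
        then show ?thesis using layer_1_iff symE by (auto simp: D'_def)
      next
        case 4
        then have "u \<noteq> q" using lq by (intro l_neq) simp
        then obtain t where t: "t \<in> D" "t = u \<or> (u, t) \<in> E" using dom[of u] u by blast
        then have "2 \<le> l t" using 4 lip'[of u t] by auto
        then have "t \<noteq> p" "t \<noteq> s" using layerD[OF p(2)] layerD[OF s(2)] by auto
        then show ?thesis using t by (auto simp: D'_def)
      qed (use w in \<open>auto simp: D'_def\<close>)
    qed
    ultimately show False using critI[of D' y] ny by blast
  qed
  have lp: "p \<in> V" "l p = 1" using layerD[OF p(2)] by auto
  have pdom: "(u, p) \<in> E" if u: "u \<in> layer 1" "u \<noteq> q" "u \<noteq> p" for u
  proof -
    have "u \<noteq> y" using y layerD[OF u(1)] by auto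
    then obtain t where t: "t \<in> D" "t = u \<or> (u, t) \<in> E" using dom[of u] layerD[OF u(1)] u by auto
    then have "l t \<le> 2" using layerD[OF u(1)] lip[of u t] by auto
    moreover have "t \<in> V" "l t \<noteq> 0" using t(1) xw D(1) l_eq_0_iff[of t] by auto
    moreover have "t \<notin> layer 2" using t(1) xw w by auto
    ultimately have "t \<in> layer 1" by (auto simp: layer_def)
    then show ?thesis using only t u by auto
  qed
  obtain D0 where D0: "D0 \<subseteq> V" "x \<in> D0" "card D0 < k" "dominates_set E D0 (V - {w})"
    "\<And>s. s \<in> D0 \<Longrightarrow> s = x \<or> 3 \<le> l s"
    by (rule second_layer_crit[OF lw(3) w(2)]) (rule that)
  have fin0: "finite D0" using D0 finV by (auto intro: finite_subset)
  define D1 where "D1 = insert p (D0 - {x})"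
  have "card D1 \<le> Suc (card (D0 - {x}))" unfolding D1_def using fin0 by (simp add: card_insert_if)
  also have "\<dots> = card D0" by (rule card_Suc_Diff1[OF fin0 D0(2)])
  finally have "card D1 < k" using D0(3) by simp
  moreover have "q \<noteq> x" using lq(3) irrE by blast
  then have "q \<notin> D0" using D0(5)[of q] lq by auto
  then have "D1 \<subseteq> V" "q \<notin> D1" using D0(1) lp p(1) D(2) by (auto simp: D1_def)
  moreover have "dominates_set E D1 (V - {q})"
    unfolding dominates_set_def
  proof
    fix u assume u: "u \<in> V - {q}"
    from u have "u \<in> V" by simp
    then show "\<exists>s\<in>D1. s = u \<or> (u, s) \<in> E"
    proof (cases rule: layer_cases)
      case 1
      then show ?thesis using p(2) layer_1_iff by (auto simp: D1_def)
    next
      case 2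
      then show ?thesis using pdom u by (auto simp: D1_def)
    next
      case 3
      then show ?thesis using w joined[OF p(2)] symE by (auto simp: D1_def)
    next
      case 4
      then have "u \<in> V - {w}" using u lw by auto
      then obtain t where t: "t \<in> D0" "t = u \<or> (u, t) \<in> E" using D0(4) by (auto elim: dominates_setE)
      then have "t \<noteq> x" using 4 lip'[of u t] by auto
      then show ?thesis using t by (auto simp: D1_def)
    qed
  qed
  ultimately show False using critI[of D1 q] q by blast
qed

lemma noncrit_far_crit:
  assumes crit2: "\<forall>v\<in>layer 2. crit v" and z: "z \<in> V" "l z \<le> 2" "\<not> crit z" and y: "y \<in> V" "3 \<le> l y"
  shows "crit y"
proof -
  obtain w where w: "layer 2 = {w}" using second_layer_singleton crit2 by blast
  have "l z = 0 \<or> l z = 1 \<or> l z = 2" using z(2) by linarith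
  then have "z = x \<or> z \<in> layer 1" using z crit2 l_eq_0_iff[of z] by (auto simp: layer_def)
  then show ?thesis
    using noncrit_root_far_crit[OF w _ y] noncrit_first_layer_far_crit[OF w _ _ _ z(3) y] crit2 w z(3)
    by blast
qed

text \<open>The set of \<open>x\<close> joins layer 1 to \<open>w\<close>, the set of a vertex in
  layer 1 supplies its partner, and the set of \<open>w\<close> without \<open>x\<close> is
  \<open>T\<close>.\<close>

lemma ordinary_end:
  assumes crit: "\<And>v. v \<in> V \<Longrightarrow> l v \<le> 2 \<Longrightarrow> crit v"
  obtains w T where "layer 2 = {w}" "comatching E (layer 1)" "\<And>v. v \<in> layer 1 \<Longrightarrow> (v, w) \<in> E"
    "T \<subseteq> V" "\<And>t. t \<in> T \<Longrightarrow> 3 \<le> l t" "card T + 1 < k" "dominates_set E T {v \<in> V. 3 \<le> l v}"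
proof -
  obtain w where w: "layer 2 = {w}" using second_layer_singleton crit by (auto simp: layer_def)
  have lw: "w \<in> V" "l w = 2" "w \<in> layer 2" using w layerD by blast+
  obtain Dx where Dx: "Dx \<subseteq> V" "x \<notin> Dx" "dominates_set E Dx (V - {x})" "\<And>s. s \<in> Dx \<Longrightarrow> (x, s) \<notin> E"
    by (rule critE[OF crit[OF xV] xV]) (simp, rule that)
  have joined: "(v, w) \<in> E" if v: "v \<in> layer 1" for v
    by (rule first_layer_joined[OF w Dx v]) (use layerD[OF v] in auto)
  have "comatching E (layer 1)"
    unfolding comatching_def
  proof
    fix v assume v: "v \<in> layer 1"
    then have "crit v" using crit[of v] by (simp add: layer_def)
    then obtain D where D: "D \<subseteq> V" "v \<notin> D" "card D < k" "dominates_set E D (V - {v})"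
      "\<And>s. s \<in> D \<Longrightarrow> (v, s) \<notin> E"
      by (rule critE[OF _ layer_in_V[OF v]]) (rule that)
    obtain p where p: "p \<in> D" "l p = 1" "\<And>s. s \<in> D \<Longrightarrow> s = p \<or> 3 \<le> l s"
      by (rule exceptions_first[OF D(1,3,4), rotated], rule that, assumption+) (use layerD[OF v] in auto)
    have "(u, p) \<in> E" if u: "u \<in> layer 1" "u \<noteq> v" "u \<noteq> p" for u
    proof -
      have "u \<in> V - {v}" using u layerD[OF u(1)] by auto
      then obtain s where s: "s \<in> D" "s = u \<or> (u, s) \<in> E" using D(4) by (auto elim: dominates_setE)
      then have "l s \<le> 2" using layerD[OF u(1)] lip[of u s] by auto
      then show ?thesis using s p(3)[of s] u by auto
    qed
    then show "\<exists>p\<in>layer 1. p \<noteq> v \<and> (v, p) \<notin> E \<and> (\<forall>u\<in>layer 1. u \<noteq> v \<longrightarrow> u \<noteq> p \<longrightarrow> (u, p) \<in> E)"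
      using p D layerI[of p 1] by (intro bexI[of _ p]) auto
  qed
  moreover
  obtain D where D: "D \<subseteq> V" "x \<in> D" "card D < k" "dominates_set E D (V - {w})"
    "\<And>s. s \<in> D \<Longrightarrow> s = x \<or> 3 \<le> l s"
    by (rule second_layer_crit[OF lw(3) crit[OF lw(1)]]) (simp add: lw, rule that)
  have fin: "finite D" using D finV by (auto intro: finite_subset)
  have "dominates_set E (D - {x}) {v \<in> V. 3 \<le> l v}"
    unfolding dominates_set_def
  proof
    fix u assume u: "u \<in> {v \<in> V. 3 \<le> l v}"
    then have "u \<in> V - {w}" using lw by auto
    then obtain t where t: "t \<in> D" "t = u \<or> (u, t) \<in> E" using D(4) by (auto elim: dominates_setE)
    then have "t \<noteq> x" using u lip'[of u t] by auto
    then show "\<exists>s\<in>D - {x}. s = u \<or> (u, s) \<in> E" using t by blast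
  qed
  moreover have "card (D - {x}) + 1 < k" using card_Suc_Diff1[OF fin D(2)] D(3) by linarith
  ultimately show ?thesis using that[of w "D - {x}"] w joined D by blast
qed

end

section \<open>Choosing the end to split off\<close>

context connected_weak_bicritical
begin

text \<open>A noncritical \<open>z'\<close> near \<open>y\<close> is in layer
  \<open>2 * k - 4\<close> or higher as seen from \<open>x\<close>. If layer 2 is critical, a
  noncritical \<open>z\<close> near \<open>x\<close> keeps \<open>z'\<close> below layer 3, which
  leaves \<open>k = 3\<close> with \<open>z'\<close> in layer 2. Otherwise \<open>k\<close> is at
  least 4, and \<open>z'\<close> lies so far out that the twins make it critical.\<close>

lemma extremal_ends:
  assumes k: "3 \<le> k" and xy: "x \<in> V" "y \<in> V" "rdist E x y = 2 * k - 2"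
  obtains (left) "\<And>v. v \<in> V \<Longrightarrow> rdist E x v \<le> 2 \<Longrightarrow> crit v"
    | (right) "\<And>v. v \<in> V \<Longrightarrow> rdist E y v \<le> 2 \<Longrightarrow> crit v"
    | (twin) z where "k = 3" "z \<in> V" "rdist E x z = 2" "\<not> crit z"
proof -
  interpret X: extremal V E k x
    by unfold_locales (use k xy in auto)
  show ?thesis
  proof (cases "k = 3 \<and> \<not> (\<forall>v\<in>X.layer 2. crit v)")
    case True
    then show ?thesis using twin X.layerD by blast
  next
    case nt: False
    show ?thesis
    proof (rule ccontr)
      assume no: "\<not> thesis"
      then obtain z where z: "z \<in> V" "rdist E x z \<le> 2" "\<not> crit z" using left by blast
      obtain z' where z': "z' \<in> V" "rdist E y z' \<le> 2" "\<not> crit z'" using no right by blast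
      have tri: "rdist E x y \<le> rdist E x z' + rdist E z' y"
      proof -
        have "(x, y) \<in> E ^^ (rdist E x z' + rdist E z' y)"
          using relpow_rdist[OF conn[OF xy(1) z'(1)]] relpow_rdist[OF conn[OF z'(1) xy(2)]]
          by (auto simp: relpow_add)
        then show ?thesis by (rule rdist_le)
      qed
      show False
      proof (cases "\<forall>v\<in>X.layer 2. crit v")
        case True
        have "rdist E x z' \<ge> 2 * k - 4" using tri z'(2) xy(3) rdist_sym[OF sym, of z' y] by simp
        moreover have "\<not> 3 \<le> rdist E x z'" using X.noncrit_far_crit[OF True z z'(1)] z'(3) by blast
        ultimately have "rdist E x z' = 2" using k by linarith
        then show False using True z' X.layerI by blast
      next
        case False
        then have "k \<noteq> 3" using nt by blast
        then have "4 \<le> rdist E x z'" using tri z'(2) xy(3) rdist_sym[OF sym, of z' y] k by simp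
        then show False using X.twin_far_critical[of _ z'] False z' by blast
      qed
    qed
  qed
qed

end

section \<open>Graphs\<close>

lemma pair_wf_digraph_iff: "pair_wf_digraph G \<longleftrightarrow> parcs G \<subseteq> pverts G \<times> pverts G"
  by (force simp: pair_wf_digraph_def)

lemma pair_graph_iff:
  "pair_graph G \<longleftrightarrow> finite (pverts G) \<and> parcs G \<subseteq> pverts G \<times> pverts G \<and> sym (parcs G) \<and> irrefl (parcs G)"
proof
  assume "pair_graph G"
  then interpret pair_graph G .
  show "finite (pverts G) \<and> parcs G \<subseteq> pverts G \<times> pverts G \<and> sym (parcs G) \<and> irrefl (parcs G)"
    using in_arcsD1 in_arcsD2 arcs_symmetric by (auto simp: sym_def irrefl_def dest: no_loops')
next
  assume *: "finite (pverts G) \<and> parcs G \<subseteq> pverts G \<times> pverts G \<and> sym (parcs G) \<and> irrefl (parcs G)"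
  then have "finite (parcs G)" by (meson finite_SigmaI finite_subset)
  with * show "pair_graph G"
    by unfold_locales (auto simp: symmetric_def irrefl_def)
qed

lemma reachable_iff:
  assumes "pair_wf_digraph G" "x \<in> pverts G"
  shows "x \<rightarrow>\<^sup>*\<^bsub>with_proj G\<^esub> y \<longleftrightarrow> (x, y) \<in> (parcs G)\<^sup>*"
proof
  assume "x \<rightarrow>\<^sup>*\<^bsub>with_proj G\<^esub> y"
  then show "(x, y) \<in> (parcs G)\<^sup>*" using reachable_rtranclI by fastforce
next
  interpret pair_wf_digraph G by fact
  assume "(x, y) \<in> (parcs G)\<^sup>*"
  then show "x \<rightarrow>\<^sup>*\<^bsub>with_proj G\<^esub> y"
  proof (induction rule: rtrancl_induct)
    case base
    then show ?case using assms(2) by simp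
  next
    case (step y z)
    then show ?case using reachable_adj_trans[of x y z] by simp
  qed
qed

lemma connected_iff:
  assumes "pair_graph G"
  shows "connected (with_proj G) \<longleftrightarrow> pverts G \<noteq> {} \<and> (\<forall>a\<in>pverts G. \<forall>b\<in>pverts G. (a, b) \<in> (parcs G)\<^sup>*)"
proof -
  interpret pair_graph G by fact
  have *: "mk_symmetric (with_proj G) = G"
    using arcs_symmetric by (intro pair_pre_digraph.equality) (auto simp: parcs_mk_symmetric)
  show ?thesis
    unfolding connected_def strongly_connected_def *
    using reachable_iff[of G] pair_wf_digraph_iff[of G] assms by (auto simp: pair_graph_iff)
qed


subsection \<open>Distance and diameter\<close>

text \<open>The bridge from arc lists to powers of the arc relation; afterwards distances are
  computed only in \<open>parcs G\<close>.\<close>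

lemma ex_awalk_iff:
  "(\<exists>p. pre_digraph.awalk (with_proj G) x p y \<and> length p = n) \<longleftrightarrow> x \<in> pverts G \<and> (x, y) \<in> parcs G ^^ n"
    if "pair_wf_digraph G"
proof -
  have *: "(\<exists>p. set p \<subseteq> parcs G \<and> pcas x p y \<and> length p = n) \<longleftrightarrow> (x, y) \<in> parcs G ^^ n" for x
  proof (induction n arbitrary: x)
    case (Suc n)
    have "(\<exists>p. set p \<subseteq> parcs G \<and> pcas x p y \<and> length p = Suc n) \<longleftrightarrow>
      (\<exists>z. (x, z) \<in> parcs G \<and> (\<exists>p. set p \<subseteq> parcs G \<and> pcas z p y \<and> length p = n))" (is "?l \<longleftrightarrow> ?r")
    proof
      assume ?l
      then obtain e p where "set (e # p) \<subseteq> parcs G" "pcas x (e # p) y" "length p = n"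
        by (metis length_Suc_conv)
      then show ?r by (intro exI[of _ "snd e"]) auto
    next
      assume ?r
      then obtain z p where "(x, z) \<in> parcs G" "set p \<subseteq> parcs G" "pcas z p y" "length p = n" by blast
      then show ?l by (intro exI[of _ "(x, z) # p"]) auto
    qed
    also have "\<dots> \<longleftrightarrow> (x, y) \<in> parcs G ^^ Suc n"
      unfolding Suc.IH by (metis relpow_Suc_D2 relpow_Suc_I2)
    finally show ?case .
  qed auto
  interpret pair_pre_digraph G .
  show ?thesis by (simp add: awalk_def flip: *)
qed

lemma gdist_le_iff:
  assumes "pair_wf_digraph G" "x \<in> pverts G"
  shows "gdist G x y \<le> enat n \<longleftrightarrow> (\<exists>m\<le>n. (x, y) \<in> parcs G ^^ m)"
proof -
  let ?A = "{p. pre_digraph.awalk (with_proj G) x p y}"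
  have "gdist G x y \<le> enat n \<longleftrightarrow> (\<exists>p\<in>?A. length p \<le> n)" (is "?l \<longleftrightarrow> ?r")
  proof
    assume ?l
    have "?A \<noteq> {}"
    proof
      assume "?A = {}"
      then have "gdist G x y = \<infinity>" by (simp add: gdist_def top_enat_def)
      then show False using \<open>?l\<close> by simp
    qed
    then obtain e where "e \<in> (\<lambda>p. enat (length p)) ` ?A" by blast
    then have "(LEAST e. e \<in> (\<lambda>p. enat (length p)) ` ?A) \<in> (\<lambda>p. enat (length p)) ` ?A" by (rule LeastI)
    then have "gdist G x y \<in> (\<lambda>p. enat (length p)) ` ?A"
      unfolding gdist_def Inf_enat_def using \<open>?A \<noteq> {}\<close> by (metis (no_types, lifting) image_is_empty)
    then show ?r using \<open>?l\<close> by auto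
  next
    assume ?r
    then obtain p where "p \<in> ?A" "length p \<le> n" by blast
    then show ?l unfolding gdist_def by (intro INF_lower2[of p]) auto
  qed
  also have "\<dots> \<longleftrightarrow> (\<exists>m\<le>n. \<exists>p. pre_digraph.awalk (with_proj G) x p y \<and> length p = m)"
    by auto
  also have "\<dots> \<longleftrightarrow> (\<exists>m\<le>n. (x, y) \<in> parcs G ^^ m)"
    unfolding ex_awalk_iff[OF assms(1)] using assms(2) by simp
  finally show ?thesis .
qed

lemma gdist_eq_rdist:
  assumes "pair_wf_digraph G" "x \<in> pverts G" "(x, y) \<in> (parcs G)\<^sup>*"
  shows "gdist G x y = enat (rdist (parcs G) x y)"
proof (rule antisym)
  show le: "gdist G x y \<le> enat (rdist (parcs G) x y)"
    unfolding gdist_le_iff[OF assms(1,2)] using relpow_rdist[OF assms(3)] by blast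
  then obtain n where n: "gdist G x y = enat n" by (cases "gdist G x y") auto
  then obtain m where "m \<le> n" "(x, y) \<in> parcs G ^^ m" using gdist_le_iff[OF assms(1,2), of y n] by auto
  then show "enat (rdist (parcs G) x y) \<le> gdist G x y" using rdist_le[of x y m] n by fastforce
qed

lemma diam_le_iff: "diam G \<le> n \<longleftrightarrow> (\<forall>x\<in>pverts G. \<forall>y\<in>pverts G. gdist G x y \<le> n)"
  by (auto simp: diam_def SUP_le_iff)

lemma gdist_le_diam: "x \<in> pverts G \<Longrightarrow> y \<in> pverts G \<Longrightarrow> gdist G x y \<le> diam G"
  using diam_le_iff[of G "diam G"] by simp

lemma diam_eqI:
  assumes "\<And>x y. x \<in> pverts G \<Longrightarrow> y \<in> pverts G \<Longrightarrow> gdist G x y \<le> n"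
    and "a \<in> pverts G" "b \<in> pverts G" "n \<le> gdist G a b"
  shows "diam G = n"
proof (rule antisym)
  show "diam G \<le> n" using assms(1) by (simp add: diam_le_iff)
  show "n \<le> diam G" using assms(4) gdist_le_diam[OF assms(2,3)] by (rule order_trans)
qed

lemma diametricalI:
  assumes "a \<in> pverts G" "b \<in> pverts G" "diam G \<le> gdist G a b"
  shows "diametrical G a"
  unfolding diametrical_def
proof (intro conjI antisym)
  show "(SUP y\<in>pverts G. gdist G a y) \<le> diam G" using gdist_le_diam[OF assms(1)] by (auto simp: SUP_le_iff)
  show "diam G \<le> (SUP y\<in>pverts G. gdist G a y)" using assms by (meson SUP_upper order_trans)
qed (fact assms)

lemma diametricalE:
  assumes "diametrical G a" "finite (pverts G)"
  obtains b where "b \<in> pverts G" "gdist G a b = diam G"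
proof -
  have "(SUP y\<in>pverts G. gdist G a y) \<in> gdist G a ` pverts G"
    using assms unfolding diametrical_def
    by (subst Max_Sup[symmetric]) (auto intro: Max_in)
  then show ?thesis using assms that unfolding diametrical_def by auto
qed


subsection \<open>Domination number\<close>

text \<open>Deleting vertices repeatedly stays among the induced subgraphs of one fixed graph. All
  domination numbers involved thus become statements about the single relation
  \<open>parcs G\<close>.\<close>

definition induced :: "'a sgraph \<Rightarrow> 'a set \<Rightarrow> 'a sgraph" where
  "induced G U = \<lparr>pverts = U, parcs = parcs G \<inter> U \<times> U\<rparr>"

lemma pverts_induced [simp]: "pverts (induced G U) = U"
  and parcs_induced [simp]: "parcs (induced G U) = parcs G \<inter> U \<times> U"
  by (simp_all add: induced_def)

lemma pair_graph_induced: "pair_graph G \<Longrightarrow> U \<subseteq> pverts G \<Longrightarrow> pair_graph (induced G U)"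
  by (auto simp: pair_graph_iff sym_def irrefl_def intro: finite_subset)

lemma delete_vertex_induced: "delete_vertex (induced G U) x = induced G (U - {x})"
  by (auto simp: delete_vertex_def induced_def)

lemma induced_self: "pair_wf_digraph G \<Longrightarrow> induced G (pverts G) = G"
  by (auto simp: induced_def pair_wf_digraph_iff intro!: pair_pre_digraph.equality)

lemma delete_vertex_conv: "pair_wf_digraph G \<Longrightarrow> delete_vertex G x = induced G (pverts G - {x})"
  using delete_vertex_induced[of G "pverts G"] induced_self by metis

lemma dominating_induced_iff: "dominating (induced G U) S \<longleftrightarrow> S \<subseteq> U \<and> dominates_set (parcs G) S U"
  unfolding dominating_def dominates_set_def by auto

lemma domination_number_induced_le_iff:
  assumes "finite U"
  shows "\<gamma> (induced G U) \<le> n \<longleftrightarrow> (\<exists>S\<subseteq>U. dominates_set (parcs G) S U \<and> card S \<le> n)"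
proof -
  let ?D = "{S. dominating (induced G U) S}"
  have "?D \<subseteq> Pow U" by (auto simp: dominating_induced_iff)
  then have "finite ?D" using assms by (metis finite_Pow_iff finite_subset)
  moreover have "U \<in> ?D" by (auto simp: dominating_induced_iff dominates_set_def)
  ultimately have "\<gamma> (induced G U) \<le> n \<longleftrightarrow> (\<exists>S\<in>?D. card S \<le> n)"
    unfolding domination_number_def by (subst Min_le_iff) auto
  then show ?thesis by (auto simp: dominating_induced_iff)
qed

lemma domination_number_induced_leI:
  assumes "finite U" "S \<subseteq> U" "dominates_set (parcs G) S U" "card S \<le> n"
  shows "\<gamma> (induced G U) \<le> n"
  using assms by (auto simp: domination_number_induced_le_iff)

lemma dominates_set_restrict: "S \<subseteq> U \<Longrightarrow> X \<subseteq> U \<Longrightarrow> dominates_set (E \<inter> U \<times> U) S X \<longleftrightarrow> dominates_set E S X"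
  unfolding dominates_set_def by blast

section \<open>From weak bicritical graphs to relations and back\<close>

lemma weak_bicritical_relI:
  assumes G: "pair_graph G" and wk: "weak_k_bicritical k G"
  shows "weak_bicritical_rel (pverts G) (parcs G) k"
proof -
  have wf: "pair_wf_digraph G" and fin: "finite (pverts G)"
    using G by (auto simp: pair_graph_iff pair_wf_digraph_iff)
  have wb: "weak_bicritical G" and k: "\<gamma> G = k" using wk by (auto simp: weak_k_bicritical_def)
  note le_iff = domination_number_induced_le_iff[OF finite_subset[OF _ fin]]
  show ?thesis
  proof unfold_locales
    show "finite (pverts G)" "\<And>a b. (a, b) \<in> parcs G \<Longrightarrow> a \<in> pverts G \<and> b \<in> pverts G"
      "\<And>a b. (a, b) \<in> parcs G \<Longrightarrow> (b, a) \<in> parcs G" "\<And>a. (a, a) \<notin> parcs G"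
      using G by (auto simp: pair_graph_iff sym_def irrefl_def)
    show "k \<le> card S" if "S \<subseteq> pverts G" "dominates_set (parcs G) S (pverts G)" for S
      using le_iff[of "pverts G" G "card S"] that k induced_self[OF wf] by auto
    show "(\<exists>D\<subseteq>pverts G - {z}. card D < k \<and> dominates_set (parcs G) D (pverts G - {z})) \<or>
      (\<forall>S\<subseteq>pverts G - {z}. dominates_set (parcs G) S (pverts G - {z}) \<longrightarrow> k \<le> card S) \<and>
      (\<forall>v\<in>pverts G - {z}. \<exists>D\<subseteq>pverts G - {z, v}. card D < k \<and> dominates_set (parcs G) D (pverts G - {z, v}))"
      if z: "z \<in> pverts G" for z
    proof -
      let ?Gz = "delete_vertex G z"
      have dz: "?Gz = induced G (pverts G - {z})" by (rule delete_vertex_conv[OF wf])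
      have "\<not> \<gamma> ?Gz > k" using wb k z by (auto simp: weak_bicritical_def V_plus_def)
      then consider "\<gamma> ?Gz < k" | "\<gamma> ?Gz = k" by linarith
      then show ?thesis
      proof cases
        case 1
        have "\<gamma> ?Gz \<le> \<gamma> ?Gz" by simp
        then obtain S where "S \<subseteq> pverts G - {z}" "dominates_set (parcs G) S (pverts G - {z})" "card S \<le> \<gamma> ?Gz"
          using le_iff[of "pverts G - {z}" G "\<gamma> ?Gz"] unfolding dz by auto
        then show ?thesis using 1 by auto
      next
        case 2
        then have "critical ?Gz" using wb k z by (auto simp: weak_bicritical_def V_zero_def)
        then have V: "V_minus ?Gz = pverts G - {z}" by (simp add: critical_def dz)
        have "\<exists>D\<subseteq>pverts G - {z, v}. card D < k \<and> dominates_set (parcs G) D (pverts G - {z, v})"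
          if v: "v \<in> pverts G - {z}" for v
        proof -
          have dv: "delete_vertex ?Gz v = induced G (pverts G - {z, v})"
            unfolding dz delete_vertex_induced by (rule arg_cong[where f = "induced G"]) auto
          have "\<gamma> (delete_vertex ?Gz v) < k" using v V 2 unfolding V_minus_def by auto
          then have "\<gamma> (induced G (pverts G - {z, v})) \<le> k - 1" "0 < k" unfolding dv by auto
          then obtain S where "S \<subseteq> pverts G - {z, v}" "dominates_set (parcs G) S (pverts G - {z, v})" "card S \<le> k - 1"
            using le_iff[of "pverts G - {z, v}" G "k - 1"] by auto
          then show ?thesis using \<open>0 < k\<close> by (intro exI[of _ S]) auto
        qed
        moreover have "k \<le> card S" if "S \<subseteq> pverts G - {z}" "dominates_set (parcs G) S (pverts G - {z})" for S
          using le_iff[of "pverts G - {z}" G "card S"] that 2 unfolding dz by auto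
        ultimately show ?thesis by blast
      qed
    qed
  qed
qed

text \<open>The way back, for the graph left after splitting, which is known only through its
  relation. \<open>S\<close> gives the upper bound on \<gamma>. The second vertex \<open>v\<close>
  from \<open>two\<close> bounds the number after deleting a noncritical \<open>z\<close>: a set for
  \<open>z\<close> and \<open>v\<close> is completed by \<open>v\<close> itself.\<close>

lemma weak_k_bicriticalI:
  assumes G: "pair_graph G" and rel: "weak_bicritical_rel (pverts G) (parcs G) k"
    and S: "S \<subseteq> pverts G" "dominates_set (parcs G) S (pverts G)" "card S \<le> k"
    and two: "\<And>z. z \<in> pverts G \<Longrightarrow> \<exists>v\<in>pverts G. v \<noteq> z"
  shows "weak_k_bicritical k G"
proof -
  interpret weak_bicritical_rel "pverts G" "parcs G" k by (fact rel)
  have wf: "pair_wf_digraph G" and fin: "finite (pverts G)"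
    using G by (auto simp: pair_graph_iff pair_wf_digraph_iff)
  note le_iff = domination_number_induced_le_iff[OF finite_subset[OF _ fin]]
  have "\<gamma> G \<le> k" using le_iff[of "pverts G" G k] S induced_self[OF wf] by auto
  obtain S0 where "S0 \<subseteq> pverts G" "dominates_set (parcs G) S0 (pverts G)" "card S0 \<le> \<gamma> G"
    using le_iff[of "pverts G" G "\<gamma> G"] induced_self[OF wf] by auto
  then have "k \<le> \<gamma> G" using dominating_ge[of S0] by simp
  then have k: "\<gamma> G = k" using \<open>\<gamma> G \<le> k\<close> by simp
  have dz: "delete_vertex G z = induced G (pverts G - {z})" for z by (rule delete_vertex_conv[OF wf])
  have nc: "\<gamma> (delete_vertex G z) = k \<and> critical (delete_vertex G z)"
    if z: "z \<in> pverts G" and nz: "\<not> crit z" for z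
  proof -
    have less: "\<gamma> (induced G (pverts G - {z, v})) < k \<and> \<gamma> (induced G (pverts G - {z})) \<le> k"
      if v: "v \<in> pverts G" "v \<noteq> z" for v
    proof -
      obtain D where D: "D \<subseteq> pverts G" "z \<notin> D" "v \<notin> D" "card D < k" "dominates_set (parcs G) D (pverts G - {z, v})"
        by (rule noncritE[OF nz z v]) (rule that)
      then have "\<gamma> (induced G (pverts G - {z, v})) \<le> k - 1"
        using fin by (intro domination_number_induced_leI[where S = D]) auto
      moreover have "card (insert v D) \<le> k" using D card_insert_le_m1[of k D v] by linarith
      then have "\<gamma> (induced G (pverts G - {z})) \<le> k"
        using D v fin
        by (intro domination_number_induced_leI[where S = "insert v D"]) (auto simp: dominates_set_def)
      ultimately show ?thesis using D(4) by linarith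
    qed
    have low: "k \<le> card D" if "D \<subseteq> pverts G - {z}" "dominates_set (parcs G) D (pverts G - {z})" for D
      using nz that critI[of D z] by (cases "card D < k") auto
    obtain S1 where "S1 \<subseteq> pverts G - {z}" "dominates_set (parcs G) S1 (pverts G - {z})"
      "card S1 \<le> \<gamma> (induced G (pverts G - {z}))"
      using le_iff[of "pverts G - {z}" G "\<gamma> (induced G (pverts G - {z}))"] by auto
    then have "k \<le> \<gamma> (induced G (pverts G - {z}))" using low[of S1] by linarith
    moreover obtain v where "v \<in> pverts G" "v \<noteq> z" using two[OF z] by blast
    ultimately have eq: "\<gamma> (induced G (pverts G - {z})) = k" using less[of v] by simp
    have "pverts G - {z} - {v} = pverts G - {z, v}" for v by auto
    then have "V_minus (induced G (pverts G - {z})) = pverts G - {z}"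
      unfolding V_minus_def delete_vertex_induced eq using less by auto
    then show ?thesis using eq by (simp add: dz critical_def)
  qed
  have cr: "\<gamma> (delete_vertex G z) < k" if z: "z \<in> pverts G" and cz: "crit z" for z
  proof -
    obtain D where D: "D \<subseteq> pverts G" "z \<notin> D" "card D < k" "dominates_set (parcs G) D (pverts G - {z})"
      by (rule critE[OF cz z]) (rule that)
    then have "\<gamma> (delete_vertex G z) \<le> k - 1"
      unfolding dz using fin by (intro domination_number_induced_leI[where S = D]) auto
    then show ?thesis using D(3) by linarith
  qed
  have "\<not> k < \<gamma> (delete_vertex G z)" if "z \<in> pverts G" for z
    using nc[OF that] cr[OF that] by (cases "crit z") auto
  then have "V_plus G = {}" by (auto simp: V_plus_def k)
  moreover have "critical (delete_vertex G z)" if "z \<in> V_zero G" for z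
    using that nc[of z] cr[of z] by (cases "crit z") (auto simp: V_zero_def k)
  ultimately show ?thesis using k by (simp add: weak_k_bicritical_def weak_bicritical_def)
qed

lemma V_minusI:
  assumes G: "pair_graph G" and rel: "weak_bicritical_rel (pverts G) (parcs G) k"
    and w: "w \<in> pverts G" "T \<subseteq> pverts G" "w \<notin> T" "card T < k" "dominates_set (parcs G) T (pverts G - {w})"
  shows "w \<in> V_minus G"
proof -
  interpret weak_bicritical_rel "pverts G" "parcs G" k by (fact rel)
  have wf: "pair_wf_digraph G" and fin: "finite (pverts G)"
    using G by (auto simp: pair_graph_iff pair_wf_digraph_iff)
  note le_iff = domination_number_induced_le_iff[OF finite_subset[OF _ fin]]
  obtain S0 where "S0 \<subseteq> pverts G" "dominates_set (parcs G) S0 (pverts G)" "card S0 \<le> \<gamma> G"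
    using le_iff[of "pverts G" G "\<gamma> G"] induced_self[OF wf] by auto
  then have "k \<le> \<gamma> G" using dominating_ge[of S0] by simp
  moreover have "\<gamma> (delete_vertex G w) \<le> card T"
    unfolding delete_vertex_conv[OF wf] using w fin by (intro domination_number_induced_leI[where S = T]) auto
  ultimately show ?thesis using w by (simp add: V_minus_def)
qed


subsection \<open>Isomorphism\<close>

lemma isomorphicI:
  assumes "bij_betw f (pverts G) (pverts H)" "pair_wf_digraph G" "pair_wf_digraph H"
    and "\<And>a b. a \<in> pverts G \<Longrightarrow> b \<in> pverts G \<Longrightarrow> (a, b) \<in> parcs G \<longleftrightarrow> (f a, f b) \<in> parcs H"
  shows "G \<cong>\<^sub>G H"
proof -
  let ?h = "\<lparr>iso_verts = f, iso_arcs = map_prod f f, iso_head = snd, iso_tail = fst\<rparr>"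
  have inj: "inj_on f (pverts G)" using assms(1) by (rule bij_betw_imp_inj_on)
  have img: "f ` pverts G = pverts H" using assms(1) by (rule bij_betw_imp_surj_on)
  have wfG: "parcs G \<subseteq> pverts G \<times> pverts G" and wfH: "parcs H \<subseteq> pverts H \<times> pverts H"
    using assms by (simp_all add: pair_wf_digraph_iff)
  have arcs: "map_prod f f ` parcs G = parcs H"
  proof (intro equalityI subsetI)
    fix e assume "e \<in> map_prod f f ` parcs G"
    then show "e \<in> parcs H" using assms(4) wfG by fastforce
  next
    fix e assume e: "e \<in> parcs H"
    then obtain a b where ab: "e = (f a, f b)" "a \<in> pverts G" "b \<in> pverts G"
      using wfH img by (cases e) blast
    then have "(a, b) \<in> parcs G" using assms(4) e by simp
    then show "e \<in> map_prod f f ` parcs G" using ab by force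
  qed
  have "inj_on (map_prod f f) (parcs G)"
    using wfG map_prod_inj_on[OF inj inj] by (rule inj_on_subset[rotated])
  then have "pre_digraph.digraph_isomorphism (with_proj G) ?h"
    using inj assms(2) wf_digraph_wp_iff[of G]
    by (auto simp: pre_digraph.digraph_isomorphism_def)
  moreover have "with_proj H = app_iso ?h (with_proj G)"
    using img arcs by (simp add: app_iso_def with_proj_def)
  ultimately show ?thesis unfolding digraph_iso_def by blast
qed

text \<open>A digraph isomorphism carries its own arc map and endpoint maps. Since the endpoints in
  \<open>with_proj\<close> are the projections of a pair, the arc map is forced to be the vertex map
  on both components.\<close>

lemma isomorphicE:
  assumes "G \<cong>\<^sub>G H"
  obtains f where "bij_betw f (pverts G) (pverts H)" "pair_wf_digraph G" "pair_wf_digraph H"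
    "\<And>a b. a \<in> pverts G \<Longrightarrow> b \<in> pverts G \<Longrightarrow> (a, b) \<in> parcs G \<longleftrightarrow> (f a, f b) \<in> parcs H"
proof -
  obtain h where h: "pre_digraph.digraph_isomorphism (with_proj G) h" "with_proj H = app_iso h (with_proj G)"
    using assms unfolding digraph_iso_def by blast
  define f where "f = iso_verts h"
  have wfG: "wf_digraph (with_proj G)" and inj: "inj_on f (pverts G)"
    and arc: "\<And>a. a \<in> parcs G \<Longrightarrow> f (fst a) = iso_tail h (iso_arcs h a) \<and> f (snd a) = iso_head h (iso_arcs h a)"
    using h(1) by (auto simp: pre_digraph.digraph_isomorphism_def f_def)
  have "verts (with_proj H) = f ` pverts G" "arcs (with_proj H) = iso_arcs h ` parcs G"
    "tail (with_proj H) = iso_tail h" "head (with_proj H) = iso_head h"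
    unfolding h(2) by (simp_all add: f_def)
  then have vH: "pverts H = f ` pverts G" and aH: "parcs H = iso_arcs h ` parcs G"
    and th: "iso_tail h = fst" "iso_head h = snd" by simp_all
  have "iso_arcs h a = (f (fst a), f (snd a))" if "a \<in> parcs G" for a
    using arc[OF that] th by (simp add: prod_eq_iff)
  then have aH': "parcs H = (\<lambda>a. (f (fst a), f (snd a))) ` parcs G" unfolding aH by (rule image_cong[OF refl])
  have wG: "pair_wf_digraph G" using wfG by (simp add: wf_digraph_wp_iff)
  then have sG: "parcs G \<subseteq> pverts G \<times> pverts G" by (simp add: pair_wf_digraph_iff)
  have "parcs H \<subseteq> pverts H \<times> pverts H" using sG unfolding aH' vH by auto
  moreover have "(a, b) \<in> parcs G \<longleftrightarrow> (f a, f b) \<in> parcs H" if ab: "a \<in> pverts G" "b \<in> pverts G" for a b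
  proof
    assume "(a, b) \<in> parcs G"
    then show "(f a, f b) \<in> parcs H" unfolding aH' by force
  next
    assume "(f a, f b) \<in> parcs H"
    then obtain c d where cd: "(c, d) \<in> parcs G" "f c = f a" "f d = f b" unfolding aH' by auto
    then have "c = a" "d = b" using inj sG ab by (auto dest: inj_onD)
    then show "(a, b) \<in> parcs G" using cd by simp
  qed
  ultimately show ?thesis
    using that[of f] inj vH wG by (simp add: bij_betw_def pair_wf_digraph_iff)
qed

section \<open>Removing an ordinary end\<close>

context extremal
begin

definition upper :: "'a set" where "upper = {v \<in> V. 2 \<le> l v}"

lemma exchange_upper:
  assumes w: "layer 2 = {w}" and co: "comatching E (layer 1)"
    and D: "D \<subseteq> V" "card D < k" "dominates_set E D (V - Z)" "\<And>z. z \<in> Z \<Longrightarrow> 3 \<le> l z" "D \<inter> Z = {}"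
  obtains D' where "D' \<subseteq> upper - Z" "card D' < k - 1" "dominates_set E D' (upper - Z)"
proof -
  have fin: "finite D" using D finV by (auto intro: finite_subset)
  have lw: "w \<in> V" "l w = 2" using w layerD by blast+
  have wZ: "w \<notin> Z" using D(4) lw by force
  define D0 where "D0 = {s \<in> D. 2 \<le> l s}"
  define D1 where "D1 = {s \<in> D. \<not> 2 \<le> l s}"
  have fin1: "finite D1" "finite D0" using fin by (auto simp: D1_def D0_def)
  have card: "card D = card D0 + card D1" unfolding D0_def D1_def by (rule card_split[OF fin])
  have D0: "D0 \<subseteq> upper - Z" using D(1,5) by (auto simp: D0_def upper_def)
  have "x \<notin> Z" using D(4)[of x] by auto
  then obtain p where p: "p \<in> D" "p = x \<or> (x, p) \<in> E" using D(3) xV by (auto elim: dominates_setE)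
  have pD1: "p \<in> D1" using p lip[of x p] by (auto simp: D1_def)
  then have card1: "1 \<le> card D1" using fin1 by (metis One_nat_def Suc_leI card_gt_0_iff empty_iff)
  have high: "\<exists>s\<in>D0. s = u \<or> (u, s) \<in> E" if u: "u \<in> V - Z" "3 \<le> l u" for u
  proof -
    obtain s where s: "s \<in> D" "s = u \<or> (u, s) \<in> E" using D(3) u by (auto elim: dominates_setE)
    have "2 \<le> l s" using s(2) u(2) lip'[of u s] by auto
    then show ?thesis using s by (auto simp: D0_def)
  qed
  have upper: "u = w \<or> 3 \<le> l u" if "u \<in> upper" for u
  proof (cases "l u = 2")
    case True
    then have "u \<in> layer 2" using that by (simp add: upper_def layer_def)
    then show ?thesis using w by simp
  qed (use that in \<open>auto simp: upper_def\<close>)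
  have domI: "dominates_set E S (upper - Z)" if "D0 \<subseteq> S" "\<exists>s\<in>S. s = w \<or> (w, s) \<in> E" for S
    unfolding dominates_set_def
  proof
    fix u assume u: "u \<in> upper - Z"
    then have uV: "u \<in> V - Z" by (auto simp: upper_def)
    show "\<exists>s\<in>S. s = u \<or> (u, s) \<in> E"
      using upper[of u] u that high[OF uV] by blast
  qed
  show ?thesis
  proof (cases "card D1 = 1 \<or> w \<in> D")
    case True
    have "\<exists>s\<in>D0. s = w \<or> (w, s) \<in> E"
    proof (cases "w \<in> D")
      case True
      then show ?thesis using lw by (auto simp: D0_def)
    next
      case False
      then have "card D1 = 1" using True by simp
      then have D1p: "D1 = {p}" using pD1 by (metis card_1_singletonE singletonD)
      have "p = x"
      proof (rule ccontr)
        assume "p \<noteq> x"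
        then have "p \<in> layer 1" using p layer_1_iff by blast
        then obtain q where q: "q \<in> layer 1" "q \<noteq> p" "(q, p) \<notin> E"
          using comatchingE[OF co sym] by metis
        have "q \<in> V - Z" using layerD[OF q(1)] D(4)[of q] by auto
        then obtain s where s: "s \<in> D" "s = q \<or> (q, s) \<in> E" using D(3) by (auto elim: dominates_setE)
        have "l s \<le> 2" using s(2) layerD[OF q(1)] lip[of q s] by auto
        moreover have "s \<noteq> p" using s q by auto
        then have "2 \<le> l s" using s(1) D1p by (auto simp: D1_def)
        ultimately have "s \<in> layer 2" using s(1) D(1) by (auto simp: layer_def)
        then show False using w s(1) False by simp
      qed
      have "w \<in> V - Z" using lw wZ by simp
      then obtain s where s: "s \<in> D" "s = w \<or> (w, s) \<in> E" using D(3) by (auto elim: dominates_setE)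
      have "l s \<noteq> 0" using s(2) lw lip'[of w s] by auto
      then have "s \<noteq> x" by auto
      then have "s \<in> D0" using s(1) D1p \<open>p = x\<close> by (auto simp: D1_def D0_def)
      then show ?thesis using s by blast
    qed
    then have "dominates_set E D0 (upper - Z)" using domI[of D0] by simp
    then show ?thesis using that[of D0] D0 card card1 D(2) by simp
  next
    case False
    have "dominates_set E (insert w D0) (upper - Z)" by (rule domI) auto
    moreover have "insert w D0 \<subseteq> upper - Z" using D0 lw wZ by (auto simp: upper_def)
    moreover have "card (insert w D0) < k - 1"
      using False card1 card D(2) card_insert_le_m1[of "Suc (card D0)" D0 w] by linarith
    ultimately show ?thesis using that by blast
  qed
qed

text \<open>\<open>x\<close> alone dominates layers 0 and 1. So lower bounds for \<open>V\<close>
  pass to the upper part at the cost of one, matching the element saved in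
  \<open>exchange_upper\<close>.\<close>

lemma extend_dominating:
  assumes w: "layer 2 = {w}" and S: "S \<subseteq> upper" "dominates_set E S (upper - Z)" "\<And>z. z \<in> Z \<Longrightarrow> 3 \<le> l z"
  shows "dominates_set E (insert x S) (V - Z)"
  unfolding dominates_set_def
proof
  fix u assume u: "u \<in> V - Z"
  show "\<exists>s\<in>insert x S. s = u \<or> (u, s) \<in> E"
  proof (cases "2 \<le> l u")
    case True
    then have "u \<in> upper - Z" using u by (auto simp: upper_def)
    then show ?thesis using S(2) by (auto elim: dominates_setE)
  next
    case False
    then have "u = x \<or> u \<in> layer 1" using u layer_1I[of u] by auto
    then show ?thesis using layer_1_iff symE by blast
  qed
qed

text \<open>\<open>T\<close> makes \<open>w\<close> critical in the upper part. Every other vertex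
  keeps its type: small sets are moved up by the exchange, and lower bounds by adding
  \<open>x\<close>.\<close>

lemma weak_bicritical_upper:
  assumes w: "layer 2 = {w}" and co: "comatching E (layer 1)"
    and T: "T \<subseteq> V" "\<And>t. t \<in> T \<Longrightarrow> 3 \<le> l t" "card T + 1 < k" "dominates_set E T {v \<in> V. 3 \<le> l v}"
  shows "weak_bicritical_rel upper (E \<inter> upper \<times> upper) (k - 1)"
proof -
  have lw: "w \<in> V" "l w = 2" using w layerD by blast+
  have restrict: "dominates_set (E \<inter> upper \<times> upper) S X \<longleftrightarrow> dominates_set E S X" if "S \<subseteq> upper" "X \<subseteq> upper" for S X
    by (rule dominates_set_restrict[OF that])
  have upper: "3 \<le> l u" if "u \<in> upper" "u \<noteq> w" for u
  proof -
    have "u \<notin> layer 2" using that w by simp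
    then show ?thesis using that by (auto simp: upper_def layer_def)
  qed
  have uV: "upper \<subseteq> V" by (auto simp: upper_def)
  have finU: "finite upper" using finV uV by (rule finite_subset[rotated])
  have x_upper: "x \<notin> upper" by (simp add: upper_def)
  show ?thesis
  proof unfold_locales
    show "finite upper" by (rule finU)
    show "\<And>a b. (a, b) \<in> E \<inter> upper \<times> upper \<Longrightarrow> a \<in> upper \<and> b \<in> upper" by blast
    show "\<And>a b. (a, b) \<in> E \<inter> upper \<times> upper \<Longrightarrow> (b, a) \<in> E \<inter> upper \<times> upper" using symE by blast
    show "\<And>a. (a, a) \<notin> E \<inter> upper \<times> upper" using irrE by blast
    show "k - 1 \<le> card S" if S: "S \<subseteq> upper" "dominates_set (E \<inter> upper \<times> upper) S upper" for S
    proof -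
      have "dominates_set E S (upper - {})" using S restrict by simp
      then have "dominates_set E (insert x S) (V - {})" using S by (intro extend_dominating[OF w]) auto
      then have "k \<le> card (insert x S)" using S(1) uV xV by (intro dominating_ge) auto
      also have "\<dots> \<le> Suc (card S)" by (rule card_insert_le_m1) auto
      finally show ?thesis by simp
    qed
    fix h assume h: "h \<in> upper"
    show "(\<exists>D\<subseteq>upper - {h}. card D < k - 1 \<and> dominates_set (E \<inter> upper \<times> upper) D (upper - {h})) \<or>
      (\<forall>S\<subseteq>upper - {h}. dominates_set (E \<inter> upper \<times> upper) S (upper - {h}) \<longrightarrow> k - 1 \<le> card S) \<and>
      (\<forall>v\<in>upper - {h}. \<exists>D\<subseteq>upper - {h, v}. card D < k - 1 \<and>
         dominates_set (E \<inter> upper \<times> upper) D (upper - {h, v}))"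
    proof (cases "h = w")
      case True
      have "T \<subseteq> upper - {h}" using T(1,2) lw True by (force simp: upper_def)
      moreover have "dominates_set E T (upper - {h})"
        using T(4) upper True uV by (auto simp: dominates_set_def)
      moreover have "card T < k - 1" using T(3) by simp
      ultimately show ?thesis using restrict[of T "upper - {h}"] by blast
    next
      case False
      have lh: "3 \<le> l h" "h \<in> V" using upper[OF h False] h uV by auto
      show ?thesis
      proof (cases "crit h")
        case True
        then obtain D where D: "D \<subseteq> V" "h \<notin> D" "card D < k" "dominates_set E D (V - {h})"
          by (rule critE[OF _ lh(2)]) (rule that)
        obtain D' where "D' \<subseteq> upper - {h}" "card D' < k - 1" "dominates_set E D' (upper - {h})"
          by (rule exchange_upper[OF w co D(1,3,4)]) (use lh D(2) that in auto)
        then show ?thesis using restrict[of D' "upper - {h}"] by blast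
      next
        case nh: False
        have "k - 1 \<le> card S" if S: "S \<subseteq> upper - {h}" "dominates_set (E \<inter> upper \<times> upper) S (upper - {h})" for S
        proof -
          have "dominates_set E S (upper - {h})" using S restrict[of S "upper - {h}"] by blast
          then have "dominates_set E (insert x S) (V - {h})" using S lh by (intro extend_dominating[OF w]) auto
          moreover have "insert x S \<subseteq> V" "h \<notin> insert x S" using S h uV xV x_upper by auto
          ultimately have "\<not> card (insert x S) < k" using nh critI[of "insert x S" h] by blast
          moreover have "card (insert x S) \<le> Suc (card S)" by (rule card_insert_le_m1) auto
          ultimately show ?thesis by simp
        qed
        moreover have "\<exists>D\<subseteq>upper - {h, v}. card D < k - 1 \<and> dominates_set (E \<inter> upper \<times> upper) D (upper - {h, v})"
          if v: "v \<in> upper - {h}" for v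
        proof -
          have vV: "v \<in> V" "v \<noteq> h" using v uV by auto
          then obtain D where D: "D \<subseteq> V" "h \<notin> D" "v \<notin> D" "card D < k" "dominates_set E D (V - {h, v})"
            by (rule noncritE[OF nh lh(2)]) (rule that)
          have "\<exists>D'\<subseteq>upper - {h, v}. card D' < k - 1 \<and> dominates_set E D' (upper - {h, v})"
          proof (cases "v = w")
            case False
            then have lv: "3 \<le> l v" using upper v by blast
            obtain D' where "D' \<subseteq> upper - {h, v}" "card D' < k - 1" "dominates_set E D' (upper - {h, v})"
              by (rule exchange_upper[OF w co D(1,4,5)]) (use lh lv D(2,3) that in auto)
            then show ?thesis by blast
          next
            case True
            have fin: "finite D" using D finV by (auto intro: finite_subset)
            \<comment> \<open>With \<open>w\<close> excepted there is nothing to repair: it suffices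
              to drop the low part, which contains a dominator of \<open>x\<close>.\<close>
            define D0 where "D0 = {s \<in> D. 2 \<le> l s}"
            have "x \<noteq> h" "x \<noteq> v" using x_upper h v by auto
            then obtain p where p: "p \<in> D" "p = x \<or> (x, p) \<in> E" using D(5) xV by (auto elim: dominates_setE)
            have "l p \<le> 1" using p lip[of x p] by auto
            then have "p \<notin> D0" by (simp add: D0_def)
            moreover have "D0 \<subseteq> D" by (auto simp: D0_def)
            ultimately have "D0 \<subset> D" using p(1) by blast
            then have "card D0 < card D" using fin by (rule psubset_card_mono[rotated])
            moreover have "D0 \<subseteq> upper - {h, v}" using D by (auto simp: D0_def upper_def)
            moreover have "dominates_set E D0 (upper - {h, v})"
              unfolding dominates_set_def
            proof
              fix u assume u: "u \<in> upper - {h, v}"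
              then have "u \<in> V - {h, v}" using uV by blast
              then obtain s where s: "s \<in> D" "s = u \<or> (u, s) \<in> E" using D(5) by (auto elim: dominates_setE)
              have "3 \<le> l u" using u upper True by blast
              then have "2 \<le> l s" using s(2) lip'[of u s] by auto
              then show "\<exists>s\<in>D0. s = u \<or> (u, s) \<in> E" using s by (auto simp: D0_def)
            qed
            ultimately show ?thesis using D(4) by (intro exI[of _ D0]) auto
          qed
          then show ?thesis using restrict[of _ "upper - {h, v}"] by blast
        qed
        ultimately show ?thesis by blast
      qed
    qed
  qed
qed

text \<open>Predecessors of layers above the second stay in the upper part. Thus everything there is
  reachable from \<open>w\<close>, at its old distance minus two.\<close>

lemma upper_walk:
  assumes "v \<in> layer (i + 2)" "layer 2 = {w}"
  shows "(w, v) \<in> (E \<inter> upper \<times> upper) ^^ i"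
  using assms(1)
proof (induction i arbitrary: v)
  case 0
  then have "v \<in> layer 2" by (simp only: add_0)
  then show ?case using assms(2) by simp
next
  case (Suc i)
  then obtain u where u: "u \<in> layer (i + 2)" "(u, v) \<in> E" using layer_pred[of v "i + 2"] by auto
  have "u \<in> upper" "v \<in> upper" using layerD[OF u(1)] layerD[OF Suc.prems] by (auto simp: upper_def)
  then show ?case using Suc.IH[OF u(1)] u(2) by auto
qed

lemma upper_walk_ge:
  "(w, v) \<in> (E \<inter> upper \<times> upper) ^^ i \<Longrightarrow> l v \<le> l w + i"
proof (induction i arbitrary: v)
  case (Suc i)
  then obtain u where "(w, u) \<in> (E \<inter> upper \<times> upper) ^^ i" "(u, v) \<in> E" by auto
  then show ?case using Suc.IH lip[of u v] by fastforce
qed auto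

end


section \<open>Complements of perfect matchings\<close>

lemma co_mK2_simps:
  "pverts (co_mK2 m) = {..<m} \<times> {..<2}"
  "(p, q) \<in> parcs (co_mK2 m) \<longleftrightarrow> p \<in> {..<m} \<times> {..<2} \<and> q \<in> {..<m} \<times> {..<2} \<and> fst p \<noteq> fst q"
  by (auto simp: graph_complement_def copies_def disjoint_sum_def complete_graph_def)

text \<open>The first coordinate numbers the nonadjacent pairs and the second tells their two
  vertices apart, as in \<open>co_mK2\<close>. The induction removes a vertex with its partner and
  gives this pair the new number \<open>m\<close>.\<close>

lemma comatching_enum:
  assumes "finite X" "sym E" "irrefl E" "comatching E X"
  shows "\<exists>(m::nat) h. bij_betw h X ({..<m} \<times> {..<2::nat}) \<and> (\<forall>a\<in>X. \<forall>b\<in>X. (a, b) \<in> E \<longleftrightarrow> fst (h a) \<noteq> fst (h b))"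
  using assms(1,4)
proof (induction X rule: finite_psubset_induct)
  case (psubset X)
  show ?case
  proof (cases "X = {}")
    case True
    then show ?thesis by (intro exI[of _ "0::nat"] exI[of _ "\<lambda>_. (0, 0)"]) (auto simp: bij_betw_def)
  next
    case False
    then obtain v where v: "v \<in> X" by blast
    obtain p where p: "p \<in> X" "p \<noteq> v" "(v, p) \<notin> E" "(p, v) \<notin> E"
      "\<And>u. u \<in> X \<Longrightarrow> u \<noteq> v \<Longrightarrow> u \<noteq> p \<Longrightarrow> (u, p) \<in> E \<and> (u, v) \<in> E"
      by (rule comatchingE[OF psubset.prems assms(2) v]) (rule that)
    let ?Y = "X - {v, p}"
    have co: "comatching E ?Y"
      unfolding comatching_def
    proof
      fix a assume a: "a \<in> ?Y"
      then obtain b where b: "b \<in> X" "b \<noteq> a" "(a, b) \<notin> E" "(b, a) \<notin> E"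
        "\<And>u. u \<in> X \<Longrightarrow> u \<noteq> a \<Longrightarrow> u \<noteq> b \<Longrightarrow> (u, b) \<in> E \<and> (u, a) \<in> E"
        by (rule_tac comatchingE[OF psubset.prems assms(2), of a]) auto
      have "b \<noteq> v" "b \<noteq> p" using p(5)[of a] a b(3) by auto
      then show "\<exists>b\<in>?Y. b \<noteq> a \<and> (a, b) \<notin> E \<and> (\<forall>u\<in>?Y. u \<noteq> a \<longrightarrow> u \<noteq> b \<longrightarrow> (u, b) \<in> E)"
        using b by (intro bexI[of _ b]) auto
    qed
    have sub: "?Y \<subset> X" using v by blast
    from psubset.IH[OF sub co] obtain m :: nat and h where h: "bij_betw h ?Y ({..<m} \<times> {..<2::nat})"
      "\<forall>a\<in>?Y. \<forall>b\<in>?Y. (a, b) \<in> E \<longleftrightarrow> fst (h a) \<noteq> fst (h b)"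
      by blast
    define g where "g = h(v := (m, 0), p := (m, 1))"
    have gY: "g a = h a" if "a \<in> ?Y" for a using that by (simp add: g_def)
    have g: "g v = (m, 0)" "g p = (m, 1)" using p by (auto simp: g_def)
    have hm: "fst (h a) < m" if "a \<in> ?Y" for a using bij_betwE[OF h(1)] that by (auto simp: mem_Times_iff)
    have "bij_betw g ?Y ({..<m} \<times> {..<2})" using h(1) gY by (subst bij_betw_cong) auto
    moreover have "bij_betw g {v, p} {(m, 0), (m, 1)}" using g p by (auto simp: bij_betw_def inj_on_def)
    ultimately have "bij_betw g (?Y \<union> {v, p}) ({..<m} \<times> {..<2} \<union> {(m, 0), (m, 1)})"
      by (rule bij_betw_combine) auto
    moreover have "?Y \<union> {v, p} = X" using v p by auto
    moreover have "{..<m} \<times> {..<2} \<union> {(m, 0), (m, 1)} = {..<Suc m} \<times> {..<2::nat}" by (auto simp: less_Suc_eq numeral_2_eq_2)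
    ultimately have "bij_betw g X ({..<Suc m} \<times> {..<2})" by simp
    moreover have "(a, b) \<in> E \<longleftrightarrow> fst (g a) \<noteq> fst (g b)" if ab: "a \<in> X" "b \<in> X" for a b
    proof -
      have hv: "(a, v) \<in> E" "(v, a) \<in> E" "(a, p) \<in> E" "(p, a) \<in> E" if "a \<in> ?Y" for a
        using p(5)[of a] that assms(2) by (auto dest: symD)
      have "(a, a) \<notin> E" for a using assms(3) by (auto simp: irrefl_def)
      then show ?thesis
        using ab h(2) gY g hv hm[of a] hm[of b] p by (cases "a \<in> ?Y"; cases "b \<in> ?Y") auto
    qed
    ultimately show ?thesis by blast
  qed
qed

lemma comatching_enumE:
  assumes "finite X" "sym E" "irrefl E" "comatching E X"
  obtains m :: nat and h where "bij_betw h X ({..<m} \<times> {..<2::nat})"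
    "\<And>a b. a \<in> X \<Longrightarrow> b \<in> X \<Longrightarrow> (a, b) \<in> E \<longleftrightarrow> fst (h a) \<noteq> fst (h b)"
proof -
  from comatching_enum[OF assms] obtain m :: nat and h where
    "bij_betw h X ({..<m} \<times> {..<2::nat})" "\<forall>a\<in>X. \<forall>b\<in>X. (a, b) \<in> E \<longleftrightarrow> fst (h a) \<noteq> fst (h b)"
    by blast
  then show ?thesis using that[of h m] by blast
qed

lemma comatching_extend:
  assumes "comatching E X" "(a, b) \<notin> E" "(b, a) \<notin> E" "a \<noteq> b"
    and "\<And>v. v \<in> X \<Longrightarrow> (v, a) \<in> E \<and> (v, b) \<in> E \<and> (a, v) \<in> E \<and> (b, v) \<in> E"
  shows "comatching E (insert a (insert b X))"
  unfolding comatching_def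
proof
  fix v assume "v \<in> insert a (insert b X)"
  then consider "v = a" | "v = b" | "v \<in> X" by blast
  then show "\<exists>p\<in>insert a (insert b X). p \<noteq> v \<and> (v, p) \<notin> E \<and>
      (\<forall>u\<in>insert a (insert b X). u \<noteq> v \<longrightarrow> u \<noteq> p \<longrightarrow> (u, p) \<in> E)"
  proof cases
    case 3
    then obtain p where "p \<in> X" "p \<noteq> v" "(v, p) \<notin> E" "\<forall>u\<in>X. u \<noteq> v \<longrightarrow> u \<noteq> p \<longrightarrow> (u, p) \<in> E"
      using assms(1) unfolding comatching_def by blast
    then show ?thesis using assms(5) by (intro bexI[of _ p]) auto
  qed (use assms in auto)
qed

lemma enum_card_ge_2:
  fixes m :: nat
  assumes "bij_betw h X ({..<m} \<times> {..<2::nat})" "3 \<le> card X"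
  shows "2 \<le> m"
  using bij_betw_same_card[OF assms(1)] assms(2) by simp

lemma pair_wf_co_mK2: "pair_wf_digraph (co_mK2 m)"
  by (auto simp: pair_wf_digraph_iff graph_complement_def)

lemma pair_wf_identify_along: "pair_wf_digraph G \<Longrightarrow> pair_wf_digraph (identify_along f G)"
  by (auto simp: pair_wf_digraph_iff identify_along_def)

lemma pair_wf_disjoint_sum: "(\<And>i. pair_wf_digraph (H i)) \<Longrightarrow> pair_wf_digraph (disjoint_sum n H)"
  by (auto simp: pair_wf_digraph_iff disjoint_sum_def)

lemma pair_wf_chain: "pair_wf_digraph (chain ms u v)"
  unfolding chain_def by (intro pair_wf_identify_along pair_wf_disjoint_sum pair_wf_co_mK2)

text \<open>A chain of one block makes no identification. The nonadjacent pair only supplies the two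
  marked vertices that the family requires in every block.\<close>

lemma family_F_2I:
  assumes H: "pair_graph H" "comatching (parcs H) (pverts H)" "3 \<le> card (pverts H)"
    and ab: "a \<in> pverts H" "b \<in> pverts H" "a \<noteq> b" "(a, b) \<notin> parcs H"
  shows "family_F 2 H"
proof -
  have "finite (pverts H)" "sym (parcs H)" "irrefl (parcs H)" using H(1) by (auto simp: pair_graph_iff)
  then obtain m :: nat and h where
    h: "bij_betw h (pverts H) ({..<m} \<times> {..<2::nat})" and
    h2: "\<And>a b. a \<in> pverts H \<Longrightarrow> b \<in> pverts H \<Longrightarrow> (a, b) \<in> parcs H \<longleftrightarrow> fst (h a) \<noteq> fst (h b)"
    by (rule comatching_enumE[OF _ _ _ H(2)]) (rule that)
  have m: "2 \<le> m" using enum_card_ge_2[OF h] H(3) by simp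
  have chain: "pverts (chain [m] u v) = {0} \<times> ({..<m} \<times> {..<2})"
    "(p, q) \<in> parcs (chain [m] u v) \<longleftrightarrow>
      p \<in> {0} \<times> ({..<m} \<times> {..<2}) \<and> q \<in> {0} \<times> ({..<m} \<times> {..<2}) \<and> fst (snd p) \<noteq> fst (snd q)" for u v p q
    by (auto simp: chain_def identify_along_def disjoint_sum_def co_mK2_simps image_iff map_prod_def)
  have "H \<cong>\<^sub>G chain [m] (\<lambda>_. h a) (\<lambda>_. h b)"
  proof (rule isomorphicI)
    show "bij_betw (\<lambda>c. (0, h c)) (pverts H) (pverts (chain [m] (\<lambda>_. h a) (\<lambda>_. h b)))"
      using h unfolding chain bij_betw_def by (auto simp: inj_on_def)
    show "pair_wf_digraph H" using H(1) by (auto simp: pair_graph_iff pair_wf_digraph_iff)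
    show "pair_wf_digraph (chain [m] (\<lambda>_. h a) (\<lambda>_. h b))" by (rule pair_wf_chain)
    show "(c, d) \<in> parcs H \<longleftrightarrow> ((0, h c), (0, h d)) \<in> parcs (chain [m] (\<lambda>_. h a) (\<lambda>_. h b))"
      if "c \<in> pverts H" "d \<in> pverts H" for c d
      using h2[OF that] bij_betwE[OF h] that unfolding chain by (auto simp: mem_Times_iff)
  qed
  moreover have "h a \<in> {..<m} \<times> {..<2}" "h b \<in> {..<m} \<times> {..<2}" "h a \<noteq> h b" "fst (h a) = fst (h b)"
    using h2 ab bij_betwE[OF h] bij_betw_imp_inj_on[OF h] by (auto dest: inj_onD)
  ultimately show ?thesis
    unfolding family_F_def using m
    by (intro conjI exI[of _ "[m]"] exI[of _ "\<lambda>_. h a"] exI[of _ "\<lambda>_. h b"]) (auto simp: co_mK2_simps)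
qed

section \<open>Recognising members of the families\<close>

lemma pair_wf_disjoint_union: "pair_wf_digraph G \<Longrightarrow> pair_wf_digraph H \<Longrightarrow> pair_wf_digraph (disjoint_union G H)"
  by (auto simp: pair_wf_digraph_iff disjoint_union_def)

lemma pair_wf_coalesce: "pair_wf_digraph G \<Longrightarrow> pair_wf_digraph H \<Longrightarrow> pair_wf_digraph (coalesce G x H y)"
  unfolding coalesce_def by (intro pair_wf_identify_along pair_wf_disjoint_union)

lemma pair_wf_graph_complement: "pair_wf_digraph (graph_complement G)"
  by (auto simp: pair_wf_digraph_iff graph_complement_def)

lemma isomorphic_coalesce_induced:
  assumes G: "pair_graph G" and V: "V1 \<union> V2 = pverts G" "V1 \<inter> V2 = {w}"
    and sep: "\<And>a b. (a, b) \<in> parcs G \<Longrightarrow> a \<in> V1 \<and> b \<in> V1 \<or> a \<in> V2 \<and> b \<in> V2"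
  shows "G \<cong>\<^sub>G coalesce (induced G V1) w (induced G V2) w"
proof -
  let ?C = "coalesce (induced G V1) w (induced G V2) w"
  \<comment> \<open>\<open>coalesce\<close> keeps the right-hand copy of the glued vertex, so
    \<open>w\<close>, which lies in both parts, must go to the right.\<close>
  define f where "f = (\<lambda>v. if v \<in> V2 then Inr v else Inl v)"
  define \<phi> where "\<phi> = (id(Inl w := Inr w) :: 'a + 'a \<Rightarrow> 'a + 'a)"
  have w: "w \<in> V1" "w \<in> V2" using V(2) by blast+
  have f1: "\<phi> (Inl v) = f v" if "v \<in> V1" for v using that V(2) w by (auto simp: f_def \<phi>_def)
  have f2: "\<phi> (Inr v) = f v" if "v \<in> V2" for v using that by (auto simp: f_def \<phi>_def)
  have inj: "inj f" by (rule injI) (auto simp: f_def split: if_splits)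
  have vC: "pverts ?C = f ` pverts G"
  proof -
    have "pverts ?C = (\<lambda>v. \<phi> (Inl v)) ` V1 \<union> (\<lambda>v. \<phi> (Inr v)) ` V2"
      unfolding coalesce_def identify_along_def disjoint_union_def \<phi>_def[symmetric]
      by (simp add: image_Un image_image)
    also have "\<dots> = f ` V1 \<union> f ` V2" using f1 f2 by (auto simp: image_def)
    finally show ?thesis unfolding V(1)[symmetric] image_Un .
  qed
  have aC: "parcs ?C = map_prod f f ` parcs G"
  proof -
    have "parcs ?C = map_prod (\<lambda>v. \<phi> (Inl v)) (\<lambda>v. \<phi> (Inl v)) ` (parcs G \<inter> V1 \<times> V1) \<union>
      map_prod (\<lambda>v. \<phi> (Inr v)) (\<lambda>v. \<phi> (Inr v)) ` (parcs G \<inter> V2 \<times> V2)"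
      unfolding coalesce_def identify_along_def disjoint_union_def \<phi>_def[symmetric]
      by (simp add: image_Un image_image map_prod_def case_prod_beta)
    also have "\<dots> = map_prod f f ` (parcs G \<inter> V1 \<times> V1) \<union> map_prod f f ` (parcs G \<inter> V2 \<times> V2)"
      using f1 f2 by (intro arg_cong2[where f = "(\<union>)"] image_cong) auto
    also have "\<dots> = map_prod f f ` ((parcs G \<inter> V1 \<times> V1) \<union> (parcs G \<inter> V2 \<times> V2))" by (rule image_Un[symmetric])
    also have "(parcs G \<inter> V1 \<times> V1) \<union> (parcs G \<inter> V2 \<times> V2) = parcs G" using sep by auto
    finally show ?thesis .
  qed
  have wf: "pair_wf_digraph G" using G by (simp add: pair_graph_iff pair_wf_digraph_iff)
  show ?thesis
  proof (rule isomorphicI)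
    show "bij_betw f (pverts G) (pverts ?C)" unfolding vC using inj by (auto simp: bij_betw_def inj_on_def)
    show "pair_wf_digraph ?C" by (intro pair_wf_coalesce) (auto simp: pair_wf_digraph_iff)
    show "(a, b) \<in> parcs G \<longleftrightarrow> (f a, f b) \<in> parcs ?C" for a b
      unfolding aC using inj by (auto simp: inj_eq image_iff intro!: bexI[of _ "(a, b)"])
  qed (fact wf)
qed

lemma disjoint_sum_2:
  "pverts (disjoint_sum 2 H) = Pair 0 ` pverts (H 0) \<union> Pair 1 ` pverts (H 1)"
  "parcs (disjoint_sum 2 H) = {((0, a), (0, b)) | a b. (a, b) \<in> parcs (H 0)} \<union>
     {((1, a), (1, b)) | a b. (a, b) \<in> parcs (H 1)}"
  by (auto simp: disjoint_sum_def less_2_cases_iff)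

lemma family_F_3I:
  assumes H: "pair_graph H" and V: "B1 \<union> B2 = pverts H" "B1 \<inter> B2 = {c}"
    and sep: "\<And>a b. (a, b) \<in> parcs H \<Longrightarrow> a \<in> B1 \<and> b \<in> B1 \<or> a \<in> B2 \<and> b \<in> B2"
    and co: "comatching (parcs H) B1" "comatching (parcs H) B2" and card: "3 \<le> card B1" "3 \<le> card B2"
    and a: "a \<in> B1" "a \<noteq> c" "(a, c) \<notin> parcs H" and b: "b \<in> B2" "b \<noteq> c" "(c, b) \<notin> parcs H"
  shows "family_F 3 H"
proof -
  have "finite (pverts H)" and sym: "sym (parcs H)" and irr: "irrefl (parcs H)" using H(1) by (auto simp: pair_graph_iff)
  then have fin: "finite B1" "finite B2" using V(1) by (metis finite_Un)+
  obtain m1 :: nat and h1 where h1: "bij_betw h1 B1 ({..<m1} \<times> {..<2::nat})"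
    "\<And>a b. a \<in> B1 \<Longrightarrow> b \<in> B1 \<Longrightarrow> (a, b) \<in> parcs H \<longleftrightarrow> fst (h1 a) \<noteq> fst (h1 b)"
    by (rule comatching_enumE[OF fin(1) sym irr co(1)]) (rule that)
  obtain m2 :: nat and h2 where h2: "bij_betw h2 B2 ({..<m2} \<times> {..<2::nat})"
    "\<And>a b. a \<in> B2 \<Longrightarrow> b \<in> B2 \<Longrightarrow> (a, b) \<in> parcs H \<longleftrightarrow> fst (h2 a) \<noteq> fst (h2 b)"
    by (rule comatching_enumE[OF fin(2) sym irr co(2)]) (rule that)
  have c: "c \<in> B1" "c \<in> B2" using V(2) by blast+
  have m: "2 \<le> m1" "2 \<le> m2" using enum_card_ge_2[OF h1(1) card(1)] enum_card_ge_2[OF h2(1) card(2)] .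
  have im1: "h1 ` B1 = {..<m1} \<times> {..<2}" and im2: "h2 ` B2 = {..<m2} \<times> {..<2}"
    using h1(1) h2(1) by (auto simp: bij_betw_def)
  have inj1: "h1 x = h1 y \<longleftrightarrow> x = y" if "x \<in> B1" "y \<in> B1" for x y
    using h1(1) that by (auto simp: bij_betw_def dest: inj_onD)
  have inj2: "h2 x = h2 y \<longleftrightarrow> x = y" if "x \<in> B2" "y \<in> B2" for x y
    using h2(1) that by (auto simp: bij_betw_def dest: inj_onD)
  define u where "u = (\<lambda>i::nat. if i = 0 then h1 a else h2 c)"
  define v where "v = (\<lambda>i::nat. if i = 0 then h1 c else h2 b)"
  define \<phi> where "\<phi> = (\<lambda>(i, p). if Suc i < length [m1, m2] \<and> p = v i then (Suc i, u (Suc i)) else (i, p))"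
  \<comment> \<open>\<open>chain\<close> redirects \<open>v 0\<close> to \<open>u 1\<close>, so the
    shared vertex \<open>c\<close> survives in block 1. Hence membership in \<open>B2\<close> is
    tested first.\<close>
  define f where "f = (\<lambda>x. if x \<in> B2 then (1::nat, h2 x) else (0, h1 x))"
  have f1: "\<phi> (0, h1 x) = f x" if "x \<in> B1" for x
    using that V(2) c inj1[of x c] by (auto simp: \<phi>_def f_def u_def v_def)
  have f2: "\<phi> (1, h2 x) = f x" if "x \<in> B2" for x
    using that by (auto simp: \<phi>_def f_def)
  let ?S = "disjoint_sum 2 (\<lambda>i. co_mK2 ([m1, m2] ! i))"
  have chain: "chain [m1, m2] u v = identify_along \<phi> ?S" by (simp add: chain_def \<phi>_def numeral_2_eq_2)
  have vS: "pverts ?S = (\<lambda>x. (0, h1 x)) ` B1 \<union> (\<lambda>x. (1, h2 x)) ` B2"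
  proof -
    have "pverts ?S = {0} \<times> (h1 ` B1) \<union> {1} \<times> (h2 ` B2)"
      unfolding im1 im2 disjoint_sum_2 by (auto simp: co_mK2_simps)
    then show ?thesis by auto
  qed
  have aS: "parcs ?S = map_prod (\<lambda>x. (0, h1 x)) (\<lambda>x. (0, h1 x)) ` (parcs H \<inter> B1 \<times> B1) \<union>
      map_prod (\<lambda>x. (1, h2 x)) (\<lambda>x. (1, h2 x)) ` (parcs H \<inter> B2 \<times> B2)" (is "_ = ?R")
  proof -
    have "parcs ?S = {((0, p), (0, q)) | p q. p \<in> h1 ` B1 \<and> q \<in> h1 ` B1 \<and> fst p \<noteq> fst q} \<union>
      {((1, p), (1, q)) | p q. p \<in> h2 ` B2 \<and> q \<in> h2 ` B2 \<and> fst p \<noteq> fst q}"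
      unfolding im1 im2 disjoint_sum_2 by (simp add: co_mK2_simps conj_commute)
    also have "\<dots> = {((0, h1 x), (0, h1 y)) | x y. x \<in> B1 \<and> y \<in> B1 \<and> (x, y) \<in> parcs H} \<union>
      {((1, h2 x), (1, h2 y)) | x y. x \<in> B2 \<and> y \<in> B2 \<and> (x, y) \<in> parcs H}"
      using h1(2) h2(2) by blast
    also have "\<dots> = ?R" by (force simp: image_iff)
    finally show ?thesis .
  qed
  have vC: "pverts (chain [m1, m2] u v) = f ` pverts H"
  proof -
    have "pverts (chain [m1, m2] u v) = \<phi> ` pverts ?S" by (simp add: chain identify_along_def)
    also have "\<dots> = (\<lambda>x. \<phi> (0, h1 x)) ` B1 \<union> (\<lambda>x. \<phi> (1, h2 x)) ` B2"
      unfolding vS image_Un image_image ..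
    also have "\<dots> = f ` B1 \<union> f ` B2"
      using f1 f2 by (intro arg_cong2[where f = "(\<union>)"] image_cong) auto
    finally show ?thesis unfolding V(1)[symmetric] image_Un .
  qed
  have aC: "parcs (chain [m1, m2] u v) = map_prod f f ` parcs H"
  proof -
    have "parcs (chain [m1, m2] u v) = map_prod \<phi> \<phi> ` parcs ?S" by (simp add: chain identify_along_def)
    also have "\<dots> = map_prod (\<lambda>x. \<phi> (0, h1 x)) (\<lambda>x. \<phi> (0, h1 x)) ` (parcs H \<inter> B1 \<times> B1) \<union>
      map_prod (\<lambda>x. \<phi> (1, h2 x)) (\<lambda>x. \<phi> (1, h2 x)) ` (parcs H \<inter> B2 \<times> B2)"
      unfolding aS image_Un image_image by (simp add: map_prod_def case_prod_beta)
    also have "\<dots> = map_prod f f ` (parcs H \<inter> B1 \<times> B1) \<union> map_prod f f ` (parcs H \<inter> B2 \<times> B2)"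
      using f1 f2 by (intro arg_cong2[where f = "(\<union>)"] image_cong) auto
    also have "\<dots> = map_prod f f ` ((parcs H \<inter> B1 \<times> B1) \<union> (parcs H \<inter> B2 \<times> B2))" by (rule image_Un[symmetric])
    also have "(parcs H \<inter> B1 \<times> B1) \<union> (parcs H \<inter> B2 \<times> B2) = parcs H" using sep by auto
    finally show ?thesis .
  qed
  have inj: "inj_on f (pverts H)"
    unfolding V(1)[symmetric] by (rule inj_onI) (auto simp: f_def inj1 inj2 split: if_splits)
  have "H \<cong>\<^sub>G chain [m1, m2] u v"
  proof (rule isomorphicI)
    show "bij_betw f (pverts H) (pverts (chain [m1, m2] u v))" unfolding vC using inj by (rule inj_on_imp_bij_betw)
    show wf: "pair_wf_digraph H" using H by (simp add: pair_graph_iff pair_wf_digraph_iff)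
    show "pair_wf_digraph (chain [m1, m2] u v)" by (rule pair_wf_chain)
    show "(x, y) \<in> parcs H \<longleftrightarrow> (f x, f y) \<in> parcs (chain [m1, m2] u v)"
      if "x \<in> pverts H" "y \<in> pverts H" for x y
    proof
      assume "(f x, f y) \<in> parcs (chain [m1, m2] u v)"
      then obtain x' y' where *: "(x', y') \<in> parcs H" "f x' = f x" "f y' = f y" unfolding aC by auto
      then have "x' \<in> pverts H" "y' \<in> pverts H" using wf by (auto simp: pair_wf_digraph_iff)
      then have "x' = x" "y' = y" using * that inj by (auto dest: inj_onD)
      then show "(x, y) \<in> parcs H" using * by simp
    next
      assume "(x, y) \<in> parcs H"
      then show "(f x, f y) \<in> parcs (chain [m1, m2] u v)" unfolding aC by force
    qed
  qed
  moreover have "\<forall>i<2. u i \<in> pverts (co_mK2 ([m1, m2] ! i)) \<and> v i \<in> pverts (co_mK2 ([m1, m2] ! i)) \<and>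
        u i \<noteq> v i \<and> (u i, v i) \<notin> parcs (co_mK2 ([m1, m2] ! i))"
  proof -
    have "h1 a \<in> {..<m1} \<times> {..<2}" "h1 c \<in> {..<m1} \<times> {..<2}" "h1 a \<noteq> h1 c" "fst (h1 a) = fst (h1 c)"
      "h2 c \<in> {..<m2} \<times> {..<2}" "h2 b \<in> {..<m2} \<times> {..<2}" "h2 c \<noteq> h2 b" "fst (h2 c) = fst (h2 b)"
      using a b c im1 im2 inj1[of a c] inj2[of c b] h1(2)[of a c] h2(2)[of c b] by blast+
    moreover have "i = 0 \<or> i = 1" if "i < 2" for i :: nat using that by auto
    ultimately show ?thesis by (auto simp: co_mK2_simps u_def v_def)
  qed
  ultimately show ?thesis
    unfolding family_F_def using m
    by (intro conjI exI[of _ "[m1, m2]"] exI[of _ u] exI[of _ v]) auto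
qed


section \<open>The case of domination number two\<close>

text \<open>For \<open>k = 2\<close> a set with exceptions \<open>z\<close> and \<open>v\<close> has
  at most one element, and \<open>big\<close> makes it nonempty. This element is the partner of
  \<open>v\<close>.\<close>

lemma (in weak_bicritical_rel) comatching_delete_noncrit:
  assumes k: "k = 2" and z: "z \<in> V" "\<not> crit z" and big: "\<And>v. v \<in> V \<Longrightarrow> v \<noteq> z \<Longrightarrow> \<exists>u\<in>V. u \<noteq> z \<and> u \<noteq> v"
  shows "comatching E (V - {z})"
  unfolding comatching_def
proof
  fix v assume v: "v \<in> V - {z}"
  then obtain D where D: "D \<subseteq> V" "z \<notin> D" "v \<notin> D" "card D < k" "dominates_set E D (V - {z, v})"
    "\<And>s. s \<in> D \<Longrightarrow> (v, s) \<notin> E"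
    by (rule_tac noncritE[OF z(2,1), of v]) (use that in auto)
  obtain u where "u \<in> V" "u \<noteq> z" "u \<noteq> v" using big[of v] v by blast
  then obtain p where p: "p \<in> D" using D(5) by (blast elim: dominates_setE)
  have "finite D" using D(1) finV by (rule finite_subset)
  then have *: "s = p" if "s \<in> D" for s using D(4) k p that card_le_Suc0_iff_eq[of D] by auto
  have "(u, p) \<in> E" if "u \<in> V - {z}" "u \<noteq> v" "u \<noteq> p" for u
  proof -
    have "u \<in> V - {z, v}" using that by simp
    then obtain s where "s \<in> D" "s = u \<or> (u, s) \<in> E" using D(5) by (blast elim: dominates_setE)
    then show ?thesis using * that by blast
  qed
  moreover have "p \<in> V - {z}" "p \<noteq> v" "(v, p) \<notin> E" using D p by auto
  ultimately show "\<exists>p\<in>V - {z}. p \<noteq> v \<and> (v, p) \<notin> E \<and> (\<forall>u\<in>V - {z}. u \<noteq> v \<longrightarrow> u \<noteq> p \<longrightarrow> (u, p) \<in> E)"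
    by blast
qed

lemma (in weak_bicritical_rel) crit_k2E:
  assumes k: "k = 2" and z: "z \<in> V" "crit z" and big: "\<exists>u\<in>V. u \<noteq> z"
  obtains p where "p \<in> V" "p \<noteq> z" "(z, p) \<notin> E" "\<And>u. u \<in> V \<Longrightarrow> u \<noteq> z \<Longrightarrow> u \<noteq> p \<Longrightarrow> (u, p) \<in> E"
proof -
  obtain D where D: "D \<subseteq> V" "z \<notin> D" "card D < k" "dominates_set E D (V - {z})"
    "\<And>s. s \<in> D \<Longrightarrow> (z, s) \<notin> E"
    by (rule critE[OF z(2,1)]) (rule that)
  obtain u where "u \<in> V" "u \<noteq> z" using big by blast
  then obtain p where p: "p \<in> D" using D(4) by (blast elim: dominates_setE)
  have "finite D" using D(1) finV by (rule finite_subset)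
  then have *: "s = p" if "s \<in> D" for s using D(3) k p that card_le_Suc0_iff_eq[of D] by auto
  have "(u, p) \<in> E" if "u \<in> V" "u \<noteq> z" "u \<noteq> p" for u
  proof -
    have "u \<in> V - {z}" using that by simp
    then obtain s where "s \<in> D" "s = u \<or> (u, s) \<in> E" using D(4) by (blast elim: dominates_setE)
    then show ?thesis using * that by blast
  qed
  then show ?thesis using that[of p] p D by blast
qed

text \<open>The non-edges at a noncritical vertex \<open>z\<close> can only reach one pair of the matching formed by the
  non-edges of the rest of the graph.\<close>

lemma (in connected_weak_bicritical) k2_structure:
  assumes k: "k = 2" and ne: "V \<noteq> {}"
  shows "comatching E V \<or> (\<exists>z a p. z \<noteq> a \<and> z \<noteq> p \<and> a \<noteq> p \<and> {z, a, p} \<subseteq> V \<and> V \<noteq> {z, a, p} \<and>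
      (z, a) \<notin> E \<and> (a, p) \<notin> E \<and> comatching E (V - {z, a, p}) \<and>
      (\<forall>u\<in>V - {z, a, p}. (u, z) \<in> E \<and> (u, a) \<in> E \<and> (u, p) \<in> E))"
proof -
  have nonnbr: "\<exists>u\<in>V. u \<noteq> v \<and> (u, v) \<notin> E" if v: "v \<in> V" for v
  proof (rule ccontr)
    assume "\<not> ?thesis"
    then have "dominates_set E {v} V" by (auto simp: dominates_set_def)
    then show False using dominating_ge[of "{v}"] v k by simp
  qed
  have nbr: "\<exists>u\<in>V. (v, u) \<in> E" if v: "v \<in> V" for v
  proof -
    obtain u where u: "u \<in> V" "u \<noteq> v" using nonnbr[OF v] by blast
    then show ?thesis using converse_rtranclE[OF conn[OF v u(1)]] EV by metis
  qed
  show ?thesis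
  proof (cases "\<forall>z\<in>V. crit z")
    case True
    have "comatching E V"
      unfolding comatching_def
    proof
      fix v assume v: "v \<in> V"
      have big: "\<exists>u\<in>V. u \<noteq> v" using nonnbr[OF v] by blast
      obtain p where "p \<in> V" "p \<noteq> v" "(v, p) \<notin> E" "\<And>u. u \<in> V \<Longrightarrow> u \<noteq> v \<Longrightarrow> u \<noteq> p \<Longrightarrow> (u, p) \<in> E"
        by (rule crit_k2E[OF k v _ big]) (use True v that in auto)
      then show "\<exists>p\<in>V. p \<noteq> v \<and> (v, p) \<notin> E \<and> (\<forall>u\<in>V. u \<noteq> v \<longrightarrow> u \<noteq> p \<longrightarrow> (u, p) \<in> E)" by blast
    qed
    then show ?thesis ..
  next
    case False
    then obtain z where z: "z \<in> V" "\<not> crit z" by blast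
    have big: "\<exists>u\<in>V. u \<noteq> c \<and> u \<noteq> v" if c: "c \<in> V" and v: "v \<in> V" "v \<noteq> c" for c v
    proof -
      obtain u where u: "u \<in> V" "(c, u) \<in> E" using nbr[OF c] by blast
      obtain u' where u': "u' \<in> V" "u' \<noteq> c" "(u', c) \<notin> E" using nonnbr[OF c] by blast
      have "u \<noteq> c" "u \<noteq> u'" using u u' irrE symE by blast+
      then show ?thesis using u u' by metis
    qed
    have co: "comatching E (V - {c})" if "c \<in> V" "\<not> crit c" for c
      by (rule comatching_delete_noncrit[OF k that]) (use big[OF that(1)] in auto)
    note coz = co[OF z]
    obtain a where a: "a \<in> V" "a \<noteq> z" "(a, z) \<notin> E" using nonnbr[OF z(1)] by blast
    obtain p where p: "p \<in> V - {z}" "p \<noteq> a" "(a, p) \<notin> E" "(p, a) \<notin> E"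
      "\<And>u. u \<in> V - {z} \<Longrightarrow> u \<noteq> a \<Longrightarrow> u \<noteq> p \<Longrightarrow> (u, p) \<in> E \<and> (u, a) \<in> E"
      by (rule comatchingE[OF coz sym, of a]) (use a that in auto)
    have za: "(z, a) \<notin> E" using a symE by blast
    let ?A = "{z, a, p}"
    have rest: "(c, z) \<in> E" if c: "c \<in> V - ?A" for c
    proof (rule ccontr)
      assume cz: "(c, z) \<notin> E"
      then have zc: "(z, c) \<notin> E" using symE by blast
      \<comment> \<open>Deleting a noncritical \<open>q\<close> leaves a perfect matching of
        non-edges, in which \<open>z\<close> cannot miss both \<open>c\<close> and
        \<open>r\<close>.\<close>
      have no: False if q: "q \<in> V" "q \<noteq> z" "q \<noteq> c" and nq: "\<not> crit q" and r: "r \<in> V - {q}" "r \<noteq> z" "r \<noteq> c" "(z, r) \<notin> E" for q r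
      proof -
        have "z \<in> V - {q}" "c \<in> V - {q}" using z q c by auto
        then obtain t where t: "\<And>u. u \<in> V - {q} \<Longrightarrow> u \<noteq> z \<Longrightarrow> u \<noteq> t \<Longrightarrow> (u, z) \<in> E"
          using comatchingE[OF co[OF q(1) nq] sym, of z] by metis
        have "c = t" using t[of c] c q(3) cz by blast
        moreover have "r = t" using t[of r] r symE by blast
        ultimately show False using r by simp
      qed
      \<comment> \<open>The vertex tested is \<open>p\<close> if \<open>z\<close> and
        \<open>p\<close> are adjacent, and \<open>a\<close> otherwise. If it is noncritical, its
        deletion leaves \<open>z\<close> with two nonneighbours. If it is critical, it has a
        nonneighbour \<open>q\<close> dominating all the others, but every candidate for
        \<open>q\<close> misses one of \<open>z\<close> and \<open>p\<close>.\<close>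
      show False
      proof (cases "(z, p) \<in> E")
        case True
        show False
        proof (cases "crit p")
          case False
          then show False using no[of p a] p a za c by blast
        next
          case True
          have bigp: "\<exists>u\<in>V. u \<noteq> p" using a(1) p(2) by metis
          obtain q where q: "q \<in> V" "q \<noteq> p" "(p, q) \<notin> E" "\<And>u. u \<in> V \<Longrightarrow> u \<noteq> p \<Longrightarrow> u \<noteq> q \<Longrightarrow> (u, q) \<in> E"
            by (rule crit_k2E[OF k _ True]) (use p(1) bigp that in auto)
          have "q \<noteq> z" using q(3) \<open>(z, p) \<in> E\<close> symE by blast
          then have "q = a" using p(5)[of q] q(1-3) symE by blast
          then show False using q(4)[of z] za z(1) a(2) p(1) by auto
        qed
      next
        case False
        show False
        proof (cases "crit a")
          case nc: False
          show False using no[of a p] nc a p False c by blast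
        next
          case True
          obtain q where q: "q \<in> V" "q \<noteq> a" "(a, q) \<notin> E" "\<And>u. u \<in> V \<Longrightarrow> u \<noteq> a \<Longrightarrow> u \<noteq> q \<Longrightarrow> (u, q) \<in> E"
            by (rule crit_k2E[OF k a(1) True]) (use p(1,2) that in auto)
          have "q = z \<or> q = p" using p(5)[of q] q(1-3) symE by blast
          then show False using q(4)[of z] q(4)[of p] False z(1) a(2) p(1,2) symE by blast
        qed
      qed
    qed
    have "comatching E (V - ?A)"
      unfolding comatching_def
    proof
      fix v assume v: "v \<in> V - ?A"
      obtain q where q: "q \<in> V - {z}" "q \<noteq> v" "(v, q) \<notin> E"
        "\<And>u. u \<in> V - {z} \<Longrightarrow> u \<noteq> v \<Longrightarrow> u \<noteq> q \<Longrightarrow> (u, q) \<in> E \<and> (u, v) \<in> E"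
        by (rule comatchingE[OF coz sym, of v]) (use v that in auto)
      have "q \<noteq> a" "q \<noteq> p" using p(5)[of v] v q(3) by auto
      then show "\<exists>q\<in>V - ?A. q \<noteq> v \<and> (v, q) \<notin> E \<and> (\<forall>u\<in>V - ?A. u \<noteq> v \<longrightarrow> u \<noteq> q \<longrightarrow> (u, q) \<in> E)"
        using q by (intro bexI[of _ q]) auto
    qed
    moreover have "V \<noteq> ?A"
    proof
      assume "V = ?A"
      moreover obtain u where "u \<in> V" "(a, u) \<in> E" using nbr[OF a(1)] by blast
      ultimately show False using za p(3) irrE symE by blast
    qed
    ultimately show ?thesis
      using z a p za rest
      by (intro disjI2 exI[of _ z] exI[of _ a] exI[of _ p]) auto
  qed
qed

lemma connected_weak_bicriticalI:
  assumes "pair_graph G" "connected (with_proj G)" "weak_k_bicritical k G" "2 \<le> k"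
  shows "connected_weak_bicritical (pverts G) (parcs G) k"
  using weak_bicritical_relI[OF assms(1,3)] connected_iff[OF assms(1)] assms(2,4)
  by (simp add: connected_weak_bicritical_def connected_weak_bicritical_axioms_def)

lemma pverts_co_union:
  "pverts (graph_complement (disjoint_union (copies m (complete_graph 2)) K)) = Inl ` ({..<m} \<times> {..<2}) \<union> Inr ` pverts K"
  by (auto simp: graph_complement_def disjoint_union_def copies_def disjoint_sum_def complete_graph_def)

lemma parcs_co_union:
  fixes m :: nat and K :: "'c sgraph"
  defines "C \<equiv> graph_complement (disjoint_union (copies m (complete_graph 2)) K)"
  assumes "r \<in> {..<m} \<times> {..<2}" "s \<in> {..<m} \<times> {..<2}" "i \<in> pverts K" "j \<in> pverts K"
  shows "(Inl r, Inl s) \<in> parcs C \<longleftrightarrow> fst r \<noteq> fst s"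
    and "(Inl r, Inr i) \<in> parcs C" and "(Inr i, Inl r) \<in> parcs C"
    and "(Inr i, Inr j) \<in> parcs C \<longleftrightarrow> i \<noteq> j \<and> (i, j) \<notin> parcs K"
  using assms(2-5) unfolding C_def
  by (auto simp: graph_complement_def disjoint_union_def copies_def disjoint_sum_def complete_graph_def)

text \<open>Treats \<open>K3\<close> and \<open>P3\<close> at once: \<open>z\<close>,
  \<open>a\<close>, \<open>p\<close> become \<open>0\<close>, \<open>1\<close>, \<open>2\<close>,
  with \<open>a\<close> as the middle vertex in the complement, and only the edge between
  \<open>0\<close> and \<open>2\<close> is left open.\<close>

lemma isomorphic_co_unionI:
  fixes m :: nat
  assumes G: "pair_graph G" and V: "{z, a, p} \<subseteq> pverts G" "z \<noteq> a" "z \<noteq> p" "a \<noteq> p"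
    and h: "bij_betw h (pverts G - {z, a, p}) ({..<m} \<times> {..<2::nat})"
      "\<And>r s. r \<in> pverts G - {z, a, p} \<Longrightarrow> s \<in> pverts G - {z, a, p} \<Longrightarrow> (r, s) \<in> parcs G \<longleftrightarrow> fst (h r) \<noteq> fst (h s)"
    and rest: "\<And>r. r \<in> pverts G - {z, a, p} \<Longrightarrow> (r, z) \<in> parcs G \<and> (r, a) \<in> parcs G \<and> (r, p) \<in> parcs G"
    and K: "pverts K = {..<3::nat}" "(0, 1) \<in> parcs K" "(1, 0) \<in> parcs K" "(1, 2) \<in> parcs K" "(2, 1) \<in> parcs K"
      "(0, 2) \<in> parcs K \<longleftrightarrow> (z, p) \<notin> parcs G" "(2, 0) \<in> parcs K \<longleftrightarrow> (z, p) \<notin> parcs G"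
    and non: "(z, a) \<notin> parcs G" "(a, p) \<notin> parcs G"
  shows "G \<cong>\<^sub>G graph_complement (disjoint_union (copies m (complete_graph 2)) K)" (is "_ \<cong>\<^sub>G ?C")
proof -
  define f where "f = (\<lambda>v. if v = z then Inr 0 else if v = a then Inr 1 else if v = p then Inr (2::nat) else Inl (h v))"
  let ?R = "pverts G - {z, a, p}"
  have f: "f z = Inr 0" "f a = Inr 1" "f p = Inr 2" using V by (auto simp: f_def)
  have fR: "f r = Inl (h r)" if "r \<in> ?R" for r using that by (auto simp: f_def)
  have hR: "h r \<in> {..<m} \<times> {..<2}" if "r \<in> ?R" for r using bij_betwE[OF h(1)] that by blast
  have sym: "(s, r) \<in> parcs G" if "(r, s) \<in> parcs G" for r s using that G by (auto simp: pair_graph_iff dest: symD)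
  have irr: "(r, r) \<notin> parcs G" for r using G by (auto simp: pair_graph_iff irrefl_def)
  have K3: "0 \<in> pverts K" "1 \<in> pverts K" "2 \<in> pverts K" using K(1) by auto
  show ?thesis
  proof (rule isomorphicI)
    have "bij_betw Inl ({..<m} \<times> {..<2::nat}) (Inl ` ({..<m} \<times> {..<2}))" by (rule inj_on_imp_bij_betw) simp
    then have "bij_betw (Inl \<circ> h) ?R (Inl ` ({..<m} \<times> {..<2}))" by (rule bij_betw_trans[OF h(1)])
    then have "bij_betw f ?R (Inl ` ({..<m} \<times> {..<2}))"
      using bij_betw_cong[of ?R f "Inl \<circ> h"] fR by simp
    moreover have "bij_betw f {z, a, p} {Inr 0, Inr 1, Inr 2}" using V f by (auto simp: bij_betw_def inj_on_def)
    ultimately have "bij_betw f (?R \<union> {z, a, p}) (Inl ` ({..<m} \<times> {..<2}) \<union> {Inr 0, Inr 1, Inr 2})"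
      by (rule bij_betw_combine) auto
    moreover have "?R \<union> {z, a, p} = pverts G" using V(1) by blast
    moreover have "{Inr 0, Inr 1, Inr 2} = (Inr ` {..<3} :: (nat \<times> nat + nat) set)" by (auto simp: image_def numeral_eq_Suc less_Suc_eq)
    ultimately show "bij_betw f (pverts G) (pverts ?C)" unfolding pverts_co_union K(1) by (simp only:)
    show "pair_wf_digraph G" using G by (simp add: pair_graph_iff pair_wf_digraph_iff)
    show "pair_wf_digraph ?C" by (rule pair_wf_graph_complement)
    show "(r, s) \<in> parcs G \<longleftrightarrow> (f r, f s) \<in> parcs ?C" if "r \<in> pverts G" "s \<in> pverts G" for r s
    proof -
      have cases: "t \<in> ?R \<or> t = z \<or> t = a \<or> t = p" if "t \<in> pverts G" for t using that by blast
      note arcs = parcs_co_union[where K = K and m = m]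
      have RR: "(r, s) \<in> parcs G \<longleftrightarrow> (f r, f s) \<in> parcs ?C" if "r \<in> ?R" "s \<in> ?R" for r s
        using arcs(1)[OF hR hR K3(1,1)] fR h(2) that by auto
      have RZ: "(r, s) \<in> parcs G \<and> (f r, f s) \<in> parcs ?C \<and> (s, r) \<in> parcs G \<and> (f s, f r) \<in> parcs ?C"
        if r: "r \<in> ?R" and s: "s = z \<or> s = a \<or> s = p" for r s
        using arcs(2,3)[OF hR[OF r] hR[OF r]] K3 fR[OF r] f rest[OF r] sym s by auto
      have ZZ: "(r, s) \<in> parcs G \<longleftrightarrow> (f r, f s) \<in> parcs ?C" if "r = z \<or> r = a \<or> r = p" "s = z \<or> s = a \<or> s = p" for r s
      proof -
        have *: "(Inr i, Inr j) \<in> parcs ?C \<longleftrightarrow> i \<noteq> j \<and> (i, j) \<notin> parcs K" if "i \<in> pverts K" "j \<in> pverts K" for i j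
          using that by (auto simp: graph_complement_def disjoint_union_def)
        have "(a, z) \<notin> parcs G" "(p, a) \<notin> parcs G" "(p, z) \<in> parcs G \<longleftrightarrow> (z, p) \<in> parcs G" using sym non by blast+
        then show ?thesis using that * K3 K f irr non by auto
      qed
      show ?thesis using RR RZ ZZ cases[OF that(1)] cases[OF that(2)] by blast
    qed
  qed
qed

lemma family_F_star_2I:
  assumes G: "pair_graph G" and cn: "connected (with_proj G)" and wk: "weak_k_bicritical 2 G"
  shows "family_F_star 2 G"
proof -
  interpret connected_weak_bicritical "pverts G" "parcs G" 2
    by (rule connected_weak_bicriticalI[OF G cn wk]) simp
  have ne: "pverts G \<noteq> {}" using connected_iff[OF G] cn by blast
  have irr: "irrefl (parcs G)" and wf: "pair_wf_digraph G" using G by (auto simp: pair_graph_iff pair_wf_digraph_iff)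
  consider "comatching (parcs G) (pverts G)"
    | z a p where "z \<noteq> a" "z \<noteq> p" "a \<noteq> p" "{z, a, p} \<subseteq> pverts G" "pverts G \<noteq> {z, a, p}"
      "(z, a) \<notin> parcs G" "(a, p) \<notin> parcs G" "comatching (parcs G) (pverts G - {z, a, p})"
      "\<And>u. u \<in> pverts G - {z, a, p} \<Longrightarrow> (u, z) \<in> parcs G \<and> (u, a) \<in> parcs G \<and> (u, p) \<in> parcs G"
    using k2_structure[OF refl ne] by blast
  then show ?thesis
  proof cases
    case 1
    obtain m :: nat and h where h: "bij_betw h (pverts G) ({..<m} \<times> {..<2::nat})"
      "\<And>a b. a \<in> pverts G \<Longrightarrow> b \<in> pverts G \<Longrightarrow> (a, b) \<in> parcs G \<longleftrightarrow> fst (h a) \<noteq> fst (h b)"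
      by (rule comatching_enumE[OF finV sym irr 1]) (rule that)
    obtain v where v: "v \<in> pverts G" using ne by blast
    obtain p where p: "p \<in> pverts G" "p \<noteq> v" "(v, p) \<notin> parcs G" using comatchingE[OF 1 sym v] by metis
    obtain u where u: "(v, u) \<in> parcs G"
      using converse_rtranclE[OF conn[OF v p(1)]] p(2) by metis
    have "{v, p, u} \<subseteq> pverts G" "card {v, p, u} = 3"
      using v p u EV[OF u] irrE[of v] by (auto simp: card_insert_if)
    \<comment> \<open>Connectedness excludes a single pair, which would be two isolated
      vertices.\<close>
    then have "3 \<le> card (pverts G)" using card_mono[OF finV] by metis
    then have m: "2 \<le> m" by (rule enum_card_ge_2[OF h(1)])
    have "G \<cong>\<^sub>G co_mK2 (m - 1 + 1)"
    proof (rule isomorphicI)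
      show "bij_betw h (pverts G) (pverts (co_mK2 (m - 1 + 1)))" using h(1) m by (simp add: co_mK2_simps)
      show "(a, b) \<in> parcs G \<longleftrightarrow> (h a, h b) \<in> parcs (co_mK2 (m - 1 + 1))"
        if "a \<in> pverts G" "b \<in> pverts G" for a b
        using h(2)[OF that] bij_betwE[OF h(1)] that m by (simp add: co_mK2_simps)
    qed (fact wf, rule pair_wf_co_mK2)
    then show ?thesis using m by (intro family_F_star.co_K2[of "m - 1"]) auto
  next
    case 2
    have fin: "finite (pverts G - {z, a, p})" using finV by simp
    obtain m :: nat and h where h: "bij_betw h (pverts G - {z, a, p}) ({..<m} \<times> {..<2::nat})"
      "\<And>r s. r \<in> pverts G - {z, a, p} \<Longrightarrow> s \<in> pverts G - {z, a, p} \<Longrightarrow> (r, s) \<in> parcs G \<longleftrightarrow> fst (h r) \<noteq> fst (h s)"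
      by (rule comatching_enumE[OF fin sym irr 2(8)]) (rule that)
    obtain r where "r \<in> pverts G - {z, a, p}" using 2(4,5) by blast
    then have m: "1 \<le> m" using bij_betwE[OF h(1)] by (cases m) auto
    note iso = isomorphic_co_unionI[OF G 2(4,1-3) h 2(9) _ _ _ _ _ _ _ 2(6,7)]
    show ?thesis
    proof (cases "(z, p) \<in> parcs G")
      case True
      then show ?thesis using m
        by (intro family_F_star.co_K2_P3[of m] iso) (auto simp: path_graph_def)
    next
      case False
      then show ?thesis using m
        by (intro family_F_star.co_K2_K3[of m] iso) (auto simp: complete_graph_def)
    qed
  qed
qed


section \<open>Extremal graphs belong to the family\<close>

lemma gdist_ge_2:
  assumes "pair_wf_digraph G" "a \<in> pverts G" "b \<noteq> a" "(a, b) \<notin> parcs G"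
  shows "2 \<le> gdist G a b"
proof (rule ccontr)
  assume "\<not> ?thesis"
  then have "gdist G a b \<le> enat 1"
    by (cases "gdist G a b") (auto simp: numeral_eq_enat)
  then obtain n where "n \<le> 1" "(a, b) \<in> parcs G ^^ n" using gdist_le_iff[OF assms(1,2)] by blast
  then show False using assms(3,4) by (cases n) auto
qed

lemma gdist_le_2:
  assumes "pair_wf_digraph G" "a \<in> pverts G"
    and "a = b \<or> (a, b) \<in> parcs G \<or> (\<exists>c. (a, c) \<in> parcs G \<and> (c, b) \<in> parcs G)"
  shows "gdist G a b \<le> 2"
proof -
  have "\<exists>n\<le>2. (a, b) \<in> parcs G ^^ n"
    using assms(3)
  proof (elim disjE exE)
    fix c assume "(a, c) \<in> parcs G \<and> (c, b) \<in> parcs G"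
    then have "(a, b) \<in> parcs G ^^ 2" by (auto simp: numeral_2_eq_2)
    then show ?thesis by blast
  qed (auto intro: exI[of _ 0] exI[of _ 1])
  then have "gdist G a b \<le> enat 2" using gdist_le_iff[OF assms(1,2)] by blast
  then show ?thesis by (simp add: numeral_eq_enat)
qed

lemma diam_eq_2I:
  assumes "pair_wf_digraph G"
    and "\<And>a b. a \<in> pverts G \<Longrightarrow> b \<in> pverts G \<Longrightarrow>
      a = b \<or> (a, b) \<in> parcs G \<or> (\<exists>c. (a, c) \<in> parcs G \<and> (c, b) \<in> parcs G)"
    and "a0 \<in> pverts G" "b0 \<in> pverts G" "b0 \<noteq> a0" "(a0, b0) \<notin> parcs G"
  shows "diam G = 2"
  using gdist_le_2[OF assms(1)] assms(2) gdist_ge_2[OF assms(1,3,5,6)] assms(3,4) by (intro diam_eqI) auto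

lemma comatching_diam:
  assumes G: "pair_graph G" and co: "comatching (parcs G) (pverts G)" and card: "3 \<le> card (pverts G)"
  shows "diam G = 2"
proof -
  have wf: "pair_wf_digraph G" and sym: "sym (parcs G)" using G by (auto simp: pair_graph_iff pair_wf_digraph_iff)
  have two: "a = b \<or> (a, b) \<in> parcs G \<or> (\<exists>c. (a, c) \<in> parcs G \<and> (c, b) \<in> parcs G)"
    if ab: "a \<in> pverts G" "b \<in> pverts G" for a b
  proof (rule ccontr)
    assume *: "\<not> ?thesis"
    obtain p where p: "p \<in> pverts G" "p \<noteq> a" "(a, p) \<notin> parcs G"
      "\<And>u. u \<in> pverts G \<Longrightarrow> u \<noteq> a \<Longrightarrow> u \<noteq> p \<Longrightarrow> (u, p) \<in> parcs G \<and> (u, a) \<in> parcs G"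
      using comatchingE[OF co sym ab(1)] by metis
    have "b = p" using p(4)[of b] ab * sym by (blast dest: symD)
    moreover have "\<not> pverts G \<subseteq> {a, p}"
      using card card_mono[of "{a, p}" "pverts G"] by (auto simp: card_insert_if split: if_splits)
    then obtain c where "c \<in> pverts G" "c \<noteq> a" "c \<noteq> p" by blast
    ultimately show False using p(4)[of c] * sym by (blast dest: symD)
  qed
  have "pverts G \<noteq> {}" using card by auto
  then obtain a where a: "a \<in> pverts G" by blast
  obtain p where "p \<in> pverts G" "p \<noteq> a" "(a, p) \<notin> parcs G" using comatchingE[OF co sym a] by metis
  then show ?thesis by (intro diam_eq_2I[OF wf two a])
qed

lemma comatching_restrict: "X \<subseteq> U \<Longrightarrow> comatching (E \<inter> U \<times> U) X \<longleftrightarrow> comatching E X"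
  unfolding comatching_def by (intro ball_cong bex_cong) auto

text \<open>The split-off block \<open>B\<close> is layer 1 with \<open>x\<close> and
  \<open>w\<close> added as one more nonadjacent pair, and \<open>H\<close> is the upper part; they
  share only \<open>w\<close>. The general bound applied to \<open>H\<close> limits its diameter
  from above.\<close>

lemma ordinary_end_coalesce:
  fixes G :: "'a sgraph"
  assumes G: "pair_graph G" and cn: "connected (with_proj G)" and wk: "weak_k_bicritical k G" and k: "3 \<le> k"
    and xy: "x \<in> pverts G" "y \<in> pverts G" "rdist (parcs G) x y = 2 * k - 2"
    and crit: "\<And>v. v \<in> pverts G \<Longrightarrow> rdist (parcs G) x v \<le> 2 \<Longrightarrow> weak_bicritical_rel.crit (pverts G) (parcs G) k v"
  obtains B H :: "'a sgraph" and w where "pair_graph H" "connected (with_proj H)" "weak_k_bicritical (k - 1) H"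
    "diam H = enat (2 * (k - 1) - 2)" "w \<in> V_minus H" "diametrical H w"
    "family_F 2 B" "diametrical B w" "G \<cong>\<^sub>G coalesce B w H w"
proof -
  interpret C: connected_weak_bicritical "pverts G" "parcs G" k
    by (rule connected_weak_bicriticalI[OF G cn wk]) (use k in simp)
  interpret X: extremal "pverts G" "parcs G" k x
    by unfold_locales (use k xy in auto)
  obtain w T where w: "X.layer 2 = {w}" and co: "comatching (parcs G) (X.layer 1)"
    and joined: "\<And>v. v \<in> X.layer 1 \<Longrightarrow> (v, w) \<in> parcs G"
    and T: "T \<subseteq> pverts G" "\<And>t. t \<in> T \<Longrightarrow> 3 \<le> X.l t" "card T + 1 < k"
      "dominates_set (parcs G) T {v \<in> pverts G. 3 \<le> X.l v}"
    by (rule X.ordinary_end[OF crit]) (assumption, assumption, rule that)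
  define H where "H = induced G X.upper"
  define B where "B = induced G (insert x (insert w (X.layer 1)))"
  have lw: "w \<in> pverts G" "X.l w = 2" "w \<in> X.layer 2" using w X.layerD by blast+
  have upV: "X.upper \<subseteq> pverts G" by (auto simp: X.upper_def)
  have w_up: "w \<in> X.upper" and y_up: "y \<in> X.upper" using lw xy k by (auto simp: X.upper_def)
  have wy: "w \<noteq> y" using lw xy k by (intro X.l_neq) simp
  have up: "u = w \<or> 3 \<le> X.l u" if "u \<in> X.upper" for u
  proof (cases "X.l u = 2")
    case True
    then have "u \<in> X.layer 2" using that upV by (auto simp: X.layer_def)
    then show ?thesis using w by simp
  qed (use that in \<open>auto simp: X.upper_def\<close>)
  have H: "pair_graph H" unfolding H_def by (rule pair_graph_induced[OF G upV])
  have wfH: "pair_wf_digraph H" using H by (simp add: pair_graph_iff pair_wf_digraph_iff)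
  have pH: "pverts H = X.upper" "parcs H = parcs G \<inter> X.upper \<times> X.upper" by (simp_all add: H_def)
  have symH: "sym (parcs H)" using H by (simp add: pair_graph_iff)
  have relH: "weak_bicritical_rel (pverts H) (parcs H) (k - 1)"
    unfolding pH by (rule X.weak_bicritical_upper[OF w co T])
  have reach: "(w, v) \<in> (parcs H)\<^sup>*" if v: "v \<in> pverts H" for v
  proof -
    have "v \<in> X.layer (X.l v - 2 + 2)" using v by (auto simp: pH X.upper_def X.layer_def)
    then have "(w, v) \<in> parcs H ^^ (X.l v - 2)" unfolding pH by (rule X.upper_walk[OF _ w])
    then show ?thesis by (rule relpow_imp_rtrancl)
  qed
  have connH: "(a, b) \<in> (parcs H)\<^sup>*" if "a \<in> pverts H" "b \<in> pverts H" for a b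
    using reach[OF that(1)] reach[OF that(2)] sym_rtrancl[OF symH] by (meson rtrancl_trans symD)
  have cH: "connected (with_proj H)"
    unfolding connected_iff[OF H] using connH w_up by (auto simp: pH)
  have T_up: "T \<subseteq> X.upper" "w \<notin> T" using T(1,2) lw by (force simp: X.upper_def)+
  have domT: "dominates_set (parcs H) T (pverts H - {w})"
    unfolding pH dominates_set_restrict[OF T_up(1) Diff_subset]
    using T(4) up upV by (auto simp: dominates_set_def)
  have wkH: "weak_k_bicritical (k - 1) H"
  proof (rule weak_k_bicriticalI[OF H relH, of "insert w T"])
    show "insert w T \<subseteq> pverts H" using T_up w_up by (simp add: pH)
    show "dominates_set (parcs H) (insert w T) (pverts H)" using domT by (auto simp: dominates_set_def)
    show "card (insert w T) \<le> k - 1" using T(3) card_insert_le_m1[of "k - 1" T w] by linarith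
    show "\<exists>v\<in>pverts H. v \<noteq> z" if "z \<in> pverts H" for z using w_up y_up wy by (metis pH(1))
  qed
  interpret CH: connected_weak_bicritical "pverts H" "parcs H" "k - 1"
    by (rule connected_weak_bicriticalI[OF H cH wkH]) (use k in simp)
  have gd: "gdist H a b = enat (rdist (parcs H) a b)" if "a \<in> pverts H" "b \<in> pverts H" for a b
    by (rule gdist_eq_rdist[OF wfH that(1) connH[OF that]])
  \<comment> \<open>Layers of \<open>G\<close> still change by at most one along edges of
    \<open>H\<close>, so \<open>y\<close> remains \<open>2 * k - 4\<close> steps away from
    \<open>w\<close>. This gives both the diameter of \<open>H\<close> and that \<open>w\<close> is
    diametrical.\<close>
  have far: "2 * (k - 1) - 2 \<le> rdist (parcs H) w y"
  proof -
    have "(w, y) \<in> parcs H ^^ rdist (parcs H) w y" using y_up by (intro relpow_rdist reach) (simp add: pH)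
    then have "X.l y \<le> X.l w + rdist (parcs H) w y" unfolding pH(2) by (rule X.upper_walk_ge)
    then show ?thesis using lw xy(3) by simp
  qed
  have wyH: "w \<in> pverts H" "y \<in> pverts H" using w_up y_up by (simp_all add: pH)
  have diamH: "diam H = enat (2 * (k - 1) - 2)"
  proof (rule diam_eqI[OF _ wyH])
    show "gdist H a b \<le> enat (2 * (k - 1) - 2)" if "a \<in> pverts H" "b \<in> pverts H" for a b
      using CH.rdist_bound[OF that] gd[OF that] by simp
    show "enat (2 * (k - 1) - 2) \<le> gdist H w y" using far gd[OF wyH] by simp
  qed
  have dH: "diametrical H w"
    using far by (intro diametricalI[OF wyH]) (simp add: diamH gd[OF wyH])
  have minus: "w \<in> V_minus H"
    by (rule V_minusI[OF H relH wyH(1) _ T_up(2) _ domT]) (use T_up(1) T(3) in \<open>auto simp: pH\<close>)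
  have xB: "x \<in> pverts G" "x \<notin> X.upper" "X.l x = 0" using xy by (auto simp: X.upper_def)
  have xw: "(x, w) \<notin> parcs G" "x \<noteq> w" using X.layer_1_iff[of w] lw by (auto simp: X.layer_def)
  have sub: "insert x (insert w (X.layer 1)) \<subseteq> pverts G" using xB lw X.layer_in_V by blast
  have B: "pair_graph B" unfolding B_def by (rule pair_graph_induced[OF G sub])
  have wfB: "pair_wf_digraph B" using B by (simp add: pair_graph_iff pair_wf_digraph_iff)
  have coB: "comatching (parcs B) (pverts B)"
  proof -
    have "comatching (parcs G) (insert x (insert w (X.layer 1)))"
    proof (rule comatching_extend[OF co xw(1) _ xw(2)])
      show "(w, x) \<notin> parcs G" using xw C.symE by blast
      show "(v, x) \<in> parcs G \<and> (v, w) \<in> parcs G \<and> (x, v) \<in> parcs G \<and> (w, v) \<in> parcs G"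
        if "v \<in> X.layer 1" for v using that X.layer_1_iff joined C.symE by blast
    qed
    then show ?thesis unfolding B_def pverts_induced parcs_induced comatching_restrict[OF order_refl] .
  qed
  have cardB: "3 \<le> card (pverts B)"
  proof -
    obtain a where a: "a \<in> X.layer 1" using X.layer_ex[of 1] by auto
    have "a \<noteq> x" "a \<noteq> w" using X.layerD[OF a] lw by auto
    then have "card {x, w, a} = 3" using xw by (simp add: card_insert_if)
    moreover have "finite (pverts B)" using B by (simp add: pair_graph_iff)
    ultimately show ?thesis using card_mono[of "pverts B" "{x, w, a}"] a by (simp add: B_def)
  qed
  have xwB: "w \<in> pverts B" "x \<in> pverts B" "(w, x) \<notin> parcs B"
    using xw C.symE by (auto simp: B_def)
  have FB: "family_F 2 B"
    by (rule family_F_2I[OF B coB cardB xwB(1,2)]) (use xw xwB in auto)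
  have dB: "diametrical B w"
    using gdist_ge_2[OF wfB xwB(1) xw(2) xwB(3)] comatching_diam[OF B coB cardB]
    by (intro diametricalI[OF xwB(1,2)]) simp
  have "G \<cong>\<^sub>G coalesce B w H w"
    unfolding B_def H_def
  proof (rule isomorphic_coalesce_induced[OF G])
    have low: "u \<in> insert x (X.layer 1)" if "u \<in> pverts G" "u \<notin> X.upper" for u
      using X.layer_1I[of u] that by (auto simp: X.upper_def)
    show "insert x (insert w (X.layer 1)) \<union> X.upper = pverts G" using low sub upV by blast
    show "insert x (insert w (X.layer 1)) \<inter> X.upper = {w}"
      using xB w_up by (auto simp: X.upper_def X.layer_def)
    fix a b assume ab: "(a, b) \<in> parcs G"
    have abV: "a \<in> pverts G" "b \<in> pverts G" using C.EV[OF ab] by auto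
    have near: "v = w \<or> v \<in> insert x (X.layer 1)" if uv: "(u, v) \<in> parcs G" and u: "u \<notin> X.upper" for u v
    proof (cases "v \<in> X.upper")
      case True
      have "X.l u \<le> 1" using u C.EV[OF uv] by (auto simp: X.upper_def)
      then have "X.l v \<le> 2" using X.lip[OF uv] by simp
      then show ?thesis using up[OF True] by auto
    qed (use low C.EV[OF uv] in blast)
    show "a \<in> insert x (insert w (X.layer 1)) \<and> b \<in> insert x (insert w (X.layer 1)) \<or> a \<in> X.upper \<and> b \<in> X.upper"
      using near[OF ab] near[OF C.symE[OF ab]] low abV by blast
  qed
  then show ?thesis by (rule that[OF H cH wkH diamH minus dH FB dB])
qed

section \<open>A twin pair in the middle layer\<close>

lemma pair_wf_add_twin: "pair_wf_digraph G \<Longrightarrow> pair_wf_digraph (add_twin G u)"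
  unfolding pair_wf_digraph_iff add_twin_def by auto

text \<open>Deleting the twin \<open>w\<close> leaves two complements of perfect matchings that
  share \<open>z\<close>. In the lower one \<open>z\<close> is paired with \<open>x\<close>, in the
  upper one with \<open>y\<close>, which is possible because layer 4 is just
  \<open>{y}\<close>.\<close>

lemma twin_family:
  assumes G: "pair_graph G" and cn: "connected (with_proj G)" and wk: "weak_k_bicritical 3 G"
    and xy: "x \<in> pverts G" "y \<in> pverts G" "rdist (parcs G) x y = 4"
    and z: "z \<in> pverts G" "rdist (parcs G) x z = 2" "\<not> weak_bicritical_rel.crit (pverts G) (parcs G) 3 z"
  shows "family_F_star 3 G"
proof -
  interpret C: connected_weak_bicritical "pverts G" "parcs G" 3
    by (rule connected_weak_bicriticalI[OF G cn wk]) simp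
  interpret X: extremal "pverts G" "parcs G" 3 x
    by unfold_locales (use xy in auto)
  have z2: "z \<in> X.layer 2" using z by (simp add: X.layer_def)
  obtain w where w: "w \<noteq> z" "X.layer 2 = {z, w}" and co: "comatching (parcs G) (X.layer 1)" "comatching (parcs G) (X.layer 3)"
    and joined: "\<And>v. v \<in> X.layer 1 \<union> X.layer 3 \<Longrightarrow> (v, z) \<in> parcs G \<and> (v, w) \<in> parcs G"
    and last: "\<And>u v. 3 = (3 :: nat) \<Longrightarrow> v \<in> X.layer 3 \<Longrightarrow> u \<in> X.layer 4 \<Longrightarrow> (v, u) \<in> parcs G"
    by (rule X.twin_structure[OF z2 z(3)]) (rule that)
  obtain y' where "X.layer 4 = {y'}" by (rule X.twin_last_layer[OF z2 z(3) refl]) (rule that)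
  then have y4: "X.layer 4 = {y}" using xy by (auto simp: X.layer_def)
  have lw: "w \<in> X.layer 2" "w \<in> pverts G" "X.l w = 2" "X.l z = 2" "X.l y = 4" "X.l x = 0"
    using w(2) X.layerD[of w 2] z xy by auto
  note sym = C.symE
  have cases: "v = x \<or> v \<in> X.layer 1 \<or> v = z \<or> v = w \<or> v \<in> X.layer 3 \<or> v = y" if v: "v \<in> pverts G" for v
  proof -
    have "X.l v \<le> 4" using X.layer_le[OF v] by simp
    then consider "X.l v = 0" | "X.l v = 1" | "X.l v = 2" | "X.l v = 3" | "X.l v = 4" by linarith
    then show ?thesis
    proof cases
      case 1 then show ?thesis using X.l_eq_0_iff[OF v] by blast
    next
      case 3 then have "v \<in> X.layer 2" using v by (simp add: X.layer_def)
      then have "v = z \<or> v = w" using w(2) by simp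
      then show ?thesis by blast
    next
      case 5 then have "v \<in> X.layer 4" using v by (simp add: X.layer_def)
      then show ?thesis using y4 by simp
    qed (use v in \<open>auto simp: X.layer_def\<close>)
  qed
  have lev: "X.l v = i \<and> v \<in> pverts G" if "v \<in> X.layer i" for v i using that by (simp add: X.layer_def)
  define B1 where "B1 = insert x (insert z (X.layer 1))"
  define B2 where "B2 = insert z (insert y (X.layer 3))"
  define H where "H = induced G (pverts G - {w})"
  have B12: "B1 \<union> B2 = pverts G - {w}"
  proof
    show "B1 \<union> B2 \<subseteq> pverts G - {w}"
      using xy z lev lw w(1) unfolding B1_def B2_def by fastforce
    show "pverts G - {w} \<subseteq> B1 \<union> B2" using cases unfolding B1_def B2_def by blast
  qed
  have lB1: "X.l v \<le> 2" if "v \<in> B1" for v using that lev lw unfolding B1_def by fastforce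
  have lB2: "2 \<le> X.l v" if "v \<in> B2" for v using that lev lw unfolding B2_def by fastforce
  have eqz: "v = z" if "v \<in> pverts G - {w}" "X.l v = 2" for v
  proof -
    have "v \<in> X.layer 2" using that by (simp add: X.layer_def)
    then show ?thesis using w(2) that by simp
  qed
  have zB: "z \<in> B1" "z \<in> B2" by (auto simp: B1_def B2_def)
  have B1I: "v \<in> B1" if "v \<in> pverts G - {w}" "X.l v \<le> 2" for v
    using that B12 lB2[of v] eqz[of v] zB by force
  have B2I: "v \<in> B2" if "v \<in> pverts G - {w}" "2 \<le> X.l v" for v
    using that B12 lB1[of v] eqz[of v] zB by force
  have H: "pair_graph H" unfolding H_def by (rule pair_graph_induced[OF G]) blast
  have pH: "pverts H = pverts G - {w}" "parcs H = parcs G \<inter> (pverts G - {w}) \<times> (pverts G - {w})" by (simp_all add: H_def)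
  have wfH: "pair_wf_digraph H" using H by (simp add: pair_graph_iff pair_wf_digraph_iff)
  have B_sub: "B1 \<subseteq> pverts G - {w}" "B2 \<subseteq> pverts G - {w}" using B12 by blast+
  have non: "(x, z) \<notin> parcs G" "(z, y) \<notin> parcs G"
    using X.lip[of x z] X.lip[of z y] lw by auto
  have neq: "x \<noteq> z" "y \<noteq> z" "x \<noteq> w" "y \<noteq> w" "x \<noteq> y" using lw by (auto intro!: X.l_neq)
  obtain a where a: "a \<in> X.layer 1" using X.layer_ex[of 1] by auto
  obtain b where b: "b \<in> X.layer 3" using X.layer_ex[of 3] by auto
  have ab: "a \<noteq> x" "a \<noteq> z" "b \<noteq> z" "b \<noteq> y" using lev[OF a] lev[OF b] lw by auto
  have last': "(v, y) \<in> parcs G" if "v \<in> X.layer 3" for v using last[OF refl that, of y] y4 by simp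
  have FH: "family_F 3 H"
  proof (rule family_F_3I[OF H, of B1 B2 z x y])
    show "B1 \<union> B2 = pverts H" using B12 by (simp add: pH)
    show "B1 \<inter> B2 = {z}" using zB lB1 lB2 eqz B_sub by (auto intro: antisym)
    show "u \<in> B1 \<and> v \<in> B1 \<or> u \<in> B2 \<and> v \<in> B2" if "(u, v) \<in> parcs H" for u v
    proof -
      have uv: "(u, v) \<in> parcs G" "u \<in> pverts G - {w}" "v \<in> pverts G - {w}" using that by (auto simp: pH)
      consider "X.l u \<le> 2" "X.l v \<le> 2" | "2 \<le> X.l u" "2 \<le> X.l v"
        using X.lip[OF uv(1)] X.lip'[OF uv(1)] by linarith
      then show ?thesis using B1I B2I uv by cases blast+
    qed
    have "comatching (parcs G) B1"
      unfolding B1_def using non neq joined X.layer_1_iff sym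
      by (intro comatching_extend[OF co(1)]) auto
    then show "comatching (parcs H) B1" unfolding pH using B_sub by (simp add: comatching_restrict)
    have "comatching (parcs G) B2"
      unfolding B2_def using non neq joined last' sym
      by (intro comatching_extend[OF co(2)]) auto
    then show "comatching (parcs H) B2" unfolding pH using B_sub by (simp add: comatching_restrict)
    have fin: "finite B1" "finite B2" using B_sub C.finV finite_subset by (metis finite_Diff)+
    have "card {x, z, a} = 3" "card {z, y, b} = 3" using ab neq by (auto simp: card_insert_if)
    moreover have "{x, z, a} \<subseteq> B1" "{z, y, b} \<subseteq> B2" using a b by (auto simp: B1_def B2_def)
    ultimately show "3 \<le> card B1" "3 \<le> card B2" using card_mono fin by metis+
    show "x \<in> B1" "y \<in> B2" by (auto simp: B1_def B2_def)
  qed (use neq non in \<open>auto simp: pH\<close>)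
  have "cut_vertex H z"
    unfolding cut_vertex_def
  proof (intro conjI bexI)
    show "z \<in> pverts H" "y \<in> pverts H - {z}" "x \<in> pverts H - {z}" using z xy neq w(1) by (auto simp: pH)
    have abG: "(x, a) \<in> parcs G" "(a, z) \<in> parcs G" "(z, b) \<in> parcs G" "(b, y) \<in> parcs G"
      using a b X.layer_1_iff joined last' sym by blast+
    have "a \<noteq> w" "b \<noteq> w" using lev[OF a] lev[OF b] lw by auto
    then have "(x, a) \<in> parcs H" "(a, z) \<in> parcs H" "(z, b) \<in> parcs H" "(b, y) \<in> parcs H"
      using abG C.EV neq w(1) by (auto simp: pH)
    then have "(x, y) \<in> (parcs H)\<^sup>*" by (meson converse_rtrancl_into_rtrancl rtrancl.rtrancl_refl)
    then show "x \<rightarrow>\<^sup>*\<^bsub>with_proj H\<^esub> y" using reachable_iff[OF wfH] xy neq by (simp add: pH)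
    show "\<not> x \<rightarrow>\<^sup>*\<^bsub>with_proj (delete_vertex H z)\<^esub> y"
    proof
      assume "x \<rightarrow>\<^sup>*\<^bsub>with_proj (delete_vertex H z)\<^esub> y"
      then have "(x, y) \<in> (parcs (delete_vertex H z))\<^sup>*" using reachable_rtranclI by fastforce
      \<comment> \<open>Without \<open>z\<close> and \<open>w\<close> layer 2 is empty, so no walk
        from \<open>x\<close> leaves layers 0 and 1.\<close>
      then have "X.l y \<le> 1"
      proof (induction rule: rtrancl_induct)
        case (step u v)
        then have uv: "(u, v) \<in> parcs G" "v \<noteq> z" "v \<noteq> w" "v \<in> pverts G"
          by (auto simp: delete_vertex_def pH)
        have "X.l v \<noteq> 2" using eqz[of v] uv by blast
        then show ?case using X.lip[OF uv(1)] step.IH by simp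
      qed (simp add: lw)
      then show False using lw by simp
    qed
  qed
  \<comment> \<open>\<open>w\<close> becomes the new vertex \<open>None\<close>. Its neighbours are
    those of \<open>z\<close> in \<open>H\<close>, and the possible edge between \<open>w\<close>
    and \<open>z\<close> decides between the two kinds of twins.\<close>
  define f where "f = (\<lambda>v. if v = w then None else Some v)"
  have nb_z: "(z, v) \<in> parcs G \<longleftrightarrow> v \<in> X.layer 1 \<union> X.layer 3 \<or> v = w \<and> (w, z) \<in> parcs G" for v
  proof
    assume zv: "(z, v) \<in> parcs G"
    have "v \<in> pverts G" using C.EV[OF zv] by simp
    then show "v \<in> X.layer 1 \<union> X.layer 3 \<or> v = w \<and> (w, z) \<in> parcs G"
      using cases[of v] zv non C.irrE[of z] sym by blast
  qed (use joined sym in blast)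
  have nb_w: "(w, v) \<in> parcs G \<longleftrightarrow> v \<in> X.layer 1 \<union> X.layer 3 \<or> v = z \<and> (w, z) \<in> parcs G" for v
  proof
    assume wv: "(w, v) \<in> parcs G"
    have "v \<in> pverts G" using C.EV[OF wv] by simp
    moreover have "v \<noteq> x" "v \<noteq> y" using X.lip[OF wv] X.lip'[OF wv] lw by auto
    ultimately show "v \<in> X.layer 1 \<union> X.layer 3 \<or> v = z \<and> (w, z) \<in> parcs G"
      using cases[of v] wv C.irrE[of w] by blast
  qed (use joined sym in blast)
  have wL: "w \<notin> X.layer 1 \<union> X.layer 3" using lw by (auto simp: X.layer_def)
  have zH: "(z, v) \<in> parcs H \<longleftrightarrow> v \<in> X.layer 1 \<union> X.layer 3" for v
    using nb_z[of v] wL z w(1) lev by (auto simp: pH)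
  have wf: "pair_wf_digraph G" using G by (simp add: pair_graph_iff pair_wf_digraph_iff)
  have vT: "pverts (add_twin H z) = f ` pverts G"
    using lw by (auto simp: add_twin_def pH f_def image_def)
  have bij: "bij_betw f (pverts G) (pverts (add_twin H z))"
    unfolding vT by (rule inj_on_imp_bij_betw) (auto simp: inj_on_def f_def split: if_splits)
  have old: "(Some u, Some v) \<in> parcs (add_twin H z) \<longleftrightarrow> (u, v) \<in> parcs H"
    "(None, Some v) \<in> parcs (add_twin H z) \<longleftrightarrow> (z, v) \<in> parcs H"
    "(Some v, None) \<in> parcs (add_twin H z) \<longleftrightarrow> (z, v) \<in> parcs H"
    "(None, None) \<notin> parcs (add_twin H z)" for u v
    by (auto simp: add_twin_def)
  have arcs: "(u, v) \<in> parcs G \<longleftrightarrow> (f u, f v) \<in> parcs (add_twin H z) \<or> (w, z) \<in> parcs G \<and> {u, v} = {w, z}"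
    if uv: "u \<in> pverts G" "v \<in> pverts G" for u v
  proof -
    have *: "(w, v) \<in> parcs G \<longleftrightarrow> (f w, f v) \<in> parcs (add_twin H z) \<or> (w, z) \<in> parcs G \<and> v = z" for v
      using nb_w[of v] old(2)[of v] zH[of v] old(4) wL w(1) by (cases "v = w") (auto simp: f_def)
    have swap: "(f w, f v) \<in> parcs (add_twin H z) \<longleftrightarrow> (f v, f w) \<in> parcs (add_twin H z)" for v
      using old(2,3)[of v] by (cases "v = w") (auto simp: f_def)
    consider "u = w" | "v = w" | "u \<noteq> w" "v \<noteq> w" by blast
    then show ?thesis
    proof cases
      case 1
      then show ?thesis using *[of v] w(1) by (auto simp: doubleton_eq_iff)
    next
      case 2
      then show ?thesis using *[of u] swap[of u] w(1) sym by (auto simp: doubleton_eq_iff)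
    next
      case 3
      then show ?thesis using old(1)[of u v] uv by (auto simp: f_def pH doubleton_eq_iff)
    qed
  qed
  show ?thesis
  proof (cases "(w, z) \<in> parcs G")
    case False
    have "G \<cong>\<^sub>G add_twin H z"
      by (rule isomorphicI[OF bij wf pair_wf_add_twin[OF wfH]]) (use arcs False in blast)
    then show ?thesis by (rule family_F_star.twin[OF FH \<open>cut_vertex H z\<close>])
  next
    case True
    let ?A = "add_edge (add_twin H z) (Some z) None"
    have bijA: "bij_betw f (pverts G) (pverts ?A)" using bij by (simp add: add_edge_def)
    have wfA: "pair_wf_digraph ?A"
      using pair_wf_add_twin[OF wfH, of z] z w(1)
      by (auto simp: pair_wf_digraph_iff add_edge_def add_twin_def pH)
    have fz: "f z = Some z" "f w = None" using w(1) by (auto simp: f_def)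
    have "(u, v) \<in> parcs G \<longleftrightarrow> (f u, f v) \<in> parcs ?A" if "u \<in> pverts G" "v \<in> pverts G" for u v
    proof -
      have "{u, v} = {w, z} \<longleftrightarrow> (f u, f v) \<in> {(Some z, None), (None, Some z)}"
        using w(1) by (auto simp: f_def doubleton_eq_iff)
      then show ?thesis using arcs[OF that] True by (auto simp: add_edge_def)
    qed
    then have "G \<cong>\<^sub>G ?A" by (rule isomorphicI[OF bijA wf wfA])
    then show ?thesis by (rule family_F_star.adjacent_twin[OF FH \<open>cut_vertex H z\<close>])
  qed
qed

section \<open>Induction on the domination number\<close>

lemma diam_attained:
  assumes G: "pair_graph G" and cn: "connected (with_proj G)" and d: "diam G = enat d" and d0: "0 < d"
  obtains x y where "x \<in> pverts G" "y \<in> pverts G" "rdist (parcs G) x y = d"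
proof -
  have wf: "pair_wf_digraph G" using G by (simp add: pair_graph_iff pair_wf_digraph_iff)
  have gd: "gdist G a b = enat (rdist (parcs G) a b)" if "a \<in> pverts G" "b \<in> pverts G" for a b
    using cn that by (intro gdist_eq_rdist[OF wf]) (auto simp: connected_iff[OF G])
  have le: "rdist (parcs G) a b \<le> d" if "a \<in> pverts G" "b \<in> pverts G" for a b
    using gdist_le_diam[of a G b] that gd[OF that] d by simp
  note attained = that
  show ?thesis
  proof (rule ccontr)
    assume no: "\<not> thesis"
    have "gdist G a b \<le> enat (d - 1)" if "a \<in> pverts G" "b \<in> pverts G" for a b
    proof -
      have "rdist (parcs G) a b \<noteq> d" using no that attained[of a b] by blast
      then show ?thesis using le[OF that] gd[OF that] by simp
    qed
    then have "diam G \<le> enat (d - 1)" by (simp add: diam_le_iff)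
    then show False using d d0 by simp
  qed
qed

text \<open>One block at a time is split off from an ordinary end, so \<open>coalesced\<close> is
  always used with \<open>k1 = 2\<close>. The remaining graph is again extremal, for
  \<open>k - 1\<close>, and the gluing vertex is identifiable in it.\<close>

lemma extremal_family:
  assumes "2 \<le> k" "pair_graph G" "connected (with_proj G)" "weak_k_bicritical k G" "diam G = enat (2 * k - 2)"
  shows "family_F_star k G"
  using assms
proof (induction k arbitrary: G rule: less_induct)
  case (less k)
  note G = less.prems(2) and cn = less.prems(3) and wk = less.prems(4)
  show ?case
  proof (cases "k = 2")
    case True
    then show ?thesis using family_F_star_2I[OF G cn] wk by simp
  next
    case False
    then have k: "3 \<le> k" using less.prems(1) by simp
    interpret C: connected_weak_bicritical "pverts G" "parcs G" k
      by (rule connected_weak_bicriticalI[OF G cn wk less.prems(1)])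
    have "0 < 2 * k - 2" using k by simp
    then obtain x y where xy: "x \<in> pverts G" "y \<in> pverts G" "rdist (parcs G) x y = 2 * k - 2"
      by (rule diam_attained[OF G cn less.prems(5)]) (rule that)
    have yx: "rdist (parcs G) y x = 2 * k - 2" using xy(3) rdist_sym[OF C.sym, of x y] by simp
    have end_case: "family_F_star k G"
      if ends: "x \<in> pverts G" "y \<in> pverts G" "rdist (parcs G) x y = 2 * k - 2"
        and crit: "\<And>v. v \<in> pverts G \<Longrightarrow> rdist (parcs G) x v \<le> 2 \<Longrightarrow> C.crit v" for x y
    proof -
      obtain B H :: "'a sgraph" and w where H: "pair_graph H" "connected (with_proj H)" "weak_k_bicritical (k - 1) H"
        "diam H = enat (2 * (k - 1) - 2)" "w \<in> V_minus H" "diametrical H w"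
        "family_F 2 B" "diametrical B w" "G \<cong>\<^sub>G coalesce B w H w"
        by (rule ordinary_end_coalesce[OF G cn wk k ends crit]) (assumption, assumption, rule that)
      have "family_F_star (k - 1) H" using less.IH[of "k - 1" H] H k by simp
      moreover have "identifiable (k - 1) H w" using H by (simp add: identifiable_def)
      ultimately show ?thesis
        using k by (intro family_F_star.coalesced[OF _ _ _ H(7,8) _ _ H(9), of "k - 1"]) auto
    qed
    show ?thesis
    proof (rule C.extremal_ends[OF k xy])
      assume "\<And>v. v \<in> pverts G \<Longrightarrow> rdist (parcs G) x v \<le> 2 \<Longrightarrow> C.crit v"
      then show ?thesis by (rule end_case[OF xy])
    next
      assume "\<And>v. v \<in> pverts G \<Longrightarrow> rdist (parcs G) y v \<le> 2 \<Longrightarrow> C.crit v"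
      then show ?thesis by (rule end_case[OF xy(2,1) yx])
    next
      fix z assume z: "k = 3" "z \<in> pverts G" "rdist (parcs G) x z = 2" "\<not> C.crit z"
      show ?thesis using twin_family[OF G cn _ xy(1,2) _ z(2,3)] wk xy(3) z by simp
    qed
  qed
qed

section \<open>The diameter of the members of the families\<close>

text \<open>The map may contract an edge to a vertex. This admits the map that merges two adjacent
  twins, besides embeddings of the parts.\<close>

lemma gdist_hom_le:
  assumes "pair_wf_digraph G" "pair_wf_digraph H" "a \<in> pverts G" "f a \<in> pverts H"
    and hom: "\<And>u v. (u, v) \<in> parcs G \<Longrightarrow> f u = f v \<or> (f u, f v) \<in> parcs H"
  shows "gdist H (f a) (f b) \<le> gdist G a b"
proof (cases "gdist G a b")
  case (enat n)
  have *: "\<exists>m\<le>n. (f a, f b) \<in> parcs H ^^ m" if "(a, b) \<in> parcs G ^^ n" for n b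
    using that
  proof (induction n arbitrary: b)
    case (Suc n)
    then obtain c where c: "(a, c) \<in> parcs G ^^ n" "(c, b) \<in> parcs G" by auto
    obtain m where m: "m \<le> n" "(f a, f c) \<in> parcs H ^^ m" using Suc.IH[OF c(1)] by blast
    show ?case
    proof (cases "f c = f b")
      case True
      then show ?thesis using m by (intro exI[of _ m]) auto
    next
      case False
      then have "(f a, f b) \<in> parcs H ^^ Suc m" using m(2) hom[OF c(2)] by auto
      then show ?thesis using m(1) by (intro exI[of _ "Suc m"]) simp
    qed
  qed auto
  obtain m where "m \<le> n" "(a, b) \<in> parcs G ^^ m"
    using gdist_le_iff[OF assms(1,3), of b n] enat by auto
  then obtain m' where "m' \<le> n" "(f a, f b) \<in> parcs H ^^ m'" using * order_trans by blast
  then show ?thesis using gdist_le_iff[OF assms(2,4)] enat by auto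
qed simp

lemma gdist_triangle:
  assumes "pair_wf_digraph G" "a \<in> pverts G" "b \<in> pverts G"
    and "gdist G a b \<le> enat m" "gdist G b c \<le> enat n"
  shows "gdist G a c \<le> enat (m + n)"
proof -
  obtain m' n' where "m' \<le> m" "(a, b) \<in> parcs G ^^ m'" "n' \<le> n" "(b, c) \<in> parcs G ^^ n'"
    using gdist_le_iff[OF assms(1,2)] gdist_le_iff[OF assms(1,3)] assms(4,5) by blast
  then have "(a, c) \<in> parcs G ^^ (m' + n')" "m' + n' \<le> m + n" by (auto simp: relpow_add)
  then show ?thesis using gdist_le_iff[OF assms(1,2)] by blast
qed

lemma gdist_sym:
  assumes "pair_graph G" "a \<in> pverts G" "b \<in> pverts G"
  shows "gdist G a b = gdist G b a"
proof -
  have wf: "pair_wf_digraph G" and sym: "sym (parcs G)" using assms(1) by (auto simp: pair_graph_iff pair_wf_digraph_iff)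
  have *: "gdist G a b \<le> enat n \<longleftrightarrow> gdist G b a \<le> enat n" for n
    unfolding gdist_le_iff[OF wf assms(2)] gdist_le_iff[OF wf assms(3)] using relpow_sym[OF sym] by blast
  show ?thesis
  proof (rule antisym)
    show "gdist G a b \<le> gdist G b a"
    proof (cases "gdist G b a")
      case (enat n)
      then show ?thesis using *[of n] by simp
    qed simp
    show "gdist G b a \<le> gdist G a b"
    proof (cases "gdist G a b")
      case (enat n)
      then show ?thesis using *[of n] by simp
    qed simp
  qed
qed

text \<open>Lower bounds for distances without examining walks: it suffices to exhibit a function
  that grows by at most one along each arc.\<close>

lemma gdist_ge_potential:
  assumes "pair_wf_digraph G" "a \<in> pverts G"
    and pot: "\<And>u v. (u, v) \<in> parcs G \<Longrightarrow> l v \<le> l u + (1 :: nat)"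
  shows "enat (l b - l a) \<le> gdist G a b"
proof (cases "gdist G a b")
  case (enat n)
  have *: "l b \<le> l a + n" if "(a, b) \<in> parcs G ^^ n" for n b
    using that
  proof (induction n arbitrary: b)
    case (Suc n)
    then obtain c where "(a, c) \<in> parcs G ^^ n" "(c, b) \<in> parcs G" by auto
    then show ?case using Suc.IH[of c] pot[of c b] by simp
  qed auto
  obtain m where "m \<le> n" "(a, b) \<in> parcs G ^^ m"
    using gdist_le_iff[OF assms(1,2), of b n] enat by auto
  then show ?thesis using *[of b m] enat by simp
qed simp

lemma diam_enatD:
  assumes G: "pair_graph G" and d: "diam G = enat d" and ab: "a \<in> pverts G" "b \<in> pverts G"
  shows "(a, b) \<in> (parcs G)\<^sup>*" "gdist G a b = enat (rdist (parcs G) a b)" "gdist G a b \<le> enat d"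
proof -
  have wf: "pair_wf_digraph G" using G by (simp add: pair_graph_iff pair_wf_digraph_iff)
  show le: "gdist G a b \<le> enat d" using gdist_le_diam[OF ab] d by simp
  then show reach: "(a, b) \<in> (parcs G)\<^sup>*" using gdist_le_iff[OF wf ab(1)] relpow_imp_rtrancl by blast
  show "gdist G a b = enat (rdist (parcs G) a b)" by (rule gdist_eq_rdist[OF wf ab(1) reach])
qed

lemma isomorphic_pair_graph:
  assumes "G \<cong>\<^sub>G H" "pair_graph H"
  shows "pair_graph G"
proof -
  obtain f where f: "bij_betw f (pverts G) (pverts H)" "pair_wf_digraph G"
    "\<And>a b. a \<in> pverts G \<Longrightarrow> b \<in> pverts G \<Longrightarrow> (a, b) \<in> parcs G \<longleftrightarrow> (f a, f b) \<in> parcs H"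
    by (rule isomorphicE[OF assms(1)]) (rule that)
  have sub: "parcs G \<subseteq> pverts G \<times> pverts G" using f(2) by (simp add: pair_wf_digraph_iff)
  have "finite (pverts G)" using bij_betw_finite[OF f(1)] assms(2) by (simp add: pair_graph_iff)
  moreover have "sym (parcs G)"
  proof (rule symI)
    fix a b assume ab: "(a, b) \<in> parcs G"
    then have "a \<in> pverts G" "b \<in> pverts G" using sub by auto
    then show "(b, a) \<in> parcs G" using ab f(3) assms(2) by (auto simp: pair_graph_iff dest: symD)
  qed
  moreover have "irrefl (parcs G)"
    using sub f(3) assms(2) by (auto simp: pair_graph_iff irrefl_def)
  ultimately show ?thesis using sub by (simp add: pair_graph_iff)
qed

lemma isomorphic_diam:
  assumes "G \<cong>\<^sub>G H"
  shows "diam G = diam H"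
proof -
  obtain f where f: "bij_betw f (pverts G) (pverts H)" "pair_wf_digraph G" "pair_wf_digraph H"
    "\<And>a b. a \<in> pverts G \<Longrightarrow> b \<in> pverts G \<Longrightarrow> (a, b) \<in> parcs G \<longleftrightarrow> (f a, f b) \<in> parcs H"
    by (rule isomorphicE[OF assms(1)]) (rule that)
  define g where "g = inv_into (pverts G) f"
  have im: "f ` pverts G = pverts H" and inj: "inj_on f (pverts G)" using f(1) by (auto simp: bij_betw_def)
  have g: "g (f a) = a" if "a \<in> pverts G" for a using inj that by (simp add: g_def)
  have sub: "parcs G \<subseteq> pverts G \<times> pverts G" "parcs H \<subseteq> pverts H \<times> pverts H" using f(2,3) by (simp_all add: pair_wf_digraph_iff)
  have hom1: "(f u, f v) \<in> parcs H" if "(u, v) \<in> parcs G" for u v using f(4) sub that by blast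
  have hom2: "(g u, g v) \<in> parcs G" if uv: "(u, v) \<in> parcs H" for u v
  proof -
    obtain a b where "u = f a" "v = f b" "a \<in> pverts G" "b \<in> pverts G" using uv sub im by blast
    then show ?thesis using g f(4) uv by simp
  qed
  have eq: "gdist H (f a) (f b) = gdist G a b" if ab: "a \<in> pverts G" "b \<in> pverts G" for a b
  proof (rule antisym)
    have fa: "f a \<in> pverts H" using im ab by blast
    show "gdist H (f a) (f b) \<le> gdist G a b" by (rule gdist_hom_le[where f = f, OF f(2,3) ab(1) fa]) (use hom1 in blast)
    have "g (f a) \<in> pverts G" using g ab by simp
    then have "gdist G (g (f a)) (g (f b)) \<le> gdist H (f a) (f b)"
      by (rule gdist_hom_le[where f = g, OF f(3,2) fa]) (use hom2 in blast)
    then show "gdist G a b \<le> gdist H (f a) (f b)" using g ab by simp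
  qed
  show ?thesis
    unfolding diam_def im[symmetric] image_image using eq by (auto intro!: SUP_cong)
qed


subsection \<open>Domination number two\<close>

lemma pair_graph_complement: "pair_graph G \<Longrightarrow> pair_graph (graph_complement G)"
  by (auto simp: pair_graph_iff graph_complement_def sym_def irrefl_def)

lemma pair_graph_disjoint_sum: "(\<And>i. pair_graph (H i)) \<Longrightarrow> pair_graph (disjoint_sum n H)"
  unfolding pair_graph_iff by (auto simp: disjoint_sum_def sym_def irrefl_def; blast)

lemma pair_graph_disjoint_union: "pair_graph G \<Longrightarrow> pair_graph H \<Longrightarrow> pair_graph (disjoint_union G H)"
  unfolding pair_graph_iff by (auto simp: disjoint_union_def sym_def irrefl_def; force)

lemma pair_graph_complete: "pair_graph (complete_graph n)"
  by (auto simp: pair_graph_iff complete_graph_def sym_def irrefl_def)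

lemma pair_graph_path: "pair_graph (path_graph n)"
  by (auto simp: pair_graph_iff path_graph_def sym_def irrefl_def)

lemma pair_graph_copies: "pair_graph H \<Longrightarrow> pair_graph (copies n H)"
  unfolding copies_def by (rule pair_graph_disjoint_sum)

lemma pair_graph_co_mK2: "pair_graph (co_mK2 m)"
  by (intro pair_graph_complement pair_graph_copies pair_graph_complete)

lemma comatching_co_mK2: "comatching (parcs (co_mK2 m)) (pverts (co_mK2 m))"
  unfolding comatching_def
proof
  fix p assume "p \<in> pverts (co_mK2 m)"
  then obtain i j where p: "p = (i, j)" "i < m" "j < 2" by (auto simp: co_mK2_simps)
  have j: "j = 0 \<or> j = 1" using p by auto
  show "\<exists>q\<in>pverts (co_mK2 m). q \<noteq> p \<and> (p, q) \<notin> parcs (co_mK2 m) \<and>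
      (\<forall>r\<in>pverts (co_mK2 m). r \<noteq> p \<longrightarrow> r \<noteq> q \<longrightarrow> (r, q) \<in> parcs (co_mK2 m))"
    using p j by (intro bexI[of _ "(i, 1 - j)"]) (auto simp: co_mK2_simps)
qed

lemma diam_co_mK2: "2 \<le> m \<Longrightarrow> diam (co_mK2 m) = 2"
  by (intro comatching_diam pair_graph_co_mK2 comatching_co_mK2) (simp add: co_mK2_simps)

lemma diam_co_union:
  fixes K :: "nat sgraph"
  assumes m: "1 \<le> m" and K: "pverts K = {..<3}"
  shows "diam (graph_complement (disjoint_union (copies m (complete_graph 2)) K)) = 2" (is "diam ?C = 2")
proof (rule diam_eq_2I)
  show "pair_wf_digraph ?C" by (rule pair_wf_graph_complement)
  have in0: "(0, 0) \<in> {..<m} \<times> {..<2::nat}" "(0, 1) \<in> {..<m} \<times> {..<2::nat}" using m by auto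
  have K0: "0 \<in> pverts K" using K by simp
  note arcs = parcs_co_union[of _ m _ _ K]
  show "Inl (0, 0) \<in> pverts ?C" "Inl (0, 1) \<in> pverts ?C" using in0 unfolding pverts_co_union by blast+
  show "Inl (0, 1) \<noteq> (Inl (0, 0) :: nat \<times> nat + nat)" by simp
  show "(Inl (0, 0), Inl (0, 1)) \<notin> parcs ?C" using arcs(1)[OF in0 K0 K0] by simp
  fix a b assume ab: "a \<in> pverts ?C" "b \<in> pverts ?C"
  have mid: "(Inl r, Inr i) \<in> parcs ?C" "(Inr i, Inl r) \<in> parcs ?C" if "r \<in> {..<m} \<times> {..<2}" "i \<in> pverts K" for r i
    using arcs(2,3)[OF that(1) that(1) that(2) that(2)] by auto
  from ab consider (ll) r s where "a = Inl r" "b = Inl s" "r \<in> {..<m} \<times> {..<2}" "s \<in> {..<m} \<times> {..<2}"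
    | (lr) r i where "a = Inl r" "b = Inr i" "r \<in> {..<m} \<times> {..<2}" "i \<in> pverts K"
    | (rl) r i where "b = Inl r" "a = Inr i" "r \<in> {..<m} \<times> {..<2}" "i \<in> pverts K"
    | (rr) i j where "a = Inr i" "b = Inr j" "i \<in> pverts K" "j \<in> pverts K"
    unfolding pverts_co_union by blast
  then show "a = b \<or> (a, b) \<in> parcs ?C \<or> (\<exists>c. (a, c) \<in> parcs ?C \<and> (c, b) \<in> parcs ?C)"
  proof cases
    case ll
    then show ?thesis using mid[OF _ K0] by blast
  next
    case rr
    then show ?thesis using mid[OF in0(1)] by blast
  qed (use mid in blast)+
qed

text \<open>A critical \<open>y\<close> adjacent to all other vertices would give domination number
  at most one, hence zero after its deletion, so \<open>y\<close> would be the only vertex. Needed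
  because identifiable vertices for \<open>k = 2\<close> are only required to be critical.\<close>

lemma V_minus_diametrical:
  assumes G: "pair_graph G" and d: "diam G = 2" and y: "y \<in> V_minus G"
  shows "diametrical G y"
proof -
  have wf: "pair_wf_digraph G" and fin: "finite (pverts G)" using G by (auto simp: pair_graph_iff pair_wf_digraph_iff)
  have yV: "y \<in> pverts G" and less: "\<gamma> (delete_vertex G y) < \<gamma> G" using y by (auto simp: V_minus_def)
  have "\<exists>u\<in>pverts G. u \<noteq> y \<and> (y, u) \<notin> parcs G"
  proof (rule ccontr)
    assume no: "\<not> ?thesis"
    then have "dominates_set (parcs G) {y} (pverts G)"
      using G by (auto simp: dominates_set_def pair_graph_iff dest: symD)
    then have "\<gamma> (induced G (pverts G)) \<le> 1" using yV fin by (intro domination_number_induced_leI[of _ "{y}"]) auto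
    then have "\<gamma> (induced G (pverts G - {y})) \<le> 0"
      using less unfolding induced_self[OF wf] delete_vertex_conv[OF wf] by simp
    then obtain S where S: "S \<subseteq> pverts G - {y}" "dominates_set (parcs G) S (pverts G - {y})" "card S \<le> 0"
      using domination_number_induced_le_iff[of "pverts G - {y}" G 0] fin by auto
    then have "S = {}" using fin finite_subset[of S "pverts G - {y}"] by auto
    then have only: "v = y" if "v \<in> pverts G" for v using S(2) that by (auto elim: dominates_setE)
    have "gdist G y y \<le> enat 0" using gdist_le_iff[OF wf yV, of y 0] by auto
    then have "gdist G a b \<le> enat 0" if "a \<in> pverts G" "b \<in> pverts G" for a b
      using only[OF that(1)] only[OF that(2)] by simp
    then have "diam G \<le> enat 0" unfolding diam_le_iff by blast
    then show False using d by (simp add: numeral_eq_enat)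
  qed
  then obtain u where "u \<in> pverts G" "u \<noteq> y" "(y, u) \<notin> parcs G" by blast
  then show ?thesis using gdist_ge_2[OF wf yV] d yV by (intro diametricalI[of y G u]) auto
qed

subsection \<open>Coalescence, chains and twins\<close>

text \<open>Walks through the glued vertex give the upper bound. The lower bound needs both glued
  vertices to be diametrical: far vertices \<open>a\<close> and \<open>b\<close> then exist on the
  two sides.\<close>

lemma coalesce_diam:
  fixes H1 H2 :: "'a sgraph"
  assumes G: "pair_graph H1" "pair_graph H2" and d: "diam H1 = enat d1" "diam H2 = enat d2"
    and xy: "diametrical H1 x" "diametrical H2 y"
  shows "pair_graph (coalesce H1 x H2 y) \<and> diam (coalesce H1 x H2 y) = enat (d1 + d2)"
proof -
  let ?C = "coalesce H1 x H2 y"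
  define i1 where "i1 = (\<lambda>v. if v = x then Inr y else Inl v :: 'a + 'a)"
  have xV: "x \<in> pverts H1" and yV: "y \<in> pverts H2" using xy by (auto simp: diametrical_def)
  have wf: "pair_wf_digraph H1" "pair_wf_digraph H2" using G by (auto simp: pair_graph_iff pair_wf_digraph_iff)
  have sub: "parcs H1 \<subseteq> pverts H1 \<times> pverts H1" "parcs H2 \<subseteq> pverts H2 \<times> pverts H2"
    using G by (auto simp: pair_graph_iff)
  define \<phi> where "\<phi> = (id(Inl x := Inr y) :: 'a + 'a \<Rightarrow> 'a + 'a)"
  have phi: "\<phi> (Inl v) = i1 v" "\<phi> (Inr v) = Inr v" for v by (auto simp: \<phi>_def i1_def)
  have vC: "pverts ?C = i1 ` pverts H1 \<union> Inr ` pverts H2"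
    unfolding coalesce_def identify_along_def disjoint_union_def \<phi>_def[symmetric]
    by (simp add: image_Un image_image phi)
  have aC: "parcs ?C = map_prod i1 i1 ` parcs H1 \<union> map_prod Inr Inr ` parcs H2"
    unfolding coalesce_def identify_along_def disjoint_union_def \<phi>_def[symmetric]
    by (simp add: image_Un image_image phi map_prod_def case_prod_beta)
  have "inj i1" by (rule injI) (auto simp: i1_def split: if_splits)
  then have pgC: "pair_graph ?C"
    using G unfolding pair_graph_iff vC aC
    by (auto simp: sym_def irrefl_def inj_eq)
  have wfC: "pair_wf_digraph ?C" using pgC by (simp add: pair_graph_iff pair_wf_digraph_iff)
  have e1: "gdist ?C (i1 a) (i1 b) \<le> gdist H1 a b" if "a \<in> pverts H1" for a b
    by (rule gdist_hom_le[where f = i1, OF wf(1) wfC that]) (use that in \<open>force simp: vC aC\<close>)+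
  have e2: "gdist ?C (Inr a) (Inr b) \<le> gdist H2 a b" if "a \<in> pverts H2" for a b
    by (rule gdist_hom_le[where f = Inr, OF wf(2) wfC that]) (use that in \<open>force simp: vC aC\<close>)+
  have i1x: "i1 x = Inr y" by (simp add: i1_def)
  have cross: "gdist ?C (i1 a) (Inr b) \<le> enat (d1 + d2)" if ab: "a \<in> pverts H1" "b \<in> pverts H2" for a b
  proof (rule gdist_triangle[OF wfC])
    show "i1 a \<in> pverts ?C" "Inr y \<in> pverts ?C" using ab yV by (auto simp: vC)
    show "gdist ?C (i1 a) (Inr y) \<le> enat d1"
      using e1[OF ab(1), of x] diam_enatD(3)[OF G(1) d(1) ab(1) xV] i1x by simp
    show "gdist ?C (Inr y) (Inr b) \<le> enat d2"
      using e2[OF yV, of b] diam_enatD(3)[OF G(2) d(2) yV ab(2)] by simp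
  qed
  have upper: "gdist ?C p q \<le> enat (d1 + d2)" if pq: "p \<in> pverts ?C" "q \<in> pverts ?C" for p q
  proof -
    from pq consider (11) a b where "p = i1 a" "q = i1 b" "a \<in> pverts H1" "b \<in> pverts H1"
      | (12) a b where "p = i1 a" "q = Inr b" "a \<in> pverts H1" "b \<in> pverts H2"
      | (21) a b where "q = i1 a" "p = Inr b" "a \<in> pverts H1" "b \<in> pverts H2"
      | (22) a b where "p = Inr a" "q = Inr b" "a \<in> pverts H2" "b \<in> pverts H2"
      unfolding vC by blast
    then show ?thesis
    proof cases
      case 11
      have "gdist ?C p q \<le> enat d1" using e1[OF 11(3), of b] diam_enatD(3)[OF G(1) d(1) 11(3,4)] 11 by simp
      also have "\<dots> \<le> enat (d1 + d2)" by simp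
      finally show ?thesis .
    next
      case 22
      have "gdist ?C p q \<le> enat d2" using e2[OF 22(3), of b] diam_enatD(3)[OF G(2) d(2) 22(3,4)] 22 by simp
      also have "\<dots> \<le> enat (d1 + d2)" by simp
      finally show ?thesis .
    next
      case 12
      then show ?thesis using cross by simp
    next
      case 21
      then show ?thesis using cross gdist_sym[OF pgC pq] by simp
    qed
  qed
  obtain a where a: "a \<in> pverts H1" "gdist H1 x a = diam H1"
    using diametricalE[OF xy(1)] G(1) by (auto simp: pair_graph_iff)
  obtain b where b: "b \<in> pverts H2" "gdist H2 y b = diam H2"
    using diametricalE[OF xy(2)] G(2) by (auto simp: pair_graph_iff)
  define r1 where "r1 = (\<lambda>p :: 'a + 'a. case p of Inl v \<Rightarrow> v | Inr _ \<Rightarrow> x)"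
  define r2 where "r2 = (\<lambda>p :: 'a + 'a. case p of Inl _ \<Rightarrow> y | Inr v \<Rightarrow> v)"
  have r: "r1 (i1 v) = v" "r2 (i1 v) = y" "r1 (Inr v) = x" "r2 (Inr v) = v" for v
    by (auto simp: r1_def r2_def i1_def)
  \<comment> \<open>The retractions \<open>r1\<close> and \<open>r2\<close> collapse the other part
    to the glued vertex. Every arc lies in one part and so changes only one summand; the sum grows
    from 0 at \<open>a\<close> to \<open>d1 + d2\<close> at \<open>b\<close>.\<close>
  define pot where "pot = (\<lambda>p. rdist (parcs H1) a (r1 p) + rdist (parcs H2) y (r2 p))"
  have lip: "pot q \<le> pot p + 1" if pq: "(p, q) \<in> parcs ?C" for p q
  proof -
    from pq consider u v where "p = i1 u" "q = i1 v" "(u, v) \<in> parcs H1"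
      | u v where "p = Inr u" "q = Inr v" "(u, v) \<in> parcs H2"
      unfolding aC by auto
    then show ?thesis
    proof cases
      case 1
      then have "u \<in> pverts H1" using sub by blast
      then show ?thesis using 1 rdist_step[OF diam_enatD(1)[OF G(1) d(1) a(1)] 1(3)] by (simp add: pot_def r)
    next
      case 2
      then have "u \<in> pverts H2" using sub by blast
      then show ?thesis using 2 rdist_step[OF diam_enatD(1)[OF G(2) d(2) yV] 2(3)] by (simp add: pot_def r)
    qed
  qed
  have ab: "i1 a \<in> pverts ?C" "Inr b \<in> pverts ?C" using a b by (auto simp: vC)
  have "pot (i1 a) = 0" by (simp add: pot_def r)
  moreover have "rdist (parcs H1) a x = d1"
    using a diam_enatD(2)[OF G(1) d(1) a(1) xV] gdist_sym[OF G(1) a(1) xV] d(1) by simp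
  moreover have "rdist (parcs H2) y b = d2"
    using b diam_enatD(2)[OF G(2) d(2) yV b(1)] d(2) by simp
  ultimately have "enat (d1 + d2) \<le> gdist ?C (i1 a) (Inr b)"
    using gdist_ge_potential[where l = pot and b = "Inr b", OF wfC ab(1) lip] by (simp add: pot_def r)
  then show ?thesis using diam_eqI[OF upper ab] pgC by simp
qed

lemma chain_diam:
  assumes ms: "ms \<noteq> []" "\<And>i. i < length ms \<Longrightarrow> 2 \<le> ms ! i"
    and uv: "\<And>i. i < length ms \<Longrightarrow> u i \<in> pverts (co_mK2 (ms ! i)) \<and> v i \<in> pverts (co_mK2 (ms ! i)) \<and>
        u i \<noteq> v i \<and> (u i, v i) \<notin> parcs (co_mK2 (ms ! i))"
  shows "pair_graph (chain ms u v) \<and> diam (chain ms u v) = enat (2 * length ms)"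
proof -
  let ?C = "chain ms u v" and ?n = "length ms"
  define \<phi> where "\<phi> = (\<lambda>(i, p). if Suc i < ?n \<and> p = v i then (Suc i, u (Suc i)) else (i, p))"
  let ?B = "\<lambda>i. co_mK2 (ms ! i)"
  have vC: "pverts ?C = \<phi> ` (SIGMA i:{..<?n}. pverts (?B i))"
    and aC: "parcs ?C = map_prod \<phi> \<phi> ` {((i, a), (i, b)) | i a b. i < ?n \<and> (a, b) \<in> parcs (?B i)}"
    by (simp_all add: chain_def identify_along_def disjoint_sum_def \<phi>_def)
  have B: "pair_graph (?B i)" for i by (rule pair_graph_co_mK2)
  have wfB: "pair_wf_digraph (?B i)" for i by (rule pair_wf_co_mK2)
  have symB: "(b, a) \<in> parcs (?B i)" if "(a, b) \<in> parcs (?B i)" for i a b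
    using that by (auto simp: co_mK2_simps)
  have wfC: "pair_wf_digraph ?C" by (rule pair_wf_chain)
  have arcI: "(\<phi> (i, a), \<phi> (i, b)) \<in> parcs ?C" if "i < ?n" "(a, b) \<in> parcs (?B i)" for i a b
    unfolding aC using that by (cases a; cases b) (auto intro!: image_eqI[of _ _ "((i, a), (i, b))"])
  have arcE: "\<exists>i a b. i < ?n \<and> (a, b) \<in> parcs (?B i) \<and> p = \<phi> (i, a) \<and> q = \<phi> (i, b)"
    if pq: "(p, q) \<in> parcs ?C" for p q
  proof -
    from pq[unfolded aC] obtain e where e: "(p, q) = map_prod \<phi> \<phi> e"
      "e \<in> {((i, a), (i, b)) | i a b. i < ?n \<and> (a, b) \<in> parcs (?B i)}"
      by (rule imageE)
    from e(2) obtain i a b where "e = ((i, a), (i, b))" "i < ?n" "(a, b) \<in> parcs (?B i)"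
      unfolding mem_Collect_eq by (elim exE conjE) (rule that)
    with e(1)
    show ?thesis by (intro exI[of _ i] exI[of _ a] exI[of _ b]) simp
  qed
  have inV: "\<phi> (i, a) \<in> pverts ?C" if "i < ?n" "a \<in> pverts (?B i)" for i a
    unfolding vC using that by force
  \<comment> \<open>The value is \<open>2 * i\<close> at \<open>u i\<close>,
    \<open>2 * i + 2\<close> at \<open>v i\<close> and the number between them elsewhere in block
    \<open>i\<close>. It agrees on identified vertices and changes by at most one along arcs,
    because \<open>u i\<close> and \<open>v i\<close> are not adjacent.\<close>
  define l where "l = (\<lambda>(i, p). 2 * i + (if p = u i then 0 else if p = v i then 2 else (1::nat)))"
  have l: "l (\<phi> (i, p)) = l (i, p)" if "i < ?n" for i p
    using uv[OF that] by (auto simp: l_def \<phi>_def)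
  have lip: "l q \<le> l p + 1" if pq: "(p, q) \<in> parcs ?C" for p q
  proof -
    obtain i a b where i: "i < ?n" "(a, b) \<in> parcs (?B i)" "p = \<phi> (i, a)" "q = \<phi> (i, b)"
      using arcE[OF pq] by blast
    have "\<not> (a = u i \<and> b = v i)" using uv[OF i(1)] i(2) by blast
    then show ?thesis unfolding i(3,4) l[OF i(1)] by (auto simp: l_def)
  qed
  have pgC: "pair_graph ?C"
    unfolding pair_graph_iff
  proof (intro conjI symI)
    show "finite (pverts ?C)" unfolding vC by (intro finite_imageI finite_SigmaI) (simp_all add: co_mK2_simps)
    show "parcs ?C \<subseteq> pverts ?C \<times> pverts ?C" using wfC by (simp add: pair_wf_digraph_iff)
    show "(q, p) \<in> parcs ?C" if "(p, q) \<in> parcs ?C" for p q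
      using arcE[OF that] arcI symB by blast
    show "irrefl (parcs ?C)"
    proof (rule irreflI)
      fix p show "(p, p) \<notin> parcs ?C"
      proof
        assume "(p, p) \<in> parcs ?C"
        then obtain i a b where i: "(a, b) \<in> parcs (?B i)" "\<phi> (i, a) = \<phi> (i, b)" using arcE by metis
        have "a = b" using i(2) by (auto simp: \<phi>_def split: if_splits)
        then show False using i(1) by (auto simp: co_mK2_simps)
      qed
    qed
  qed
  have block: "gdist ?C (\<phi> (i, a)) (\<phi> (i, b)) \<le> enat 2" if i: "i < ?n" "a \<in> pverts (?B i)" "b \<in> pverts (?B i)" for i a b
  proof -
    have "gdist ?C (\<phi> (i, a)) (\<phi> (i, b)) \<le> gdist (?B i) a b"
      by (rule gdist_hom_le[where f = "\<lambda>a. \<phi> (i, a)", OF wfB wfC i(2) inV[OF i(1,2)]]) (use arcI i in blast)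
    also have "\<dots> \<le> diam (?B i)" by (rule gdist_le_diam[OF i(2,3)])
    also have "\<dots> = enat 2" using diam_co_mK2[OF ms(2)[OF i(1)]] by (simp add: numeral_eq_enat)
    finally show ?thesis .
  qed
  have join: "\<phi> (i, v i) = \<phi> (Suc i, u (Suc i))" if "Suc i < ?n" for i
    using uv[OF that] that by (auto simp: \<phi>_def)
  have long: "gdist ?C (\<phi> (i, a)) (\<phi> (i + d, b)) \<le> enat (2 * (d + 1))"
    if "i + d < ?n" "a \<in> pverts (?B i)" "b \<in> pverts (?B (i + d))" for i d a b
    using that
  proof (induction d arbitrary: i a)
    case 0
    then show ?case using block by simp
  next
    case (Suc d)
    have i: "i < ?n" "Suc i < ?n" using Suc.prems by auto
    have "gdist ?C (\<phi> (i, a)) (\<phi> (i + Suc d, b)) \<le> enat (2 + 2 * (d + 1))"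
    proof (rule gdist_triangle[OF wfC])
      show "\<phi> (i, a) \<in> pverts ?C" "\<phi> (i, v i) \<in> pverts ?C" using Suc.prems i uv inV by blast+
      show "gdist ?C (\<phi> (i, a)) (\<phi> (i, v i)) \<le> enat 2" using block[OF i(1)] Suc.prems(2) uv[OF i(1)] by blast
      have "gdist ?C (\<phi> (Suc i, u (Suc i))) (\<phi> (Suc i + d, b)) \<le> enat (2 * (d + 1))"
        by (rule Suc.IH) (use Suc.prems uv[OF i(2)] in simp_all)
      then show "gdist ?C (\<phi> (i, v i)) (\<phi> (i + Suc d, b)) \<le> enat (2 * (d + 1))"
        using join[OF i(2)] by simp
    qed
    then show ?case by simp
  qed
  have upper_le: "gdist ?C (\<phi> (i, a)) (\<phi> (j, b)) \<le> enat (2 * ?n)"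
    if "i \<le> j" "i < ?n" "j < ?n" "a \<in> pverts (?B i)" "b \<in> pverts (?B j)" for i j a b
  proof -
    have "gdist ?C (\<phi> (i, a)) (\<phi> (i + (j - i), b)) \<le> enat (2 * (j - i + 1))"
      using that by (intro long) auto
    also have "\<dots> \<le> enat (2 * ?n)" using that by simp
    finally show ?thesis using that(1) by simp
  qed
  have upper: "gdist ?C p q \<le> enat (2 * ?n)" if pq: "p \<in> pverts ?C" "q \<in> pverts ?C" for p q
  proof -
    obtain i a j b where ij: "p = \<phi> (i, a)" "q = \<phi> (j, b)" "i < ?n" "j < ?n" "a \<in> pverts (?B i)" "b \<in> pverts (?B j)"
      using pq unfolding vC by auto
    show ?thesis
    proof (cases "i \<le> j")
      case True
      then show ?thesis using upper_le ij by simp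
    next
      case False
      then show ?thesis using upper_le[of j i b a] ij gdist_sym[OF pgC pq] by simp
    qed
  qed
  have n: "0 < ?n" "?n - 1 < ?n" using ms(1) by auto
  have ends: "\<phi> (0, u 0) \<in> pverts ?C" "\<phi> (?n - 1, v (?n - 1)) \<in> pverts ?C" using inV n uv by blast+
  have "enat (l (\<phi> (?n - 1, v (?n - 1))) - l (\<phi> (0, u 0))) \<le> gdist ?C (\<phi> (0, u 0)) (\<phi> (?n - 1, v (?n - 1)))"
    by (rule gdist_ge_potential[where l = l, OF wfC ends(1) lip])
  moreover have "l (\<phi> (?n - 1, v (?n - 1))) - l (\<phi> (0, u 0)) = 2 * ?n"
    unfolding l[OF n(1)] l[OF n(2)] using uv[OF n(2)] n by (cases "length ms") (auto simp: l_def)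
  ultimately show ?thesis using diam_eqI[OF upper ends] pgC by simp
qed

lemma family_F_diam:
  assumes "family_F k G"
  shows "pair_graph G \<and> diam G = enat (2 * k - 2)"
proof -
  obtain ms u v where k: "2 \<le> k" "length ms = k - 1" and m: "\<forall>m\<in>set ms. m \<ge> 2"
    and uv: "\<forall>i<length ms. u i \<in> pverts (co_mK2 (ms ! i)) \<and> v i \<in> pverts (co_mK2 (ms ! i)) \<and>
        u i \<noteq> v i \<and> (u i, v i) \<notin> parcs (co_mK2 (ms ! i))"
    and iso: "G \<cong>\<^sub>G chain ms u v"
    using assms unfolding family_F_def by blast
  have "ms \<noteq> []" using k by auto
  then have "pair_graph (chain ms u v) \<and> diam (chain ms u v) = enat (2 * length ms)"
    using m uv by (intro chain_diam) auto
  then show ?thesis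
    using isomorphic_pair_graph[OF iso] isomorphic_diam[OF iso] k by (simp add: diff_mult_distrib2)
qed

text \<open>\<open>F\<close> is the set of edges between the two twins.\<close>

lemma twin_diam:
  fixes H :: "'a sgraph"
  assumes H: "pair_graph H" and d: "diam H = enat d" "2 \<le> d" and u: "u \<in> pverts H"
    and T: "pverts T = pverts (add_twin H u)" "parcs T = parcs (add_twin H u) \<union> F"
    and F: "F = {} \<or> F = {(Some u, None), (None, Some u)}"
  shows "pair_graph T \<and> diam T = enat d"
proof -
  have wfH: "pair_wf_digraph H" and sub: "parcs H \<subseteq> pverts H \<times> pverts H"
    using H by (auto simp: pair_graph_iff pair_wf_digraph_iff)
  have symH: "(b, a) \<in> parcs H" if "(a, b) \<in> parcs H" for a b
    using that H by (auto simp: pair_graph_iff dest: symD)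
  have vT: "pverts T = insert None (Some ` pverts H)" using T(1) by (simp add: add_twin_def)
  have aT: "parcs T = map_prod Some Some ` parcs H \<union> {(None, Some w) | w. (u, w) \<in> parcs H} \<union>
      {(Some w, None) | w. (u, w) \<in> parcs H} \<union> F"
    using T(2) by (simp add: add_twin_def)
  have pgT: "pair_graph T"
    unfolding pair_graph_iff
  proof (intro conjI)
    show "finite (pverts T)" using H by (simp add: vT pair_graph_iff)
    show "parcs T \<subseteq> pverts T \<times> pverts T" using sub u F by (auto simp: vT aT)
    show "sym (parcs T)" using F symH by (auto simp: aT sym_def)
    show "irrefl (parcs T)" using F H by (auto simp: aT irrefl_def pair_graph_iff)
  qed
  have wfT: "pair_wf_digraph T" using pgT by (simp add: pair_graph_iff pair_wf_digraph_iff)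
  have up: "gdist T (Some a) (Some b) \<le> gdist H a b" if "a \<in> pverts H" for a b
    by (rule gdist_hom_le[where f = Some, OF wfH wfT that]) (use that in \<open>force simp: vT aT\<close>)+
  have nb: "\<exists>c. (u, c) \<in> parcs H"
  proof -
    have "\<exists>b\<in>pverts H. b \<noteq> u"
    proof (rule ccontr)
      assume no: "\<not> ?thesis"
      have "gdist H u u \<le> enat 0" using gdist_le_iff[OF wfH u, of u 0] by auto
      then have "gdist H a b \<le> enat 0" if "a \<in> pverts H" "b \<in> pverts H" for a b
        using no that by metis
      then have "diam H \<le> enat 0" unfolding diam_le_iff by blast
      then show False using d by simp
    qed
    then obtain b where b: "b \<in> pverts H" "b \<noteq> u" by blast
    show ?thesis using diam_enatD(1)[OF H d(1) u b(1)] b(2) by (metis converse_rtranclE)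
  qed
  \<comment> \<open>A walk from \<open>u\<close> to another vertex can start at \<open>None\<close>
    instead, since the first step is shared. Reaching \<open>u\<close> itself takes a detour through
    a common neighbour, of length 2, which \<open>d\<close> allows.\<close>
  have new: "gdist T None (Some b) \<le> enat d" if b: "b \<in> pverts H" for b
  proof (cases "b = u")
    case True
    obtain c where "(u, c) \<in> parcs H" using nb by blast
    then have "(None, Some c) \<in> parcs T" "(Some c, Some u) \<in> parcs T" using symH by (force simp: aT)+
    then have "gdist T None (Some b) \<le> 2" using True by (intro gdist_le_2[OF wfT]) (auto simp: vT)
    also have "(2 :: enat) \<le> enat d" using d(2) by (simp add: numeral_eq_enat)
    finally show ?thesis .
  next
    case False
    have "gdist H u b \<le> enat d" by (rule diam_enatD(3)[OF H d(1) u b])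
    then obtain m where m: "m \<le> d" "(u, b) \<in> parcs H ^^ m" using gdist_le_iff[OF wfH u] by blast
    then obtain m' where m': "m = Suc m'" using False by (cases m) auto
    then obtain c where c: "(u, c) \<in> parcs H" "(c, b) \<in> parcs H ^^ m'" using m(2) by (metis relpow_Suc_E2)
    have cV: "c \<in> pverts H" using c(1) sub by auto
    have "gdist H c b \<le> enat m'" using gdist_le_iff[OF wfH cV] c(2) by blast
    then have 1: "gdist T (Some c) (Some b) \<le> enat m'" using up[OF cV, of b] by (rule order_trans[rotated])
    have "(None, Some c) \<in> parcs T ^^ 1" using c(1) by (simp add: aT)
    then have 2: "gdist T None (Some c) \<le> enat 1" using gdist_le_iff[OF wfT, of None] by (auto simp: vT)
    have "gdist T None (Some b) \<le> enat (1 + m')"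
      by (rule gdist_triangle[OF wfT _ _ 2 1]) (use cV in \<open>auto simp: vT\<close>)
    also have "\<dots> \<le> enat d" using m m' by simp
    finally show ?thesis .
  qed
  have upper: "gdist T p q \<le> enat d" if pq: "p \<in> pverts T" "q \<in> pverts T" for p q
  proof -
    have "gdist T None None \<le> enat 0" using gdist_le_iff[OF wfT, of None None 0] by (auto simp: vT)
    then have nn: "gdist T None None \<le> enat d" using order_trans by fastforce
    have ss: "gdist T (Some a) (Some b) \<le> enat d" if "a \<in> pverts H" "b \<in> pverts H" for a b
      using up[OF that(1), of b] diam_enatD(3)[OF H d(1) that] by (rule order_trans)
    have sn: "gdist T (Some a) None \<le> enat d" if "a \<in> pverts H" for a
      using new[OF that] gdist_sym[OF pgT, of "Some a" None] that by (simp add: vT)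
    show ?thesis using pq nn ss sn new unfolding vT by blast
  qed
  \<comment> \<open>Merging the twins does not lengthen walks, so distances between old vertices
    cannot shrink in \<open>T\<close>.\<close>
  define r where "r = (\<lambda>p. case p of None \<Rightarrow> u | Some v \<Rightarrow> v)"
  have down: "gdist H a b \<le> gdist T (Some a) (Some b)" if a: "a \<in> pverts H" for a b
  proof -
    have "gdist H (r (Some a)) (r (Some b)) \<le> gdist T (Some a) (Some b)"
      by (rule gdist_hom_le[where f = r, OF wfT wfH])
        (use a F symH in \<open>auto simp: vT aT r_def\<close>)
    then show ?thesis by (simp add: r_def)
  qed
  have "0 < d" using d(2) by simp
  moreover have "connected (with_proj H)"
    unfolding connected_iff[OF H] using diam_enatD(1)[OF H d(1)] u by blast
  ultimately obtain a b where ab: "a \<in> pverts H" "b \<in> pverts H" "rdist (parcs H) a b = d"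
    using diam_attained[OF H _ d(1)] by blast
  have "enat d \<le> gdist T (Some a) (Some b)"
    using down[OF ab(1), of b] diam_enatD(2)[OF H d(1) ab(1,2)] ab(3) by simp
  then have "diam T = enat d" using ab by (intro diam_eqI[OF upper]) (auto simp: vT)
  then show ?thesis using pgT by simp
qed

text \<open>The last conjunct is there for the induction: in a coalescence \<open>y\<close> is only
  known to be identifiable in \<open>H2\<close>, while the diameters add up at diametrical
  vertices.\<close>

lemma family_F_star_diam:
  assumes "family_F_star k G"
  shows "pair_graph G \<and> diam G = enat (2 * k - 2) \<and> (\<forall>y. identifiable k G y \<longrightarrow> diametrical G y)"
  using assms
proof (induction rule: family_F_star.induct)
  case (co_K2 m G)
  have "pair_graph G" by (rule isomorphic_pair_graph[OF co_K2(2) pair_graph_co_mK2])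
  moreover have "diam G = 2" using isomorphic_diam[OF co_K2(2)] diam_co_mK2[of "m + 1"] co_K2(1) by simp
  ultimately show ?case using V_minus_diametrical by (auto simp: identifiable_def numeral_eq_enat)
next
  case (co_K2_K3 m G)
  have "pair_graph G"
    by (rule isomorphic_pair_graph[OF co_K2_K3(2)])
      (intro pair_graph_complement pair_graph_disjoint_union pair_graph_copies pair_graph_complete)
  moreover have "diam G = 2"
    using isomorphic_diam[OF co_K2_K3(2)] diam_co_union[OF co_K2_K3(1)] by (simp add: complete_graph_def)
  ultimately show ?case using V_minus_diametrical by (auto simp: identifiable_def numeral_eq_enat)
next
  case (co_K2_P3 m G)
  have "pair_graph G"
    by (rule isomorphic_pair_graph[OF co_K2_P3(2)])
      (intro pair_graph_complement pair_graph_disjoint_union pair_graph_copies pair_graph_complete pair_graph_path)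
  moreover have "diam G = 2"
    using isomorphic_diam[OF co_K2_P3(2)] diam_co_union[OF co_K2_P3(1)] by (simp add: path_graph_def)
  ultimately show ?case using V_minus_diametrical by (auto simp: identifiable_def numeral_eq_enat)
next
  case (coalesced k1 k2 k H1 x H2 y G)
  have H1: "pair_graph H1" "diam H1 = enat (2 * k1 - 2)" using family_F_diam[OF coalesced(4)] by auto
  have H2: "pair_graph H2" "diam H2 = enat (2 * k2 - 2)" "diametrical H2 y" using coalesced by auto
  note C = coalesce_diam[OF H1(1) H2(1) H1(2) H2(2) coalesced(5) H2(3)]
  have "pair_graph G" using isomorphic_pair_graph[OF coalesced.hyps(8)] C by simp
  moreover have "diam G = enat (2 * k - 2)"
    using isomorphic_diam[OF coalesced.hyps(8)] C coalesced(1-3) by (simp add: algebra_simps)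
  ultimately show ?case using coalesced(1-3) by (auto simp: identifiable_def)
next
  case (twin H u G)
  have H: "pair_graph H" "diam H = enat 4" using family_F_diam[OF twin(1)] by auto
  have u: "u \<in> pverts H" using twin(2) by (simp add: cut_vertex_def)
  have "pair_graph (add_twin H u) \<and> diam (add_twin H u) = enat 4"
    by (rule twin_diam[OF H _ u, where F = "{}"]) auto
  then show ?case
    using isomorphic_pair_graph[OF twin(3)] isomorphic_diam[OF twin(3)] by (auto simp: identifiable_def)
next
  case (adjacent_twin H u G)
  have H: "pair_graph H" "diam H = enat 4" using family_F_diam[OF adjacent_twin(1)] by auto
  have u: "u \<in> pverts H" using adjacent_twin(2) by (simp add: cut_vertex_def)
  let ?T = "add_edge (add_twin H u) (Some u) None"
  have "pair_graph ?T \<and> diam ?T = enat 4"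
    by (rule twin_diam[OF H _ u, where F = "{(Some u, None), (None, Some u)}"]) (auto simp: add_edge_def)
  then show ?case
    using isomorphic_pair_graph[OF adjacent_twin(3)] isomorphic_diam[OF adjacent_twin(3)] by (auto simp: identifiable_def)
qed

theorem theorem1:
  fixes k :: nat and G :: "'a sgraph"
  assumes "k \<ge> 2"
    and "pair_graph G"
    and "connected (with_proj G)"
    and "weak_k_bicritical k G"
  shows "diam G \<le> enat (2 * k - 2) \<and> (diam G = enat (2 * k - 2) \<longleftrightarrow> family_F_star k G)"
proof -
  interpret C: connected_weak_bicritical "pverts G" "parcs G" k
    by (rule connected_weak_bicriticalI[OF assms(2-4,1)])
  have wf: "pair_wf_digraph G" using assms(2) by (simp add: pair_graph_iff pair_wf_digraph_iff)
  have "gdist G x y \<le> enat (2 * k - 2)" if "x \<in> pverts G" "y \<in> pverts G" for x y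
    using C.rdist_bound[OF that] gdist_eq_rdist[OF wf that(1) C.conn[OF that]] by simp
  then have "diam G \<le> enat (2 * k - 2)" by (simp add: diam_le_iff)
  then show ?thesis using extremal_family[OF assms] family_F_star_diam[of k G] by blast
qed

end
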